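(* Let $n\ge2$. For a non-totally-geodesic constant curvature $1$ front $f:M^n\to S^{n+1}$, its caustic $f^C:M^n\setminus\mathcal{U}_f\to S^{n+1}$ is also a constant curvature $1$ front, without umbilic points. Moreover, if $f:\mathbb{R}\times S^{n-1}\to S^{n+1}$ is the developable tube of a regular curve $\gamma=\gamma(s)$, then the unit tangent vector $e=\gamma'/|\gamma'|$ gives the center curve of $f^C$.
   Context: $S^{n+1}\subset\mathbb{R}^{n+2}$ is the unit sphere. A smooth map $f:M^n\to S^{n+1}$ is a frontal if every point has a neighborhood $U$ with a smooth map $\nu:U\to S^{n+1}$ with $\langle f,\nu\rangle=0$ and $\langle df(v),\nu\rangle=0$ for all tangent $v$ (local unit normal). It is a front if there is no $v\ne0$ with $df(v)=0$ and $d\nu(v)=0$. It is totally geodesic if $d\nu=0$ identically. $f$ has constant curvature $1$ if $R^D(X,Y)\xi=\langle df(Y),\xi\rangle df(X)-\langle df(X),\xi\rangle df(Y)$ for all vector fields $X,Y$ and sections $\xi$ of $\mathcal{E}_f$, where $\mathcal{E}_f\subset f^*TS^{n+1}$ is the subbundle perpendicular to $\nu$, $D$ is the connection on $\mathcal{E}_f$ given by the tangential part of the Levi-Civita connection of $S^{n+1}$, and $R^D(X,Y)\xi=D_XD_Y\xi-D_YD_X\xi-D_{[X,Y]}\xi$. A point $p$ is umbilic if $\delta_1(df)_p=\delta_2(d\nu)_p$ for some $(\delta_1,\delta_2)\neq(0,0)$; $\mathcal{U}_f$ is the set of umbilic points. For a constant curvature $1$ front, at each $p\in M^n\setminus\mathcal{U}_f$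 there is a unique real number $\rho(p)$ such that $df_p(v)=-\rho(p)\,d\nu_p(v)$ for some $v\in T_pM^n$ with $d\nu_p(v)\neq0$. The caustic of a non-totally-geodesic constant curvature $1$ front $f$ is $$f^C=\frac{1}{\sqrt{1+\rho^2}}(f+\rho\nu):M^n\setminus\mathcal{U}_f\to S^{n+1}.$$ Developable tube: for a complete regular curve $\gamma:\mathbb{R}\to S^{n+1}$, choose smooth $e_1(s),\dots,e_n(s)\in\mathbb{R}^{n+2}$ forming an orthonormal basis of the orthogonal complement of $\mathrm{span}\{\gamma(s),\gamma'(s)\}$; the developable tube of $\gamma$ is $F_\gamma:\mathbb{R}\times S^{n-1}\to S^{n+1}$, $F_\gamma(s,x)=\sum_{i=1}^n x_ie_i(s)$ (it has no umbilic points). A regular curve $\delta:\mathbb{R}\to S^{n+1}$ gives the center curve of $h:\mathbb{R}\times S^{n-1}\to S^{n+1}$ if $h=F_\delta\circ\Phi$ for some diffeomorphism $\Phi$ of $\mathbb{R}\times S^{n-1}$ of the form $\Phi(s,x)=(s,\phi_s(x))$. *)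

theory Defs
  imports "HOL-Analysis.Analysis"
begin

section \<open>Smooth maps between Euclidean spaces\<close>

(* C^k on an open set, through iterated directional derivatives. *)
fun C_k_on :: "nat \<Rightarrow> ('v::real_normed_vector \<Rightarrow> 'w::real_normed_vector) \<Rightarrow> 'v set \<Rightarrow> bool" where
  "C_k_on 0 f S \<longleftrightarrow> continuous_on S f"
| "C_k_on (Suc k) f S \<longleftrightarrow>
     (\<forall>x\<in>S. f differentiable (at x)) \<and>
     (\<forall>v. C_k_on k (\<lambda>x. frechet_derivative f (at x) v) S)"

definition smooth_on :: "('v::real_normed_vector \<Rightarrow> 'w::real_normed_vector) \<Rightarrow> 'v set \<Rightarrow> bool" where
  "smooth_on f S \<longleftrightarrow> (\<forall>k. C_k_on k f S)"

section \<open>Smooth manifolds\<close>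

type_synonym ('a, 'v) chart = "'a set \<times> ('a \<Rightarrow> 'v)"

(* The underlying set is the topspace of mtop; the dimension is DIM('v). The atlas need not be
   maximal. *)
record ('a, 'v) manifold =
  mtop :: "'a topology"
  atlas :: "('a, 'v) chart set"

abbreviation points :: "('a, 'v) manifold \<Rightarrow> 'a set" where
  "points M \<equiv> topspace (mtop M)"

abbreviation chart_inv :: "('a, 'v) chart \<Rightarrow> 'v \<Rightarrow> 'a" where
  "chart_inv c \<equiv> inv_into (fst c) (snd c)"

abbreviation charts_at :: "('a, 'v) manifold \<Rightarrow> 'a \<Rightarrow> ('a, 'v) chart set" where
  "charts_at M p \<equiv> {c \<in> atlas M. p \<in> fst c}"

definition smooth_manifold :: "('a, 'v::euclidean_space) manifold \<Rightarrow> bool" where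
  "smooth_manifold M \<longleftrightarrow>
     Hausdorff_space (mtop M) \<and> second_countable (mtop M) \<and>
     \<Union> (fst ` atlas M) = points M \<and>
     (\<forall>(U, \<phi>) \<in> atlas M. openin (mtop M) U \<and> open (\<phi> ` U) \<and>
        homeomorphic_map (subtopology (mtop M) U) (top_of_set (\<phi> ` U)) \<phi>) \<and>
     (\<forall>(U, \<phi>) \<in> atlas M. \<forall>(V, \<psi>) \<in> atlas M.
        smooth_on (\<psi> \<circ> inv_into U \<phi>) (\<phi> ` (U \<inter> V)))"

definition open_submanifold :: "('a, 'v) manifold \<Rightarrow> 'a set \<Rightarrow> ('a, 'v) manifold" where
  "open_submanifold M W =
     \<lparr> mtop = subtopology (mtop M) W, atlas = {(U \<inter> W, \<phi>) | U \<phi>. (U, \<phi>) \<in> atlas M} \<rparr>"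

(* Smoothness, on an open subset W of M, of a map into a Euclidean space. *)
definition smooth_fun_on ::
    "('a, 'v::euclidean_space) manifold \<Rightarrow> 'a set \<Rightarrow> ('a \<Rightarrow> 'e::euclidean_space) \<Rightarrow> bool" where
  "smooth_fun_on M W g \<longleftrightarrow>
     (\<forall>(U, \<phi>) \<in> atlas M. smooth_on (g \<circ> inv_into U \<phi>) (\<phi> ` (U \<inter> W)))"

definition smooth_map ::
    "('a, 'v::euclidean_space) manifold \<Rightarrow> ('b, 'w::euclidean_space) manifold \<Rightarrow> ('a \<Rightarrow> 'b) \<Rightarrow> bool" where
  "smooth_map M N F \<longleftrightarrow>
     continuous_map (mtop M) (mtop N) F \<and>
     (\<forall>(U, \<phi>) \<in> atlas M. \<forall>(V, \<psi>) \<in> atlas N.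
        smooth_on (\<psi> \<circ> F \<circ> inv_into U \<phi>) (\<phi> ` {p \<in> U. F p \<in> V}))"

definition diffeomorphism ::
    "('a, 'v::euclidean_space) manifold \<Rightarrow> ('b, 'w::euclidean_space) manifold \<Rightarrow> ('a \<Rightarrow> 'b) \<Rightarrow> bool" where
  "diffeomorphism M N F \<longleftrightarrow>
     bij_betw F (points M) (points N) \<and> smooth_map M N F \<and>
     smooth_map N M (inv_into (points M) F)"

(* A tangent vector at p is the family of its components in the charts around p, related by the
   derivatives of the chart changes. Components in all other charts are set to 0, so that the
   zero vector is the constant family. *)
type_synonym ('a, 'v) tangent = "('a, 'v) chart \<Rightarrow> 'v"

definition tangent_space ::
    "('a, 'v::euclidean_space) manifold \<Rightarrow> 'a \<Rightarrow> ('a, 'v) tangent set" where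
  "tangent_space M p =
     {v. (\<forall>c. c \<notin> charts_at M p \<longrightarrow> v c = 0) \<and>
         (\<forall>c \<in> charts_at M p. \<forall>c' \<in> charts_at M p.
            v c' = frechet_derivative (snd c' \<circ> chart_inv c) (at (snd c p)) (v c))}"

(* dg_p(v), computed in some chart around p; by the chain rule the chart is irrelevant. *)
definition differential ::
    "('a, 'v::euclidean_space) manifold \<Rightarrow> ('a \<Rightarrow> 'e::euclidean_space) \<Rightarrow> 'a \<Rightarrow> ('a, 'v) tangent \<Rightarrow> 'e" where
  "differential M g p v =
     (let c = (SOME c. c \<in> charts_at M p)
      in frechet_derivative (g \<circ> chart_inv c) (at (snd c p)) (v c))"

definition vector_field ::
    "('a, 'v::euclidean_space) manifold \<Rightarrow> ('a \<Rightarrow> ('a, 'v) tangent) \<Rightarrow> bool" where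
  "vector_field M X \<longleftrightarrow>
     (\<forall>p \<in> points M. X p \<in> tangent_space M p) \<and>
     (\<forall>c \<in> atlas M. smooth_on (\<lambda>x. X (chart_inv c x) c) (snd c ` fst c))"

definition lie_bracket ::
    "('a, 'v::euclidean_space) manifold \<Rightarrow> ('a \<Rightarrow> ('a, 'v) tangent) \<Rightarrow> ('a \<Rightarrow> ('a, 'v) tangent) \<Rightarrow>
     ('a \<Rightarrow> ('a, 'v) tangent)" where
  "lie_bracket M X Y p c =
     (if c \<in> charts_at M p
      then frechet_derivative (\<lambda>x. Y (chart_inv c x) c) (at (snd c p)) (X p c)
         - frechet_derivative (\<lambda>x. X (chart_inv c x) c) (at (snd c p)) (Y p c)
      else 0)"

section \<open>Frontals and fronts in the unit sphere\<close>

(* The unit normal of a frontal is given only locally and up to sign, and at singular points it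
   need not be determined by f. The bundle E, with fibre E p the orthogonal complement of
   {f p, \<nu> p}, is therefore carried along as data; the local unit normals of (f, E) are those
   defining E. *)
definition local_unit_normal ::
    "('a, 'v::euclidean_space) manifold \<Rightarrow> ('a \<Rightarrow> 'e::euclidean_space) \<Rightarrow> ('a \<Rightarrow> 'e set) \<Rightarrow>
     'a set \<Rightarrow> ('a \<Rightarrow> 'e) \<Rightarrow> bool" where
  "local_unit_normal M f E U \<nu> \<longleftrightarrow>
     openin (mtop M) U \<and> smooth_fun_on M U \<nu> \<and>
     (\<forall>p \<in> U. \<nu> p \<in> sphere 0 1 \<and> f p \<bullet> \<nu> p = 0 \<and>
        (\<forall>v \<in> tangent_space M p. differential M f p v \<bullet> \<nu> p = 0) \<and>
        E p = {w. w \<bullet> f p = 0 \<and> w \<bullet> \<nu> p = 0})"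

definition frontal ::
    "('a, 'v::euclidean_space) manifold \<Rightarrow> ('a \<Rightarrow> 'e::euclidean_space) \<Rightarrow> ('a \<Rightarrow> 'e set) \<Rightarrow> bool" where
  "frontal M f E \<longleftrightarrow>
     smooth_manifold M \<and> smooth_fun_on M (points M) f \<and> f ` points M \<subseteq> sphere 0 1 \<and>
     (\<forall>p \<in> points M. \<exists>U \<nu>. p \<in> U \<and> local_unit_normal M f E U \<nu>)"

definition front ::
    "('a, 'v::euclidean_space) manifold \<Rightarrow> ('a \<Rightarrow> 'e::euclidean_space) \<Rightarrow> ('a \<Rightarrow> 'e set) \<Rightarrow> bool" where
  "front M f E \<longleftrightarrow> frontal M f E \<and>
     (\<forall>U \<nu>. local_unit_normal M f E U \<nu> \<longrightarrow>
        (\<forall>p \<in> U. \<not> (\<exists>v \<in> tangent_space M p. v \<noteq> (\<lambda>_. 0) \<and>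
           differential M f p v = 0 \<and> differential M \<nu> p v = 0)))"

definition totally_geodesic ::
    "('a, 'v::euclidean_space) manifold \<Rightarrow> ('a \<Rightarrow> 'e::euclidean_space) \<Rightarrow> ('a \<Rightarrow> 'e set) \<Rightarrow> bool" where
  "totally_geodesic M f E \<longleftrightarrow>
     (\<forall>U \<nu>. local_unit_normal M f E U \<nu> \<longrightarrow>
        (\<forall>p \<in> U. \<forall>v \<in> tangent_space M p. differential M \<nu> p v = 0))"

definition section_of ::
    "('a, 'v::euclidean_space) manifold \<Rightarrow> ('a \<Rightarrow> 'e::euclidean_space set) \<Rightarrow> ('a \<Rightarrow> 'e) \<Rightarrow> bool" where
  "section_of M E \<xi> \<longleftrightarrow> smooth_fun_on M (points M) \<xi> \<and> (\<forall>p \<in> points M. \<xi> p \<in> E p)"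

definition orth_proj :: "'e::euclidean_space set \<Rightarrow> 'e \<Rightarrow> 'e" where
  "orth_proj S w = (THE y. y \<in> S \<and> (\<forall>z \<in> S. orthogonal (w - y) z))"

(* Levi-Civita connection of the unit sphere, acting on fields along f. *)
definition sphere_conn ::
    "('a, 'v::euclidean_space) manifold \<Rightarrow> ('a \<Rightarrow> 'e::euclidean_space) \<Rightarrow> ('a \<Rightarrow> ('a, 'v) tangent) \<Rightarrow>
     ('a \<Rightarrow> 'e) \<Rightarrow> 'a \<Rightarrow> 'e" where
  "sphere_conn M f X \<xi> p =
     differential M \<xi> p (X p) - (differential M \<xi> p (X p) \<bullet> f p) *\<^sub>R f p"

definition conn ::
    "('a, 'v::euclidean_space) manifold \<Rightarrow> ('a \<Rightarrow> 'e::euclidean_space) \<Rightarrow> ('a \<Rightarrow> 'e set) \<Rightarrow>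
     ('a \<Rightarrow> ('a, 'v) tangent) \<Rightarrow> ('a \<Rightarrow> 'e) \<Rightarrow> 'a \<Rightarrow> 'e" where
  "conn M f E X \<xi> p = orth_proj (E p) (sphere_conn M f X \<xi> p)"

definition conn_curvature ::
    "('a, 'v::euclidean_space) manifold \<Rightarrow> ('a \<Rightarrow> 'e::euclidean_space) \<Rightarrow> ('a \<Rightarrow> 'e set) \<Rightarrow>
     ('a \<Rightarrow> ('a, 'v) tangent) \<Rightarrow> ('a \<Rightarrow> ('a, 'v) tangent) \<Rightarrow> ('a \<Rightarrow> 'e) \<Rightarrow> 'a \<Rightarrow> 'e" where
  "conn_curvature M f E X Y \<xi> p =
     conn M f E X (conn M f E Y \<xi>) p - conn M f E Y (conn M f E X \<xi>) p
     - conn M f E (lie_bracket M X Y) \<xi> p"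

definition constant_curvature_one ::
    "('a, 'v::euclidean_space) manifold \<Rightarrow> ('a \<Rightarrow> 'e::euclidean_space) \<Rightarrow> ('a \<Rightarrow> 'e set) \<Rightarrow> bool" where
  "constant_curvature_one M f E \<longleftrightarrow>
     (\<forall>X Y \<xi>. vector_field M X \<and> vector_field M Y \<and> section_of M E \<xi> \<longrightarrow>
        (\<forall>p \<in> points M. conn_curvature M f E X Y \<xi> p =
           (differential M f p (Y p) \<bullet> \<xi> p) *\<^sub>R differential M f p (X p)
         - (differential M f p (X p) \<bullet> \<xi> p) *\<^sub>R differential M f p (Y p)))"

definition cc1_front ::
    "('a, 'v::euclidean_space) manifold \<Rightarrow> ('a \<Rightarrow> 'e::euclidean_space) \<Rightarrow> ('a \<Rightarrow> 'e set) \<Rightarrow> bool" where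
  "cc1_front M f E \<longleftrightarrow> front M f E \<and> constant_curvature_one M f E"

definition umbilics ::
    "('a, 'v::euclidean_space) manifold \<Rightarrow> ('a \<Rightarrow> 'e::euclidean_space) \<Rightarrow> ('a \<Rightarrow> 'e set) \<Rightarrow> 'a set" where
  "umbilics M f E =
     {p \<in> points M. \<exists>U \<nu>. p \<in> U \<and> local_unit_normal M f E U \<nu> \<and>
        (\<exists>d1 d2 :: real. (d1, d2) \<noteq> (0, 0) \<and>
           (\<forall>v \<in> tangent_space M p. d1 *\<^sub>R differential M f p v = d2 *\<^sub>R differential M \<nu> p v))}"

definition caustic_radius ::
    "('a, 'v::euclidean_space) manifold \<Rightarrow> ('a \<Rightarrow> 'e::euclidean_space) \<Rightarrow> ('a \<Rightarrow> 'e) \<Rightarrow> 'a \<Rightarrow> real" where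
  "caustic_radius M f \<nu> p =
     (THE r. \<exists>v \<in> tangent_space M p. differential M \<nu> p v \<noteq> 0 \<and>
        differential M f p v = - r *\<^sub>R differential M \<nu> p v)"

(* Replacing \<nu> by -\<nu> changes the sign of the radius, so the value at p is independent of the
   chosen local unit normal. *)
definition caustic ::
    "('a, 'v::euclidean_space) manifold \<Rightarrow> ('a \<Rightarrow> 'e::euclidean_space) \<Rightarrow> ('a \<Rightarrow> 'e set) \<Rightarrow> 'a \<Rightarrow> 'e" where
  "caustic M f E p =
     (let \<nu> = (SOME \<nu>. \<exists>U. p \<in> U \<and> local_unit_normal M f E U \<nu>);
          \<rho> = caustic_radius M f \<nu> p
      in (1 / sqrt (1 + \<rho>\<^sup>2)) *\<^sub>R (f p + \<rho> *\<^sub>R \<nu> p))"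

section \<open>Developable tubes\<close>

definition regular_curve :: "(real \<Rightarrow> 'e::euclidean_space) \<Rightarrow> bool" where
  "regular_curve \<gamma> \<longleftrightarrow> smooth_on \<gamma> UNIV \<and>
     (\<forall>s. \<gamma> s \<in> sphere 0 1 \<and> vector_derivative \<gamma> (at s) \<noteq> 0)"

(* Completeness of the Riemannian metric induced on the real line, whose distance is arc length. *)
definition complete_curve :: "(real \<Rightarrow> 'e::euclidean_space) \<Rightarrow> bool" where
  "complete_curve \<gamma> \<longleftrightarrow>
     Metric_space.mcomplete UNIV
       (\<lambda>a b. integral {min a b..max a b} (\<lambda>t. norm (vector_derivative \<gamma> (at t))))"

(* The product of the real line and the unit sphere of real^'n. On the half cylinder where
   \<sigma> * x_i > 0 (\<sigma> = 1 or \<sigma> = -1), the coordinates are the x_j with j \<noteq> i, and s is put in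
   the free slot i. *)
definition cylinder :: "(real \<times> (real^'n), real^'n) manifold" where
  "cylinder =
     \<lparr> mtop = top_of_set (UNIV \<times> sphere 0 1),
       atlas = {({(s, x). x \<in> sphere 0 1 \<and> 0 < \<sigma> * x $ i}, \<lambda>(s, x). \<chi> j. if j = i then s else x $ j)
                | i \<sigma>. \<sigma> \<in> {-1, 1}} \<rparr>"

definition developable_tube ::
    "(real \<Rightarrow> 'e::euclidean_space) \<Rightarrow> (real \<times> (real^'n) \<Rightarrow> 'e) \<Rightarrow> bool" where
  "developable_tube \<gamma> F \<longleftrightarrow> regular_curve \<gamma> \<and> complete_curve \<gamma> \<and>
     (\<exists>e :: 'n \<Rightarrow> real \<Rightarrow> 'e.
        (\<forall>i. smooth_on (e i) UNIV) \<and>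
        (\<forall>s. (\<forall>i j. e i s \<bullet> e j s = (if i = j then 1 else 0)) \<and>
             span (range (\<lambda>i. e i s)) =
               orthogonal_comp (span {\<gamma> s, vector_derivative \<gamma> (at s)})) \<and>
        (\<forall>s. \<forall>x \<in> sphere 0 1. F (s, x) = (\<Sum>i\<in>UNIV. x $ i *\<^sub>R e i s)))"

definition center_curve ::
    "(real \<Rightarrow> 'e::euclidean_space) \<Rightarrow> (real \<times> (real^'n) \<Rightarrow> 'e) \<Rightarrow> bool" where
  "center_curve \<delta> h \<longleftrightarrow> regular_curve \<delta> \<and>
     (\<exists>(F :: real \<times> (real^'n) \<Rightarrow> 'e) \<Phi> \<phi>. developable_tube \<delta> F \<and>
        diffeomorphism cylinder cylinder \<Phi> \<and>
        (\<forall>s. \<forall>x \<in> sphere 0 1. \<Phi> (s, x) = (s, \<phi> s x)) \<and>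
        (\<forall>p \<in> UNIV \<times> sphere 0 1. h p = F (\<Phi> p)))"

definition unit_tangent :: "(real \<Rightarrow> 'e::euclidean_space) \<Rightarrow> real \<Rightarrow> 'e" where
  "unit_tangent \<gamma> s = vector_derivative \<gamma> (at s) /\<^sub>R norm (vector_derivative \<gamma> (at s))"

end

theory Submission
  imports Defs
begin

text \<open>
  In a chart a front is a pair \<open>F, N\<close> of maps with \<open>dF \<bullet> N = 0\<close>, and the Gauss equation says that
  the curvature of the bundle is one iff \<open>dN\<close> has rank at most one everywhere. If \<open>n \<ge> 2\<close>, the
  umbilics are then the zeros of \<open>dN\<close>. Elsewhere \<open>dN = \<alpha> e\<close> with a one-form \<open>\<alpha>\<close> and a unit
  vector \<open>e\<close>. By the symmetry of \<open>dF \<bullet> dN\<close>, the image of \<open>dF + \<rho> dN\<close> is orthogonal to \<open>e\<close>, so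
  that \<open>e\<close> is a unit normal of the caustic; the symmetry of the second derivative of \<open>N\<close> gives
  \<open>\<alpha>(x) de(y) = \<alpha>(y) de(x)\<close>, so \<open>de\<close> has rank one, and \<open>de \<bullet> N = - \<alpha>\<close> shows that \<open>de\<close> does
  not vanish and that the caustic is a front.

  A developable tube has unit normal \<open>\<gamma>\<close> with \<open>d\<gamma> = \<gamma>' ds\<close>. Its points move in the direction of
  \<open>T = \<gamma>' / |\<gamma>'|\<close> with speed \<open>- f \<bullet> T'\<close> along a suitable tangent vector over \<open>d/ds\<close>. This
  determines \<open>\<rho> = f \<bullet> T' / |\<gamma>'|\<close>, also at the singular points \<open>f \<bullet> T' = 0\<close>, where the frontal may
  have other normals but the front condition forces \<open>\<rho> = 0\<close>. Hence the caustic at \<open>s\<close> takes its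
  values in the unit sphere of the complement of \<open>T\<close> and \<open>T'\<close>, and a frame of this complement is
  obtained by rotating the frame of the tube from \<open>\<gamma>\<close> to \<open>- T' / |T'|\<close>.
\<close>


section \<open>Calculus of smooth maps\<close>

text \<open>The curvature hypothesis speaks of global vector fields and sections, the rank of dN of
  a single point. Values prescribed at p are therefore extended by bump functions, without control
  away from p; this is enough because the Gauss equation expresses the curvature at p through the
  values at p. The radius \<rho> exists by counting dimensions: dF + \<rho> dN maps an n-dimensional
  space into the complement of F, N and e in a space of dimension n + 2, so it has a kernel, on
  whose nonzero vectors dN cannot vanish, by the front condition. The normal e depends on a chart,
  on a direction and on a sign. The bundle of the caustic is therefore described through the image
  of the differential of \<nu>, which is a line and has none of these choices. For tubes, the
  identity \<gamma> \<bullet> T' = - |\<gamma>'| does three things: T' has no zeros, so that T is a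
  regular curve; |T'| is at least |\<gamma>'|, so that T inherits completeness; and \<gamma> makes
  an acute angle with - T', so that the denominator in the formula of the rotation between them does
  not vanish.\<close>

abbreviation fderiv where "fderiv f x \<equiv> frechet_derivative f (at x)"

text \<open>Differentiability is not assumed: \<open>frechet_derivative\<close> is a choice among
  the derivatives at x, and functions that agree near x have the same ones.\<close>

lemma frechet_derivative_cong_open:
  assumes "open S" "x \<in> S" "\<And>y. y \<in> S \<Longrightarrow> f y = g y"
  shows "fderiv f x = fderiv g x"
proof -
  have "(f has_derivative D) (at x) \<longleftrightarrow> (g has_derivative D) (at x)" for D
    using has_derivative_transform_within_open[of f D x UNIV S g]
      has_derivative_transform_within_open[of g D x UNIV S f] assms by auto
  then show ?thesis by (simp add: frechet_derivative_def)
qed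

lemma frechet_derivative_eqI:
  "(f has_derivative D) (at x) \<Longrightarrow> fderiv f x = D"
  by (metis frechet_derivative_at)

lemma C_k_on_SucI:
  "(\<And>x. x \<in> S \<Longrightarrow> f differentiable (at x)) \<Longrightarrow>
    (\<And>v. C_k_on k (\<lambda>x. fderiv f x v) S) \<Longrightarrow> C_k_on (Suc k) f S"
  by simp

lemma C_k_on_mono: "C_k_on k f S \<Longrightarrow> T \<subseteq> S \<Longrightarrow> C_k_on k f T"
  by (induction k arbitrary: f) (auto intro: continuous_on_subset)

lemma C_k_on_cong:
  assumes "open S" "C_k_on k f S" "\<And>x. x \<in> S \<Longrightarrow> f x = g x"
  shows "C_k_on k g S"
  using assms(2,3)
proof (induction k arbitrary: f g)
  case 0
  have "continuous_on S f \<longleftrightarrow> continuous_on S g"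
    by (rule continuous_on_cong[OF refl 0(2)])
  with 0(1) show ?case by (simp only: C_k_on.simps(1))
next
  case (Suc k)
  have "g differentiable at x" if "x \<in> S" for x
  proof -
    have "f differentiable (at x)" using Suc.prems(1) that by simp
    then obtain D where "(f has_derivative D) (at x)" by (auto simp: differentiable_def)
    then have "(g has_derivative D) (at x)"
      by (rule has_derivative_transform_within_open[OF _ assms(1) that Suc.prems(2)])
    then show ?thesis by (auto simp: differentiable_def)
  qed
  moreover have "C_k_on k (\<lambda>x. fderiv g x v) S" for v
  proof (rule Suc.IH)
    show "C_k_on k (\<lambda>x. fderiv f x v) S" using Suc.prems by auto
    show "fderiv f x v = fderiv g x v" if "x \<in> S" for x
      using frechet_derivative_cong_open[OF assms(1) that, of f g] Suc.prems(2) by simp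
  qed
  ultimately show ?case by auto
qed

lemma C_k_on_SucD: "C_k_on (Suc k) f S \<Longrightarrow> C_k_on k f S"
proof (induction k arbitrary: f)
  case 0
  then show ?case
    by (auto intro!: continuous_at_imp_continuous_on differentiable_imp_continuous_within)
next
  case (Suc k)
  from Suc.prems have "\<forall>x\<in>S. f differentiable (at x)"
    and "\<And>v. C_k_on (Suc k) (\<lambda>x. fderiv f x v) S"
    unfolding C_k_on.simps(2)[of "Suc k"] by blast+
  then show ?case by - (rule C_k_on_SucI, blast, rule Suc.IH, blast)
qed

lemma C_k_on_local:
  assumes "\<And>x. x \<in> S \<Longrightarrow> \<exists>T. open T \<and> x \<in> T \<and> C_k_on k f T"
  shows "C_k_on k f S"
  using assms
proof (induction k arbitrary: f)
  case 0
  have "isCont f x" if "x \<in> S" for x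
    using 0[OF that] by (auto simp: continuous_on_eq_continuous_at)
  then show ?case by (simp add: continuous_at_imp_continuous_on)
next
  case (Suc k)
  have "f differentiable (at x)" if "x \<in> S" for x
    using Suc.prems[OF that] by auto
  moreover have "C_k_on k (\<lambda>x. fderiv f x v) S" for v
  proof (rule Suc.IH)
    show "\<exists>T. open T \<and> x \<in> T \<and> C_k_on k (\<lambda>x. fderiv f x v) T" if "x \<in> S" for x
      using Suc.prems[OF that] by auto
  qed
  ultimately show ?case by simp
qed

lemma C_k_on_const: "C_k_on k (\<lambda>x. c) S"
  by (induction k arbitrary: c) auto

lemma C_k_on_bounded_linear:
  assumes "bounded_linear h"
  shows "C_k_on k h S"
proof (cases k)
  case 0
  then show ?thesis by (simp add: assms linear_continuous_on)
next
  case (Suc k)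
  have "fderiv h x = h" for x
    by (rule frechet_derivative_eqI) (rule bounded_linear_imp_has_derivative[OF assms])
  then show ?thesis using Suc bounded_linear_imp_differentiable[OF assms]
    by (auto intro: C_k_on_const)
qed

lemma C_k_on_add:
  assumes "open S" "C_k_on k f S" "C_k_on k g S"
  shows "C_k_on k (\<lambda>x. f x + g x) S"
  using assms(2,3)
proof (induction k arbitrary: f g)
  case 0
  then show ?case by (auto intro: continuous_on_add)
next
  case (Suc k)
  have "C_k_on k (\<lambda>x. fderiv (\<lambda>x. f x + g x) x v) S" for v
  proof (rule C_k_on_cong[OF assms(1)])
    show "C_k_on k (\<lambda>x. fderiv f x v + fderiv g x v) S"
      using Suc by auto
    show "fderiv f x v + fderiv g x v =
        fderiv (\<lambda>x. f x + g x) x v" if "x \<in> S" for x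
    proof -
      have "((\<lambda>x. f x + g x) has_derivative
          (\<lambda>v. fderiv f x v + fderiv g x v)) (at x)"
        using Suc.prems that by (intro has_derivative_add) (auto simp: frechet_derivative_works)
      from frechet_derivative_eqI[OF this] show ?thesis by simp
    qed
  qed
  then show ?case using Suc.prems by auto
qed

lemma (in bounded_bilinear) C_k_on:
  assumes "open S" "C_k_on k f S" "C_k_on k g S"
  shows "C_k_on k (\<lambda>x. prod (f x) (g x)) S"
  using assms(2,3)
proof (induction k arbitrary: f g)
  case 0
  then show ?case by (auto intro: continuous_on)
next
  case (Suc k)
  have *: "((\<lambda>x. prod (f x) (g x)) has_derivative
          (\<lambda>v. prod (f x) (fderiv g x v) +
               prod (fderiv f x v) (g x))) (at x)" if "x \<in> S" for x
    using Suc.prems that by (intro FDERIV) (auto simp: frechet_derivative_works)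
  have "C_k_on k (\<lambda>x. fderiv (\<lambda>x. prod (f x) (g x)) x v) S" for v
  proof (rule C_k_on_cong[OF assms(1)])
    show "C_k_on k (\<lambda>x. prod (f x) (fderiv g x v) +
               prod (fderiv f x v) (g x)) S"
      using Suc C_k_on_SucD[OF Suc.prems(1)] C_k_on_SucD[OF Suc.prems(2)]
      by (intro C_k_on_add assms(1)) auto
  qed (simp add: frechet_derivative_eqI[OF *])
  then show ?case using * by (auto simp: differentiable_def)
qed

lemma C_k_on_sum:
  assumes "open S" "\<And>i. i \<in> I \<Longrightarrow> C_k_on k (f i) S"
  shows "C_k_on k (\<lambda>x. \<Sum>i\<in>I. f i x) S"
  using assms(2)
  by (induction I rule: infinite_finite_induct) (auto intro: C_k_on_const C_k_on_add[OF assms(1)])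

lemma C_k_on_compose:
  fixes f :: "'b::euclidean_space \<Rightarrow> 'c::real_normed_vector"
  assumes "open S" "C_k_on k f T" "C_k_on k g S" "g ` S \<subseteq> T"
  shows "C_k_on k (\<lambda>x. f (g x)) S"
  using assms(2,3)
proof (induction k arbitrary: f)
  case 0
  then show ?case using assms(4) by (auto intro: continuous_on_compose2)
next
  case (Suc k)
  have *: "((\<lambda>x. f (g x)) has_derivative
      (\<lambda>v. fderiv f (g x) (fderiv g x v))) (at x)"
    if "x \<in> S" for x
  proof (rule has_derivative_compose[where f=g and g=f])
    show "(g has_derivative fderiv g x) (at x)"
      using Suc.prems(2) that by (simp add: frechet_derivative_works)
    show "(f has_derivative fderiv f (g x)) (at (g x))"
      using Suc.prems(1) that assms(4) by (auto simp: frechet_derivative_works)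
  qed
  \<comment> \<open>The chain rule differentiates f in a direction that varies with x, whereas
    \<open>C_k_on\<close> controls fixed directions only. Expanding the direction in the finite
    basis reduces the one to the other.\<close>
  have exp: "fderiv f (g x) w =
      (\<Sum>b\<in>Basis. (w \<bullet> b) *\<^sub>R fderiv f (g x) b)" if "x \<in> S" for x w
  proof -
    have "linear (fderiv f (g x))"
      using Suc.prems(1) assms(4) that by (auto intro: linear_frechet_derivative)
    from linear_sum[OF this, of "\<lambda>b. (w \<bullet> b) *\<^sub>R b" Basis] linear_scale[OF this]
    show ?thesis by (simp add: euclidean_representation)
  qed
  have "C_k_on k (\<lambda>x. fderiv (\<lambda>x. f (g x)) x v) S" for v
  proof (rule C_k_on_cong[OF assms(1)])
    show "C_k_on k (\<lambda>x. \<Sum>b\<in>Basis. (fderiv g x v \<bullet> b) *\<^sub>R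
        fderiv f (g x) b) S"
    proof (intro C_k_on_sum bounded_bilinear.C_k_on[OF bounded_bilinear_scaleR]
        bounded_bilinear.C_k_on[OF bounded_bilinear_inner] C_k_on_const assms(1))
      fix b :: 'b
      show "C_k_on k (\<lambda>x. fderiv g x v) S" using Suc.prems by auto
      show "C_k_on k (\<lambda>x. fderiv f (g x) b) S"
        using Suc.IH[of "\<lambda>y. fderiv f y b"] Suc.prems C_k_on_SucD by auto
    qed
  qed (use exp in \<open>simp add: frechet_derivative_eqI[OF *]\<close>)
  then show ?case using * by (auto simp: differentiable_def)
qed

section \<open>Closure properties of smooth maps\<close>

lemma smooth_on_mono: "smooth_on f S \<Longrightarrow> T \<subseteq> S \<Longrightarrow> smooth_on f T"
  by (auto simp: smooth_on_def intro: C_k_on_mono)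

lemma smooth_on_cong:
  "open S \<Longrightarrow> smooth_on f S \<Longrightarrow> (\<And>x. x \<in> S \<Longrightarrow> f x = g x) \<Longrightarrow> smooth_on g S"
  by (auto simp: smooth_on_def intro: C_k_on_cong)

lemma smooth_on_local:
  "(\<And>x. x \<in> S \<Longrightarrow> \<exists>T. open T \<and> x \<in> T \<and> smooth_on f T) \<Longrightarrow> smooth_on f S"
  unfolding smooth_on_def by (meson C_k_on_local)

lemma smooth_on_imp_differentiable: "smooth_on f S \<Longrightarrow> x \<in> S \<Longrightarrow> f differentiable (at x)"
  unfolding smooth_on_def by (metis C_k_on.simps(2))

lemma smooth_on_has_derivative:
  "smooth_on f S \<Longrightarrow> x \<in> S \<Longrightarrow> (f has_derivative fderiv f x) (at x)"
  by (metis smooth_on_imp_differentiable frechet_derivative_works)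

lemma smooth_on_linear_derivative:
  "smooth_on f S \<Longrightarrow> x \<in> S \<Longrightarrow> linear (fderiv f x)"
  by (metis smooth_on_imp_differentiable linear_frechet_derivative)

lemma smooth_on_imp_continuous_on: "smooth_on f S \<Longrightarrow> continuous_on S f"
  unfolding smooth_on_def by (metis C_k_on.simps(1))

lemma smooth_on_frechet_derivative:
  "smooth_on f S \<Longrightarrow> smooth_on (\<lambda>x. fderiv f x v) S"
  unfolding smooth_on_def by (metis C_k_on.simps(2))

named_theorems smooth_intros

lemma smooth_on_const [smooth_intros]: "smooth_on (\<lambda>x. c) S"
  by (simp add: smooth_on_def C_k_on_const)

lemma smooth_on_bounded_linear: "bounded_linear h \<Longrightarrow> smooth_on h S"
  by (simp add: smooth_on_def C_k_on_bounded_linear)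

lemma smooth_on_ident [smooth_intros]: "smooth_on (\<lambda>x. x) S"
  by (rule smooth_on_bounded_linear) (rule bounded_linear_ident)

lemma smooth_on_add [smooth_intros]:
  "open S \<Longrightarrow> smooth_on f S \<Longrightarrow> smooth_on g S \<Longrightarrow> smooth_on (\<lambda>x. f x + g x) S"
  by (simp add: smooth_on_def C_k_on_add)

lemma smooth_on_sum [smooth_intros]:
  "open S \<Longrightarrow> (\<And>i. i \<in> I \<Longrightarrow> smooth_on (f i) S) \<Longrightarrow> smooth_on (\<lambda>x. \<Sum>i\<in>I. f i x) S"
  by (simp add: smooth_on_def C_k_on_sum)

lemma smooth_on_scaleR [smooth_intros]:
  "open S \<Longrightarrow> smooth_on f S \<Longrightarrow> smooth_on g S \<Longrightarrow> smooth_on (\<lambda>x. f x *\<^sub>R g x) S"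
  by (simp add: smooth_on_def bounded_bilinear.C_k_on[OF bounded_bilinear_scaleR])

lemma smooth_on_mult [smooth_intros]:
  fixes f g :: "_ \<Rightarrow> real"
  shows "open S \<Longrightarrow> smooth_on f S \<Longrightarrow> smooth_on g S \<Longrightarrow> smooth_on (\<lambda>x. f x * g x) S"
  by (simp add: smooth_on_def bounded_bilinear.C_k_on[OF bounded_bilinear_mult])

lemma smooth_on_inner [smooth_intros]:
  "open S \<Longrightarrow> smooth_on f S \<Longrightarrow> smooth_on g S \<Longrightarrow> smooth_on (\<lambda>x. f x \<bullet> g x) S"
  by (simp add: smooth_on_def bounded_bilinear.C_k_on[OF bounded_bilinear_inner])

lemma smooth_on_minus [smooth_intros]:
  "open S \<Longrightarrow> smooth_on f S \<Longrightarrow> smooth_on (\<lambda>x. - f x) S"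
  using smooth_on_scaleR[of S "\<lambda>x. -1" f] by (simp add: smooth_on_const)

lemma smooth_on_diff [smooth_intros]:
  "open S \<Longrightarrow> smooth_on f S \<Longrightarrow> smooth_on g S \<Longrightarrow> smooth_on (\<lambda>x. f x - g x) S"
  using smooth_on_add[of S f "\<lambda>x. - g x"] by (simp add: smooth_on_minus)

lemma smooth_on_compose:
  fixes f :: "'b::euclidean_space \<Rightarrow> 'c::real_normed_vector"
  shows "open S \<Longrightarrow> smooth_on f T \<Longrightarrow> smooth_on g S \<Longrightarrow> g ` S \<subseteq> T \<Longrightarrow> smooth_on (\<lambda>x. f (g x)) S"
  using C_k_on_compose unfolding smooth_on_def by blast

lemma smooth_on_linear_compose:
  fixes h :: "'b::euclidean_space \<Rightarrow> 'c::real_normed_vector"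
  assumes "open S" "bounded_linear h" "smooth_on g S"
  shows "smooth_on (\<lambda>x. h (g x)) S"
  using smooth_on_compose[OF assms(1) smooth_on_bounded_linear[OF assms(2), of UNIV] assms(3)]
  by simp

lemma smooth_on_Pair [smooth_intros]:
  fixes f :: "'a::real_normed_vector \<Rightarrow> 'b::euclidean_space" and g :: "'a \<Rightarrow> 'c::euclidean_space"
  assumes "open S" "smooth_on f S" "smooth_on g S"
  shows "smooth_on (\<lambda>x. (f x, g x)) S"
proof -
  have "smooth_on (\<lambda>x. (f x, 0::'c) + (0::'b, g x)) S"
    by (intro smooth_on_add assms
        smooth_on_linear_compose[where h="\<lambda>y. (y, 0)"] smooth_on_linear_compose[where h="\<lambda>y. (0, y)"]
        bounded_linear_Pair bounded_linear_ident bounded_linear_zero)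
  then show ?thesis by simp
qed

lemma smooth_on_fst [smooth_intros]: 
  fixes f :: "'a::real_normed_vector \<Rightarrow> 'b::euclidean_space \<times> 'c::euclidean_space"
  shows "open S \<Longrightarrow> smooth_on f S \<Longrightarrow> smooth_on (\<lambda>x. fst (f x)) S"
  by (rule smooth_on_linear_compose[OF _ bounded_linear_fst])

lemma smooth_on_snd [smooth_intros]: 
  fixes f :: "'a::real_normed_vector \<Rightarrow> 'b::euclidean_space \<times> 'c::euclidean_space"
  shows "open S \<Longrightarrow> smooth_on f S \<Longrightarrow> smooth_on (\<lambda>x. snd (f x)) S"
  by (rule smooth_on_linear_compose[OF _ bounded_linear_snd])

lemma smooth_on_vec_nth [smooth_intros]:
  fixes f :: "'a::real_normed_vector \<Rightarrow> real^'n"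
  shows "open S \<Longrightarrow> smooth_on f S \<Longrightarrow> smooth_on (\<lambda>x. f x $ i) S"
  by (rule smooth_on_linear_compose[OF _ bounded_linear_vec_nth])

lemma smooth_on_vec_lambda [smooth_intros]:
  fixes f :: "'n::finite \<Rightarrow> 'a::real_normed_vector \<Rightarrow> real"
  assumes "open S" "\<And>i. smooth_on (f i) S"
  shows "smooth_on (\<lambda>x. \<chi> i. f i x) S"
proof -
  have "(\<Sum>i\<in>UNIV. f i x *\<^sub>R axis i 1) = (\<chi> i. f i x)" for x
    by (simp add: vec_eq_iff axis_def if_distrib cong: if_cong)
  then show ?thesis
    using smooth_on_sum[of S UNIV "\<lambda>i x. f i x *\<^sub>R axis i (1::real)"] assms
    by (simp add: smooth_on_scaleR smooth_on_const)
qed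

text \<open>The derivative is a polynomial in \<open>inverse\<close> itself, so the induction on the
  order feeds on its own hypothesis. The same happens for \<open>sqrt\<close>, whose derivative is a
  multiple of its reciprocal.\<close>

lemma smooth_on_inverse_real: "smooth_on inverse ({x. x \<noteq> 0} :: real set)"
proof -
  have op: "open ({x. x \<noteq> 0} :: real set)" by (simp add: open_Collect_neq continuous_on_const)
  have "C_k_on k inverse ({x. x \<noteq> 0} :: real set)" for k
  proof (induction k)
    case 0
    then show ?case by (auto intro!: continuous_intros)
  next
    case (Suc k)
    have *: "(inverse has_derivative (\<lambda>v. - (inverse x * v * inverse x))) (at x)"
      if "x \<noteq> 0" for x :: real
      using has_derivative_inverse'[OF that, of UNIV] by simp
    have "C_k_on k (\<lambda>x. fderiv inverse x v) {x. x \<noteq> 0}" for v :: real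
    proof (rule C_k_on_cong[OF op])
      show "C_k_on k (\<lambda>x. (- v) * (inverse x * inverse x)) {x. x \<noteq> 0}"
        by (intro bounded_bilinear.C_k_on[OF bounded_bilinear_mult] op Suc C_k_on_const)
    qed (simp add: frechet_derivative_eqI[OF *])
    then show ?case using * by (auto simp: differentiable_def)
  qed
  then show ?thesis by (simp add: smooth_on_def)
qed

lemma smooth_on_inverse [smooth_intros]:
  fixes f :: "_ \<Rightarrow> real"
  assumes "open S" "smooth_on f S" "\<And>x. x \<in> S \<Longrightarrow> f x \<noteq> 0"
  shows "smooth_on (\<lambda>x. inverse (f x)) S"
  by (rule smooth_on_compose[OF assms(1) smooth_on_inverse_real assms(2)]) (use assms(3) in auto)

lemma smooth_on_divide [smooth_intros]:
  fixes f g :: "_ \<Rightarrow> real"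
  assumes "open S" "smooth_on f S" "smooth_on g S" "\<And>x. x \<in> S \<Longrightarrow> g x \<noteq> 0"
  shows "smooth_on (\<lambda>x. f x / g x) S"
  unfolding divide_inverse by (intro smooth_intros assms)

lemma smooth_on_sqrt_real: "smooth_on sqrt {0<..}"
proof -
  have "C_k_on k sqrt {0<..}" for k
  proof (induction k)
    case 0
    then show ?case by (auto intro!: continuous_intros)
  next
    case (Suc k)
    have *: "(sqrt has_derivative (\<lambda>v. v * (inverse (sqrt x) / 2))) (at x)" if "x > 0" for x
      by (rule has_derivative_eq_rhs[OF DERIV_real_sqrt[OF that, unfolded has_field_derivative_def]])
        auto
    have "C_k_on k (\<lambda>x. fderiv sqrt x v) {0<..}" for v :: real
    proof (rule C_k_on_cong)
      have "C_k_on k (\<lambda>x. inverse (sqrt x)) {0<..}"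
      proof (rule C_k_on_compose[where f=inverse])
        show "C_k_on k inverse ({x. x \<noteq> 0} :: real set)"
          using smooth_on_inverse_real by (simp only: smooth_on_def)
      qed (use Suc in auto)
      then show "C_k_on k (\<lambda>x. (v / 2) * inverse (sqrt x)) {0<..}"
        by (intro bounded_bilinear.C_k_on[OF bounded_bilinear_mult] C_k_on_const) auto
    qed (auto simp: frechet_derivative_eqI[OF *])
    then show ?case using * by (auto simp: differentiable_def)
  qed
  then show ?thesis by (simp add: smooth_on_def)
qed

lemma smooth_on_sqrt [smooth_intros]:
  assumes "open S" "smooth_on f S" "\<And>x. x \<in> S \<Longrightarrow> f x > 0"
  shows "smooth_on (\<lambda>x. sqrt (f x)) S"
  by (rule smooth_on_compose[OF assms(1) smooth_on_sqrt_real assms(2)]) (use assms(3) in auto)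

lemma smooth_on_norm [smooth_intros]:
  fixes f :: "_ \<Rightarrow> 'a::real_inner"
  assumes "open S" "smooth_on f S" "\<And>x. x \<in> S \<Longrightarrow> f x \<noteq> 0"
  shows "smooth_on (\<lambda>x. norm (f x)) S"
  unfolding norm_eq_sqrt_inner by (intro smooth_intros assms) (use assms(3) in auto)

section \<open>A smooth function that is flat at 0\<close>

lemma exp_neg_inverse_power_tendsto:
  "((\<lambda>t::real. inverse t ^ j * exp (- inverse t)) \<longlongrightarrow> 0) (at_right 0)"
proof -
  have "((\<lambda>u::real. u ^ j * exp (- u)) \<longlongrightarrow> 0) at_top"
    using tendsto_power_div_exp_0[of j] by (simp add: exp_minus divide_inverse)
  from filterlim_compose[OF this filterlim_inverse_at_top_right] show ?thesis .
qed

text \<open>The powers make the family stable under differentiation, so that one induction proves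
  all its members smooth. Bump functions use the member j = 0.\<close>

definition flat_exp :: "nat \<Rightarrow> real \<Rightarrow> real" where
  "flat_exp j t = (if 0 < t then inverse t ^ j * exp (- inverse t) else 0)"

lemma flat_exp_has_derivative:
  "(flat_exp j has_derivative (\<lambda>v. v * (flat_exp (j + 2) t - real j * flat_exp (j + 1) t))) (at t)"
proof -
  consider "t > 0" | "t < 0" | "t = 0" by linarith
  then have "(flat_exp j has_field_derivative flat_exp (j + 2) t - real j * flat_exp (j + 1) t) (at t)"
  proof cases
    case 1
    have "((\<lambda>t. inverse t ^ j * exp (- inverse t)) has_field_derivative
        inverse t ^ (j + 2) * exp (- inverse t) - real j * (inverse t ^ (j + 1) * exp (- inverse t))) (at t)"
      using 1 
      by (auto intro!: derivative_eq_intros simp: power2_eq_square algebra_simps)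
        (cases j; simp add: field_simps)
    then show ?thesis
      by (rule has_field_derivative_transform_within_open[of _ _ _ "{0<..}", THEN DERIV_cong])
        (use 1 in \<open>auto simp: flat_exp_def\<close>)
  next
    case 2
    have "((\<lambda>t. 0::real) has_field_derivative 0) (at t)" by simp
    then show ?thesis
      by (rule has_field_derivative_transform_within_open[of _ _ _ "{..<0}", THEN DERIV_cong])
        (use 2 in \<open>auto simp: flat_exp_def\<close>)
  next
    case 3
    \<comment> \<open>For positive h the difference quotient at 0 is the member \<open>Suc j\<close>
      of the family.\<close>
    have "((\<lambda>h. flat_exp j h / h) \<longlongrightarrow> 0) (at_right 0)"
      by (rule Lim_transform_eventually[OF exp_neg_inverse_power_tendsto[of "Suc j"]])
        (auto simp: flat_exp_def eventually_at_right_less field_simps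
          intro!: eventually_mono[OF eventually_at_right_less])
    moreover have "((\<lambda>h. flat_exp j h / h) \<longlongrightarrow> 0) (at_left 0)"
      by (rule Lim_transform_eventually[OF tendsto_const[of 0]])
        (auto simp: flat_exp_def eventually_at_filter)
    ultimately have "((\<lambda>h. flat_exp j h / h) \<longlongrightarrow> 0) (at 0)"
      by (simp add: filterlim_at_split)
    then show ?thesis using 3 by (simp add: DERIV_def flat_exp_def)
  qed
  then show ?thesis
    unfolding has_field_derivative_def by (rule has_derivative_eq_rhs) auto
qed

lemma smooth_on_flat_exp: "smooth_on (flat_exp j) S"
proof -
  have "C_k_on k (flat_exp j) UNIV" for k
  proof (induction k arbitrary: j)
    case 0
    have "flat_exp j differentiable (at t)" for t
      using flat_exp_has_derivative by (auto simp: differentiable_def)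
    then show ?case
      by (auto intro!: continuous_at_imp_continuous_on differentiable_imp_continuous_within)
  next
    case (Suc k)
    have "C_k_on k (\<lambda>t. fderiv (flat_exp j) t v) UNIV" for v :: real
    proof -
      have "C_k_on k (\<lambda>t. v * (flat_exp (j + 2) t + (- real j) * flat_exp (j + 1) t)) UNIV"
        by (intro bounded_bilinear.C_k_on[OF bounded_bilinear_mult] C_k_on_const C_k_on_add Suc) auto
      then show ?thesis by (simp add: frechet_derivative_eqI[OF flat_exp_has_derivative])
    qed
    then show ?case using flat_exp_has_derivative by (auto simp: differentiable_def)
  qed
  then show ?thesis by (meson smooth_on_def C_k_on_mono subset_UNIV)
qed

section \<open>Symmetry of second derivatives\<close>

lemma real_mvt_segment:
  fixes g :: "real \<Rightarrow> real"
  assumes "t > 0" "\<And>s. 0 \<le> s \<Longrightarrow> s \<le> t \<Longrightarrow> (g has_real_derivative g' s) (at s)"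
  obtains s where "0 < s" "s < t" "g t - g 0 = t * g' s"
  using MVT2[of 0 t g g'] assms by auto

text \<open>Two applications of the mean value theorem, along u and then along w, turn the second
  difference into \<open>t\<^sup>2\<close> times a second derivative at a nearby point; continuity
  of that derivative gives the limit. The quotient is symmetric in u and w while the limit is not
  visibly so.\<close>

lemma second_difference_tendsto:
  fixes f :: "'a::real_normed_vector \<Rightarrow> real"
  assumes S: "open S" "x \<in> S" and f: "smooth_on f S"
  shows "((\<lambda>t. (f (x + t *\<^sub>R u + t *\<^sub>R w) - f (x + t *\<^sub>R u) - f (x + t *\<^sub>R w) + f x) / t\<^sup>2)
    \<longlongrightarrow> fderiv (\<lambda>y. fderiv f y u) x w) (at_right 0)"
    (is "(?Q \<longlongrightarrow> ?H x) _")
proof (rule tendstoI)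
  fix \<epsilon> :: real assume "\<epsilon> > 0"
  define H where "H = ?H"
  have "continuous_on S H"
    unfolding H_def by (intro smooth_on_imp_continuous_on smooth_on_frechet_derivative f)
  then have "isCont H x" using S by (simp add: continuous_on_eq_continuous_at)
  then obtain d0 where d0: "d0 > 0" "\<And>y. dist y x < d0 \<Longrightarrow> dist (H y) (H x) < \<epsilon>"
    using \<open>\<epsilon> > 0\<close> unfolding continuous_at_eps_delta by blast
  obtain d1 where d1: "d1 > 0" "ball x d1 \<subseteq> S" using S open_contains_ball by blast
  \<comment> \<open>The summand 1 makes the denominator positive and the estimate in
    \<open>close\<close> strict.\<close>
  define r where "r = min d0 d1 / (norm u + norm w + 1)"
  have r: "r > 0" using d0 d1 by (simp add: r_def add_nonneg_pos)
  have close: "dist (x + a *\<^sub>R u + b *\<^sub>R w) x < min d0 d1"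
    if "0 \<le> a" "a < r" "0 \<le> b" "b < r" for a b
  proof -
    have "dist (x + a *\<^sub>R u + b *\<^sub>R w) x \<le> a * norm u + b * norm w"
      using norm_triangle_ineq[of "a *\<^sub>R u" "b *\<^sub>R w"] that by (simp add: dist_norm add.assoc)
    also have "\<dots> \<le> r * norm u + r * norm w"
      using that by (intro add_mono mult_right_mono) auto
    also have "\<dots> < r * (norm u + norm w + 1)" using r by (simp add: algebra_simps)
    also have "\<dots> = min d0 d1" by (simp add: r_def add_nonneg_eq_0_iff)
    finally show ?thesis .
  qed
  have inS: "x + a *\<^sub>R u + b *\<^sub>R w \<in> S" if "0 \<le> a" "a < r" "0 \<le> b" "b < r" for a b
    using close[OF that] d1(2) by (auto simp: dist_commute)
  have "dist (?Q t) (?H x) < \<epsilon>" if t: "0 < t" "t < r" for t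
  proof -
    have D: "((\<lambda>s. f (p + s *\<^sub>R v)) has_real_derivative fderiv f (p + s *\<^sub>R v) v) (at s)"
      if "p + s *\<^sub>R v \<in> S" for p v s
      unfolding has_field_derivative_def
    proof (rule has_derivative_eq_rhs)
      show "((\<lambda>s. f (p + s *\<^sub>R v)) has_derivative
          (\<lambda>h. fderiv f (p + s *\<^sub>R v) (h *\<^sub>R v))) (at s)"
        using smooth_on_has_derivative[OF f that]
        by (rule has_derivative_compose[where g=f and f="\<lambda>s. p + s *\<^sub>R v", rotated])
          (auto intro!: derivative_eq_intros)
      show "(\<lambda>h. fderiv f (p + s *\<^sub>R v) (h *\<^sub>R v)) =
          (*) (fderiv f (p + s *\<^sub>R v) v)"
        using linear_scale[OF smooth_on_linear_derivative[OF f that]] by (simp add: fun_eq_iff)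
    qed
    define g where "g s = f (x + t *\<^sub>R w + s *\<^sub>R u) - f (x + s *\<^sub>R u)" for s
    obtain a where a: "0 < a" "a < t" "g t - g 0 = t * (fderiv f (x + t *\<^sub>R w + a *\<^sub>R u) u
        - fderiv f (x + a *\<^sub>R u) u)"
    proof (rule real_mvt_segment[OF t(1)])
      fix s assume "0 \<le> s" "s \<le> t"
      then show "(g has_real_derivative fderiv f (x + t *\<^sub>R w + s *\<^sub>R u) u
        - fderiv f (x + s *\<^sub>R u) u) (at s)"
        unfolding g_def using inS[of s t] inS[of s 0] t
        by (intro DERIV_diff D) (auto simp: algebra_simps)
    qed blast
    define h where "h s = fderiv f (x + a *\<^sub>R u + s *\<^sub>R w) u" for s
    obtain b where b: "0 < b" "b < t" "h t - h 0 = t * H (x + a *\<^sub>R u + b *\<^sub>R w)"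
    proof (rule real_mvt_segment[OF t(1)])
      fix s assume "0 \<le> s" "s \<le> t"
      then have in': "x + a *\<^sub>R u + s *\<^sub>R w \<in> S" using inS[of a s] t a by auto
      note sm = smooth_on_frechet_derivative[OF f, of u]
      show "(h has_real_derivative H (x + a *\<^sub>R u + s *\<^sub>R w)) (at s)"
        unfolding has_field_derivative_def
      proof (rule has_derivative_eq_rhs)
        show "(h has_derivative (\<lambda>k. fderiv (\<lambda>y. fderiv f y u) (x + a *\<^sub>R u + s *\<^sub>R w) (k *\<^sub>R w))) (at s)"
          unfolding h_def using smooth_on_has_derivative[OF sm in']
          by (rule has_derivative_compose[where f="\<lambda>s. x + a *\<^sub>R u + s *\<^sub>R w"
                and g="\<lambda>y. fderiv f y u", rotated])
            (auto intro!: derivative_eq_intros)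
        show "(\<lambda>k. fderiv (\<lambda>y. fderiv f y u) (x + a *\<^sub>R u + s *\<^sub>R w) (k *\<^sub>R w)) = (*) (H (x + a *\<^sub>R u + s *\<^sub>R w))"
          using linear_scale[OF smooth_on_linear_derivative[OF sm in']]
          by (simp add: fun_eq_iff H_def)
      qed
    qed blast
    have "f (x + t *\<^sub>R u + t *\<^sub>R w) - f (x + t *\<^sub>R u) - f (x + t *\<^sub>R w) + f x = g t - g 0"
      by (simp add: g_def algebra_simps)
    also have "\<dots> = t * (h t - h 0)" by (simp add: a h_def algebra_simps)
    also have "\<dots> = t\<^sup>2 * H (x + a *\<^sub>R u + b *\<^sub>R w)" by (simp add: b power2_eq_square)
    finally have "?Q t = H (x + a *\<^sub>R u + b *\<^sub>R w)" using t by simp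
    then show ?thesis using d0(2) close[of a b] a b t by (simp add: H_def)
  qed
  then show "\<forall>\<^sub>F t in at_right 0. dist (?Q t) (?H x) < \<epsilon>"
    using r by (auto simp: eventually_at_right_field intro!: exI[of _ r])
qed

lemma frechet_derivative_inner_left:
  assumes "f differentiable (at x)"
  shows "fderiv (\<lambda>x. f x \<bullet> b) x v = fderiv f x v \<bullet> b"
  using assms
  by (subst frechet_derivative_eqI[OF has_derivative_inner_left])
    (auto simp: frechet_derivative_works)

text \<open>Exchanging u and w leaves the second difference unchanged, so its two limits agree.
  Components along the basis are taken because the mean value theorem concerns real
  functions.\<close>

lemma symmetric_second_frechet_derivative:
  fixes f :: "'a::real_normed_vector \<Rightarrow> 'b::euclidean_space"
  assumes S: "open S" "x \<in> S" and f: "smooth_on f S"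
  shows "fderiv (\<lambda>y. fderiv f y u) x w =
    fderiv (\<lambda>y. fderiv f y w) x u"
proof (rule euclidean_eqI)
  fix b :: 'b
  define g where "g y = f y \<bullet> b" for y
  have g: "smooth_on g S" unfolding g_def by (intro smooth_intros S f)
  have gf: "fderiv (\<lambda>y. fderiv g y u) x w =
      fderiv (\<lambda>y. fderiv f y u) x w \<bullet> b" for u w
  proof -
    have "fderiv (\<lambda>y. fderiv g y u) x =
        fderiv (\<lambda>y. fderiv f y u \<bullet> b) x"
      unfolding g_def
      by (rule frechet_derivative_cong_open[OF S])
        (rule frechet_derivative_inner_left[OF smooth_on_imp_differentiable[OF f]])
    then show ?thesis
      using frechet_derivative_inner_left[OF smooth_on_imp_differentiable[
            OF smooth_on_frechet_derivative[OF f] S(2)]] by metis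
  qed
  have "fderiv (\<lambda>y. fderiv g y u) x w =
      fderiv (\<lambda>y. fderiv g y w) x u"
  proof (rule tendsto_unique[OF _ second_difference_tendsto[OF S g, of u w]])
    show "((\<lambda>t. (g (x + t *\<^sub>R u + t *\<^sub>R w) - g (x + t *\<^sub>R u) - g (x + t *\<^sub>R w) + g x) / t\<^sup>2) \<longlongrightarrow>
        fderiv (\<lambda>y. fderiv g y w) x u) (at_right 0)"
      using second_difference_tendsto[OF S g, of w u] by (simp add: algebra_simps)
  qed simp
  then show "fderiv (\<lambda>y. fderiv f y u) x w \<bullet> b =
      fderiv (\<lambda>y. fderiv f y w) x u \<bullet> b"
    by (simp add: gf)
qed

section \<open>Charts, tangent vectors and smooth functions\<close>

lemma smooth_manifoldD:
  assumes "smooth_manifold M"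
  shows "Hausdorff_space (mtop M)" "second_countable (mtop M)" "\<Union> (fst ` atlas M) = points M"
    and "c \<in> atlas M \<Longrightarrow> openin (mtop M) (fst c)"
    and "c \<in> atlas M \<Longrightarrow> open (snd c ` fst c)"
    and "c \<in> atlas M \<Longrightarrow>
      homeomorphic_map (subtopology (mtop M) (fst c)) (top_of_set (snd c ` fst c)) (snd c)"
    and "c \<in> atlas M \<Longrightarrow> c' \<in> atlas M \<Longrightarrow>
      smooth_on (snd c' \<circ> chart_inv c) (snd c ` (fst c \<inter> fst c'))"
  using assms unfolding smooth_manifold_def by (auto simp: case_prod_beta)

lemma chart_subset: "smooth_manifold M \<Longrightarrow> c \<in> atlas M \<Longrightarrow> fst c \<subseteq> points M"
  by (meson openin_subset smooth_manifoldD(4))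

lemma inj_on_chart: 
  assumes "smooth_manifold M" "c \<in> atlas M"
  shows "inj_on (snd c) (fst c)"
  using homeomorphic_imp_injective_map[OF smooth_manifoldD(6)[OF assms]] chart_subset[OF assms]
  by (simp add: Int_absorb1)

lemma chart_inv_chart [simp]:
  "smooth_manifold M \<Longrightarrow> c \<in> atlas M \<Longrightarrow> q \<in> fst c \<Longrightarrow> chart_inv c (snd c q) = q"
  by (simp add: inj_on_chart)

lemma open_chart_image:
  assumes M: "smooth_manifold M" "c \<in> atlas M" and V: "openin (mtop M) V"
  shows "open (snd c ` (fst c \<inter> V))"
proof -
  have "openin (subtopology (mtop M) (fst c)) (fst c \<inter> V)"
    using V by (simp add: openin_subtopology_Int2)
  then have "openin (top_of_set (snd c ` fst c)) (snd c ` (fst c \<inter> V))"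
    using homeomorphic_imp_open_map[OF smooth_manifoldD(6)[OF M]] by (simp add: open_map_def)
  then show ?thesis using smooth_manifoldD(5)[OF M] by (meson openin_open_trans)
qed

lemma openin_chart_vimage:
  assumes M: "smooth_manifold M" "c \<in> atlas M" and T: "open T"
  shows "openin (mtop M) {q \<in> fst c. snd c q \<in> T}"
proof -
  have "continuous_map (subtopology (mtop M) (fst c)) (top_of_set (snd c ` fst c)) (snd c)"
    using homeomorphic_imp_continuous_map[OF smooth_manifoldD(6)[OF M]] .
  moreover have "openin (top_of_set (snd c ` fst c)) (snd c ` fst c \<inter> T)"
    using T by (simp add: openin_open_Int)
  ultimately have "openin (subtopology (mtop M) (fst c))
      {q \<in> topspace (subtopology (mtop M) (fst c)). snd c q \<in> snd c ` fst c \<inter> T}"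
    by (rule openin_continuous_map_preimage)
  moreover have "{q \<in> topspace (subtopology (mtop M) (fst c)). snd c q \<in> snd c ` fst c \<inter> T} =
      {q \<in> fst c. snd c q \<in> T}"
    using chart_subset[OF M] by auto
  ultimately show ?thesis using smooth_manifoldD(4)[OF M] by (metis openin_trans_full)
qed

lemma exists_chart:
  assumes "smooth_manifold M" "p \<in> points M"
  obtains c where "c \<in> charts_at M p"
proof -
  have "p \<in> \<Union> (fst ` atlas M)" using smooth_manifoldD(3)[OF assms(1)] assms(2) by simp
  then obtain c where "c \<in> atlas M" "p \<in> fst c" by blast
  then show thesis using that by simp
qed

lemma some_chart:
  assumes "smooth_manifold M" "p \<in> points M"
  shows "(SOME c. c \<in> charts_at M p) \<in> charts_at M p"
proof -
  obtain c where "c \<in> charts_at M p" using exists_chart[OF assms] .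
  then show ?thesis by (rule someI)
qed

section \<open>Smooth functions on a manifold\<close>

lemma smooth_fun_onD:
  "smooth_fun_on M W g \<Longrightarrow> c \<in> atlas M \<Longrightarrow> smooth_on (g \<circ> chart_inv c) (snd c ` (fst c \<inter> W))"
  unfolding smooth_fun_on_def by (auto simp: case_prod_beta)

lemma smooth_fun_onI:
  "(\<And>c. c \<in> atlas M \<Longrightarrow> smooth_on (g \<circ> chart_inv c) (snd c ` (fst c \<inter> W))) \<Longrightarrow> smooth_fun_on M W g"
  unfolding smooth_fun_on_def by (auto simp: case_prod_beta)

lemma smooth_fun_on_mono: "smooth_fun_on M W g \<Longrightarrow> V \<subseteq> W \<Longrightarrow> smooth_fun_on M V g"
  by (rule smooth_fun_onI) (rule smooth_on_mono[OF smooth_fun_onD], auto)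

lemma smooth_fun_on_cong:
  assumes M: "smooth_manifold M" and W: "openin (mtop M) W"
    and g: "smooth_fun_on M W g" "\<And>q. q \<in> W \<Longrightarrow> g q = h q"
  shows "smooth_fun_on M W h"
proof (rule smooth_fun_onI)
  fix c assume c: "c \<in> atlas M"
  show "smooth_on (h \<circ> chart_inv c) (snd c ` (fst c \<inter> W))"
    by (rule smooth_on_cong[OF open_chart_image[OF M c W] smooth_fun_onD[OF g(1) c]])
      (use M c g(2) in auto)
qed

lemma smooth_fun_on_local:
  assumes M: "smooth_manifold M"
    and loc: "\<And>p. p \<in> W \<Longrightarrow> \<exists>V. openin (mtop M) V \<and> p \<in> V \<and> smooth_fun_on M V g"
  shows "smooth_fun_on M W g"
proof (intro smooth_fun_onI smooth_on_local)
  fix c x assume c: "c \<in> atlas M" and "x \<in> snd c ` (fst c \<inter> W)"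
  then obtain p where p: "p \<in> fst c" "p \<in> W" "x = snd c p" by auto
  with loc obtain V where "openin (mtop M) V" "p \<in> V" "smooth_fun_on M V g" by meson
  then show "\<exists>T. open T \<and> x \<in> T \<and> smooth_on (g \<circ> chart_inv c) T"
    using open_chart_image[OF M c, of V] smooth_fun_onD[OF _ c, of V g] p by blast
qed

lemma smooth_fun_on_chartI:
  assumes M: "smooth_manifold M" and c: "c \<in> atlas M" and W: "openin (mtop M) W" "W \<subseteq> fst c"
    and g: "smooth_on (g \<circ> chart_inv c) (snd c ` W)"
  shows "smooth_fun_on M W g"
proof (rule smooth_fun_onI)
  fix d assume d: "d \<in> atlas M"
  have op: "open (snd d ` (fst d \<inter> W))" by (rule open_chart_image[OF M d W(1)])
  have "smooth_on (\<lambda>y. (g \<circ> chart_inv c) ((snd c \<circ> chart_inv d) y)) (snd d ` (fst d \<inter> W))"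
    by (rule smooth_on_compose[OF op g smooth_on_mono[OF smooth_manifoldD(7)[OF M d c]]])
      (use W M d in auto)
  then show "smooth_on (g \<circ> chart_inv d) (snd d ` (fst d \<inter> W))"
    by (rule smooth_on_cong[OF op]) (use W M c d in auto)
qed

lemma smooth_fun_on_const: "smooth_fun_on M W (\<lambda>p. k)"
  by (rule smooth_fun_onI) (simp add: comp_def smooth_on_const)

lemma smooth_fun_on_scaleR:
  assumes M: "smooth_manifold M" "openin (mtop M) W" and "smooth_fun_on M W g" "smooth_fun_on M W h"
  shows "smooth_fun_on M W (\<lambda>p. g p *\<^sub>R h p)"
proof (rule smooth_fun_onI)
  fix c assume c: "c \<in> atlas M"
  have "smooth_on (\<lambda>y. (g \<circ> chart_inv c) y *\<^sub>R (h \<circ> chart_inv c) y) (snd c ` (fst c \<inter> W))"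
    using assms c by (intro smooth_intros open_chart_image smooth_fun_onD)
  then show "smooth_on ((\<lambda>p. g p *\<^sub>R h p) \<circ> chart_inv c) (snd c ` (fst c \<inter> W))"
    by (simp add: comp_def)
qed

lemma smooth_fun_on_diff:
  assumes M: "smooth_manifold M" "openin (mtop M) W" and "smooth_fun_on M W g" "smooth_fun_on M W h"
  shows "smooth_fun_on M W (\<lambda>p. g p - h p)"
proof (rule smooth_fun_onI)
  fix c assume c: "c \<in> atlas M"
  have "smooth_on (\<lambda>y. (g \<circ> chart_inv c) y - (h \<circ> chart_inv c) y) (snd c ` (fst c \<inter> W))"
    using assms c by (intro smooth_intros open_chart_image smooth_fun_onD)
  then show "smooth_on ((\<lambda>p. g p - h p) \<circ> chart_inv c) (snd c ` (fst c \<inter> W))"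
    by (simp add: comp_def)
qed

lemma smooth_fun_on_inner:
  assumes M: "smooth_manifold M" "openin (mtop M) W" and "smooth_fun_on M W g" "smooth_fun_on M W h"
  shows "smooth_fun_on M W (\<lambda>p. g p \<bullet> h p)"
proof (rule smooth_fun_onI)
  fix c assume c: "c \<in> atlas M"
  have "smooth_on (\<lambda>y. (g \<circ> chart_inv c) y \<bullet> (h \<circ> chart_inv c) y) (snd c ` (fst c \<inter> W))"
    using assms c by (intro smooth_intros open_chart_image smooth_fun_onD)
  then show "smooth_on ((\<lambda>p. g p \<bullet> h p) \<circ> chart_inv c) (snd c ` (fst c \<inter> W))"
    by (simp add: comp_def)
qed

lemma smooth_fun_on_continuous_map:
  assumes M: "smooth_manifold M" and W: "openin (mtop M) W" and g: "smooth_fun_on M W g"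
    and T: "open T"
  shows "openin (mtop M) {q \<in> W. g q \<in> T}"
proof (subst openin_subopen, intro ballI)
  fix p assume "p \<in> {q \<in> W. g q \<in> T}"
  then have p: "p \<in> W" "g p \<in> T" by auto
  then obtain c where c: "c \<in> atlas M" "p \<in> fst c"
    using exists_chart[OF M] openin_subset[OF W] by blast
  let ?S = "snd c ` (fst c \<inter> W)"
  have "open (?S \<inter> (g \<circ> chart_inv c) -` T)"
    by (rule continuous_open_preimage[OF smooth_on_imp_continuous_on[OF smooth_fun_onD[OF g c(1)]]
          open_chart_image[OF M c(1) W] T])
  from openin_chart_vimage[OF M c(1) this]
  have "openin (mtop M) {q \<in> fst c. snd c q \<in> ?S \<inter> (g \<circ> chart_inv c) -` T}" .
  moreover have "p \<in> {q \<in> fst c. snd c q \<in> ?S \<inter> (g \<circ> chart_inv c) -` T}"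
    using p c M by auto
  moreover have "{q \<in> fst c. snd c q \<in> ?S \<inter> (g \<circ> chart_inv c) -` T} \<subseteq> {q \<in> W. g q \<in> T}"
  proof (rule subsetI)
    fix q assume "q \<in> {q \<in> fst c. snd c q \<in> ?S \<inter> (g \<circ> chart_inv c) -` T}"
    then obtain q' where "q \<in> fst c" "g (chart_inv c (snd c q)) \<in> T" "snd c q = snd c q'"
      "q' \<in> fst c" "q' \<in> W" by auto
    then show "q \<in> {q \<in> W. g q \<in> T}"
      using inj_onD[OF inj_on_chart[OF M c(1)], of q q'] M c(1) by simp
  qed
  ultimately show "\<exists>S. openin (mtop M) S \<and> p \<in> S \<and> S \<subseteq> {q \<in> W. g q \<in> T}" by blast
qed

section \<open>Tangent vectors given by their component in one chart\<close>

definition coord_tangent :: "('a, 'v::euclidean_space) manifold \<Rightarrow> 'a \<Rightarrow> ('a, 'v) chart \<Rightarrow> 'v \<Rightarrow> ('a, 'v) tangent" where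
  "coord_tangent M p c x c' =
     (if c' \<in> charts_at M p then fderiv (snd c' \<circ> chart_inv c) (snd c p) x else 0)"

text \<open>The chain rule behind two facts. With g a function, the differential does not depend on
  the chart; with g a chart map, the components given by \<open>coord_tangent\<close> are consistent
  over any two further charts.\<close>

lemma fderiv_transition_comp:
  assumes M: "smooth_manifold M" and c: "c \<in> charts_at M p" and d: "d \<in> charts_at M p"
    and W: "openin (mtop M) W" "p \<in> W" and g: "smooth_fun_on M W g"
  shows "fderiv (g \<circ> chart_inv d) (snd d p)
           (fderiv (snd d \<circ> chart_inv c) (snd c p) x) =
         fderiv (g \<circ> chart_inv c) (snd c p) x"
proof -
  have cM: "c \<in> atlas M" "p \<in> fst c" and dM: "d \<in> atlas M" "p \<in> fst d" using c d by auto
  let ?S = "snd c ` (fst c \<inter> (fst d \<inter> W))"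
  have S: "open ?S" "snd c p \<in> ?S"
    using open_chart_image[OF M cM(1)] smooth_manifoldD(4)[OF M dM(1)] W cM dM by auto
  have "((\<lambda>y. (g \<circ> chart_inv d) ((snd d \<circ> chart_inv c) y)) has_derivative
      (\<lambda>x. fderiv (g \<circ> chart_inv d) ((snd d \<circ> chart_inv c) (snd c p))
           (fderiv (snd d \<circ> chart_inv c) (snd c p) x))) (at (snd c p))"
  proof (rule has_derivative_compose[where f="snd d \<circ> chart_inv c" and g="g \<circ> chart_inv d"])
    show "((snd d \<circ> chart_inv c) has_derivative fderiv (snd d \<circ> chart_inv c) (snd c p))
        (at (snd c p))"
      by (rule smooth_on_has_derivative[OF smooth_manifoldD(7)[OF M cM(1) dM(1)]]) (use cM dM in auto)
    show "((g \<circ> chart_inv d) has_derivative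
        fderiv (g \<circ> chart_inv d) ((snd d \<circ> chart_inv c) (snd c p)))
        (at ((snd d \<circ> chart_inv c) (snd c p)))"
      by (rule smooth_on_has_derivative[OF smooth_fun_onD[OF g dM(1)]]) (use M cM dM W in auto)
  qed
  then have "((g \<circ> chart_inv c) has_derivative
      (\<lambda>x. fderiv (g \<circ> chart_inv d) ((snd d \<circ> chart_inv c) (snd c p))
           (fderiv (snd d \<circ> chart_inv c) (snd c p) x))) (at (snd c p))"
    by (rule has_derivative_transform_within_open[OF _ S]) (use M cM dM in auto)
  then have "fderiv (g \<circ> chart_inv c) (snd c p) =
      (\<lambda>x. fderiv (g \<circ> chart_inv d) (snd d p)
           (fderiv (snd d \<circ> chart_inv c) (snd c p) x))"
    using M cM by (simp add: frechet_derivative_eqI)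
  then show ?thesis by simp
qed

lemma smooth_fun_on_chart:
  assumes "smooth_manifold M" "c \<in> atlas M"
  shows "smooth_fun_on M (fst c) (snd c)"
proof (rule smooth_fun_onI)
  fix d assume "d \<in> atlas M"
  then show "smooth_on (snd c \<circ> chart_inv d) (snd d ` (fst d \<inter> fst c))"
    using smooth_manifoldD(7)[OF assms(1) _ assms(2)] by simp
qed

lemma coord_tangent_same [simp]:
  assumes M: "smooth_manifold M" and c: "c \<in> charts_at M p"
  shows "coord_tangent M p c x c = x"
proof -
  have cM: "c \<in> atlas M" "p \<in> fst c" using c by auto
  have "fderiv (snd c \<circ> chart_inv c) (snd c p) =
      fderiv (\<lambda>y. y) (snd c p)"
    by (rule frechet_derivative_cong_open[of "snd c ` fst c"])
      (use M cM smooth_manifoldD(5)[OF M] in auto)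
  then show ?thesis using c by (simp add: coord_tangent_def)
qed

lemma coord_tangent_in_tangent_space:
  assumes M: "smooth_manifold M" and c: "c \<in> charts_at M p"
  shows "coord_tangent M p c x \<in> tangent_space M p"
proof -
  have "coord_tangent M p c x d' =
      fderiv (snd d' \<circ> chart_inv d) (snd d p) (coord_tangent M p c x d)"
    if d: "d \<in> charts_at M p" "d' \<in> charts_at M p" for d d'
  proof -
    have "d' \<in> atlas M" "p \<in> fst d'" using d(2) by auto
    from fderiv_transition_comp[OF M c d(1) smooth_manifoldD(4)[OF M this(1)] this(2)
        smooth_fun_on_chart[OF M this(1)]]
    show ?thesis using d by (simp add: coord_tangent_def)
  qed
  moreover have "coord_tangent M p c x d = 0" if "d \<notin> charts_at M p" for d
    using that unfolding coord_tangent_def by (rule if_not_P)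
  ultimately show ?thesis unfolding tangent_space_def mem_Collect_eq by blast
qed

lemma tangent_eq_coord_tangent:
  assumes "v \<in> tangent_space M p" "c \<in> charts_at M p"
  shows "v = coord_tangent M p c (v c)"
proof
  fix d
  show "v d = coord_tangent M p c (v c) d"
  proof (cases "d \<in> charts_at M p")
    case True
    then have "v d = fderiv (snd d \<circ> chart_inv c) (snd c p) (v c)"
      using assms unfolding tangent_space_def by blast
    then show ?thesis unfolding coord_tangent_def using True by (simp only: if_True)
  next
    case False
    then have "v d = 0" using assms(1) unfolding tangent_space_def by blast
    then show ?thesis unfolding coord_tangent_def using False by (simp only: if_False)
  qed
qed

lemma ball_tangent_space:
  assumes "smooth_manifold M" "c \<in> charts_at M p"
  shows "(\<forall>v\<in>tangent_space M p. P (v c)) \<longleftrightarrow> (\<forall>x. P x)"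
  using coord_tangent_in_tangent_space[OF assms] coord_tangent_same[OF assms] by metis

lemma tangent_space_scaleR:
  assumes M: "smooth_manifold M" and v: "v \<in> tangent_space M p"
  shows "(\<lambda>d. a *\<^sub>R v d) \<in> tangent_space M p"
  unfolding tangent_space_def
proof (rule CollectI, intro conjI allI ballI impI)
  fix d assume "d \<notin> charts_at M p"
  then have "v d = 0" using v unfolding tangent_space_def by blast
  then show "a *\<^sub>R v d = 0" by simp
next
  fix d d' assume d: "d \<in> charts_at M p" "d' \<in> charts_at M p"
  then have "linear (fderiv (snd d' \<circ> chart_inv d) (snd d p))"
    using smooth_on_linear_derivative[OF smooth_manifoldD(7)[OF M, of d d']] by auto
  moreover have "v d' = fderiv (snd d' \<circ> chart_inv d) (snd d p) (v d)"
    using v d unfolding tangent_space_def by blast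
  ultimately show "a *\<^sub>R v d' = fderiv (snd d' \<circ> chart_inv d) (snd d p) (a *\<^sub>R v d)"
    by (simp add: linear_scale)
qed

lemma tangent_zero_iff:
  assumes "smooth_manifold M" "c \<in> charts_at M p" "v \<in> tangent_space M p"
  shows "v = (\<lambda>_. 0) \<longleftrightarrow> v c = 0"
proof
  assume "v c = 0"
  have lin: "linear (fderiv (snd d \<circ> chart_inv c) (snd c p))"
    if "d \<in> charts_at M p" for d
    using smooth_on_linear_derivative[OF smooth_manifoldD(7)[OF assms(1), of c d]] assms(2) that
    by auto
  have "coord_tangent M p c 0 d = 0" for d
    using linear_0[OF lin] by (auto simp: coord_tangent_def)
  then show "v = (\<lambda>_. 0)"
    using tangent_eq_coord_tangent[OF assms(3,2)] \<open>v c = 0\<close> by auto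
qed simp

lemma differential_eq:
  assumes M: "smooth_manifold M" and c: "c \<in> charts_at M p"
    and W: "openin (mtop M) W" "p \<in> W" and g: "smooth_fun_on M W g"
    and v: "v \<in> tangent_space M p"
  shows "differential M g p v = fderiv (g \<circ> chart_inv c) (snd c p) (v c)"
proof -
  define d where "d = (SOME d. d \<in> charts_at M p)"
  have d: "d \<in> charts_at M p" using c someI[of "\<lambda>d. d \<in> charts_at M p"] unfolding d_def by blast
  have "v d = fderiv (snd d \<circ> chart_inv c) (snd c p) (v c)"
    using v c d unfolding tangent_space_def by blast
  then show ?thesis
    using fderiv_transition_comp[OF M c d W g] unfolding differential_def Let_def d_def[symmetric]
    by (simp only:)
qed

lemma differential_cong:
  assumes M: "smooth_manifold M" and W: "openin (mtop M) W" "p \<in> W"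
    and g: "\<And>q. q \<in> W \<Longrightarrow> g q = h q"
  shows "differential M g p = differential M h p"
proof -
  define d where "d = (SOME d. d \<in> charts_at M p)"
  have "d \<in> charts_at M p"
    unfolding d_def by (rule some_chart[OF M]) (use W openin_subset in auto)
  then have d: "d \<in> atlas M" "p \<in> fst d" by auto
  have "fderiv (g \<circ> chart_inv d) (snd d p) =
      fderiv (h \<circ> chart_inv d) (snd d p)"
    by (rule frechet_derivative_cong_open[OF open_chart_image[OF M d(1) W(1)]])
      (use W d M g in auto)
  then show ?thesis unfolding differential_def Let_def d_def[symmetric] by (simp only:)
qed

lemma differential_minus:
  assumes M: "smooth_manifold M" and W: "openin (mtop M) W" "p \<in> W" and g: "smooth_fun_on M W g"
    and v: "v \<in> tangent_space M p"
  shows "differential M (\<lambda>q. - g q) p v = - differential M g p v"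
proof -
  define d where "d = (SOME d. d \<in> charts_at M p)"
  have "d \<in> charts_at M p"
    unfolding d_def by (rule some_chart[OF M]) (use W openin_subset in auto)
  then have d: "d \<in> atlas M" "p \<in> fst d" by auto
  have "((\<lambda>x. - (g \<circ> chart_inv d) x) has_derivative
      (\<lambda>x. - fderiv (g \<circ> chart_inv d) (snd d p) x)) (at (snd d p))"
    by (rule has_derivative_minus[OF smooth_on_has_derivative[OF smooth_fun_onD[OF g d(1)]]])
      (use W d in auto)
  from frechet_derivative_eqI[OF this] show ?thesis
    unfolding differential_def Let_def d_def[symmetric] by (simp add: comp_def)
qed

subsection \<open>Bump functions and global extension\<close>

text \<open>In a chart the function is \<open>flat_exp 0\<close> of \<open>r\<^sup>2\<close> minus
  the squared distance to the image z of p. It is smooth on the chart domain and zero outside the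
  preimage C of a closed ball; as C is closed in M, the two descriptions cover M by open
  sets.\<close>

lemma bump_function:
  fixes M :: "('a, 'v::euclidean_space) manifold"
  assumes M: "smooth_manifold M" and V: "openin (mtop M) V" "p \<in> V"
  obtains b :: "'a \<Rightarrow> real" and C where "smooth_fun_on M (points M) b" "b p = 1"
    "closedin (mtop M) C" "C \<subseteq> V" "\<And>q. q \<notin> C \<Longrightarrow> b q = 0"
proof -
  obtain c where c: "c \<in> atlas M" "p \<in> fst c"
    using exists_chart[OF M] openin_subset[OF V(1)] V(2) by blast
  define z where "z = snd c p"
  obtain r where r: "r > 0" "cball z r \<subseteq> snd c ` (fst c \<inter> V)"
    using open_chart_image[OF M c(1) V(1)] V(2) c(2) unfolding z_def open_contains_cball by blast
  define C where "C = {q \<in> fst c. snd c q \<in> cball z r}"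
  define b where "b q = (if q \<in> fst c then flat_exp 0 (r\<^sup>2 - (snd c q - z) \<bullet> (snd c q - z)) else 0)" for q
  have CV: "C \<subseteq> V" using r(2) c inj_on_chart[OF M c(1)] unfolding C_def by (auto dest: inj_onD)
  have b0: "b q = 0" if "q \<notin> C" for q
  proof (cases "q \<in> fst c")
    case True
    then have "r < norm (snd c q - z)" using that by (auto simp: C_def dist_norm norm_minus_commute)
    then have "r\<^sup>2 < (norm (snd c q - z))\<^sup>2" using r(1) by (simp add: power_strict_mono)
    then show ?thesis by (simp add: b_def flat_exp_def power2_norm_eq_inner)
  qed (simp add: b_def)
  have hom: "homeomorphic_maps (subtopology (mtop M) (fst c)) (top_of_set (snd c ` fst c)) (snd c) (chart_inv c)"
  proof -
    obtain g where g: "homeomorphic_maps (subtopology (mtop M) (fst c)) (top_of_set (snd c ` fst c)) (snd c) g"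
      using smooth_manifoldD(6)[OF M c(1)] by (auto simp: homeomorphic_map_maps)
    have eq: "g y = chart_inv c y" if "y \<in> snd c ` fst c" for y
      using that g chart_subset[OF M c(1)] M c(1) by (auto simp: homeomorphic_maps_def)
    show ?thesis by (rule homeomorphic_maps_eq[OF g]) (use eq in auto)
  qed
  \<comment> \<open>A set that is closed in the chart domain could have limit points elsewhere in M.
    Compactness of the ball together with the Hausdorff property excludes this.\<close>
  have "closedin (mtop M) C"
  proof -
    have "compactin (top_of_set (snd c ` fst c)) (cball z r)"
      using r(2) by (auto simp: compactin_subtopology)
    then have "compactin (subtopology (mtop M) (fst c)) (chart_inv c ` cball z r)"
      using hom unfolding homeomorphic_maps_def by (blast intro: image_compactin)
    then have "compactin (mtop M) (chart_inv c ` cball z r)"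
      by (simp add: compactin_subtopology)
    moreover have "chart_inv c ` cball z r = C"
    proof -
      have "chart_inv c y \<in> fst c \<and> snd c (chart_inv c y) = y" if "y \<in> cball z r" for y
      proof -
        have "y \<in> snd c ` fst c" using r(2) that by auto
        then show ?thesis by (simp add: f_inv_into_f inv_into_into)
      qed
      moreover have "q \<in> chart_inv c ` cball z r" if "q \<in> C" for q
        using that M c(1) unfolding C_def by (metis (mono_tags, lifting) chart_inv_chart imageI mem_Collect_eq)
      ultimately show ?thesis by (auto simp: C_def)
    qed
    ultimately show ?thesis using smooth_manifoldD(1)[OF M] by (metis compactin_imp_closedin)
  qed
  have "smooth_fun_on M (points M) b"
  proof (rule smooth_fun_on_local[OF M])
    fix q assume q: "q \<in> points M"
    show "\<exists>V. openin (mtop M) V \<and> q \<in> V \<and> smooth_fun_on M V b"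
    proof (cases "q \<in> C")
      case True
      have op: "open (snd c ` fst c)" by (rule smooth_manifoldD(5)[OF M c(1)])
      have "smooth_on (\<lambda>y. flat_exp 0 (r\<^sup>2 - (y - z) \<bullet> (y - z))) (snd c ` fst c)"
        by (rule smooth_on_compose[OF op smooth_on_flat_exp[of _ UNIV]])
          (auto intro!: smooth_intros op)
      then have "smooth_on (b \<circ> chart_inv c) (snd c ` fst c)"
        by (rule smooth_on_cong[OF op]) (use M c(1) in \<open>auto simp: b_def\<close>)
      then have "smooth_fun_on M (fst c) b"
        using smooth_fun_on_chartI[OF M c(1) smooth_manifoldD(4)[OF M c(1)]] by auto
      then show ?thesis using True smooth_manifoldD(4)[OF M c(1)] unfolding C_def by blast
    next
      case False
      have "openin (mtop M) (points M - C)" using \<open>closedin (mtop M) C\<close> by blast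
      moreover have "smooth_fun_on M (points M - C) b"
        by (rule smooth_fun_on_cong[OF M calculation smooth_fun_on_const[of _ _ 0]]) (use b0 in auto)
      ultimately show ?thesis using False q by blast
    qed
  qed
  moreover have "b p > 0" using r(1) c(2) by (simp add: b_def z_def flat_exp_def)
  ultimately have "smooth_fun_on M (points M) (\<lambda>q. (1 / b p) *\<^sub>R b q)"
    by (intro smooth_fun_on_scaleR M smooth_fun_on_const) auto
  then show thesis
    by (rule that[of _ C]) (use \<open>b p > 0\<close> \<open>closedin (mtop M) C\<close> CV b0 in auto)
qed

text \<open>The bump function may destroy g everywhere except at p. This suffices for curvature
  arguments, which see sections only through their value at p.\<close>

lemma extend_smooth_fun:
  fixes M :: "('a, 'v::euclidean_space) manifold" and g :: "'a \<Rightarrow> 'e::euclidean_space"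
  assumes M: "smooth_manifold M" and V: "openin (mtop M) V" "p \<in> V" and g: "smooth_fun_on M V g"
  obtains b :: "'a \<Rightarrow> real" where "smooth_fun_on M (points M) (\<lambda>q. if q \<in> V then b q *\<^sub>R g q else 0)"
    "b p = 1"
proof -
  obtain b C where b: "smooth_fun_on M (points M) b" "b p = (1::real)"
    "closedin (mtop M) C" "C \<subseteq> V" "\<And>q. q \<notin> C \<Longrightarrow> b q = 0"
    by (rule bump_function[OF M V]) blast
  let ?h = "\<lambda>q. if q \<in> V then b q *\<^sub>R g q else 0"
  have "smooth_fun_on M (points M) ?h"
  proof (rule smooth_fun_on_local[OF M])
    fix q assume q: "q \<in> points M"
    show "\<exists>V. openin (mtop M) V \<and> q \<in> V \<and> smooth_fun_on M V ?h"
    proof (cases "q \<in> V")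
      case True
      have "smooth_fun_on M V (\<lambda>q. b q *\<^sub>R g q)"
        using smooth_fun_on_mono[OF b(1) openin_subset[OF V(1)]] g
        by (intro smooth_fun_on_scaleR M V)
      then have "smooth_fun_on M V ?h" by (rule smooth_fun_on_cong[OF M V(1)]) auto
      then show ?thesis using True V(1) by blast
    next
      case False
      have op: "openin (mtop M) (points M - C)" using b(3) by blast
      moreover have "smooth_fun_on M (points M - C) ?h"
        by (rule smooth_fun_on_cong[OF M op smooth_fun_on_const[of _ _ 0]]) (use b(5) in auto)
      ultimately show ?thesis using False q b(4) by blast
    qed
  qed
  then show thesis using b(2) that by blast
qed

lemma exists_vector_field:
  fixes M :: "('a, 'v::euclidean_space) manifold"
  assumes M: "smooth_manifold M" and p: "p \<in> points M" and v: "v \<in> tangent_space M p"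
  obtains X where "vector_field M X" "X p = v"
proof -
  obtain c where c: "c \<in> charts_at M p" using exists_chart[OF M p] .
  then have cM: "c \<in> atlas M" "p \<in> fst c" by auto
  obtain b C where b: "smooth_fun_on M (points M) b" "b p = (1::real)"
    "closedin (mtop M) C" "C \<subseteq> fst c" "\<And>q. q \<notin> C \<Longrightarrow> b q = 0"
    by (rule bump_function[OF M smooth_manifoldD(4)[OF M cM(1)] cM(2)]) blast
  \<comment> \<open>The field with constant component in the chart c, cut off by b.\<close>
  define X where "X q d = b q *\<^sub>R coord_tangent M q c (v c) d" for q d
  have tan: "X q \<in> tangent_space M q" if q: "q \<in> points M" for q
  proof (cases "q \<in> fst c")
    case True
    then have c': "c \<in> charts_at M q" using cM by simp
    show ?thesis unfolding X_def
      by (rule tangent_space_scaleR[OF M coord_tangent_in_tangent_space[OF M c']])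
  next
    case False
    then have "b q = 0" using b(4,5) by blast
    moreover obtain d where d: "d \<in> charts_at M q" using exists_chart[OF M q] .
    ultimately have "X q = (\<lambda>d'. 0 *\<^sub>R coord_tangent M q d 0 d')" by (simp add: X_def fun_eq_iff)
    then show ?thesis
      using tangent_space_scaleR[OF M coord_tangent_in_tangent_space[OF M d], of 0 0] by simp
  qed
  have sm: "smooth_on (\<lambda>y. X (chart_inv d y) d) (snd d ` fst d)" if d: "d \<in> atlas M" for d
  proof (rule smooth_on_local)
    fix y assume "y \<in> snd d ` fst d"
    then obtain q where q: "q \<in> fst d" "y = snd d q" by auto
    show "\<exists>T. open T \<and> y \<in> T \<and> smooth_on (\<lambda>y. X (chart_inv d y) d) T"
    proof (cases "q \<in> C")
      case True
      let ?T = "snd d ` (fst d \<inter> fst c)"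
      have op: "open ?T" by (rule open_chart_image[OF M d smooth_manifoldD(4)[OF M cM(1)]])
      have "smooth_on (\<lambda>y. (b \<circ> chart_inv d) y *\<^sub>R
          fderiv (snd d \<circ> chart_inv c) ((snd c \<circ> chart_inv d) y) (v c)) ?T"
      proof (intro smooth_on_scaleR op)
        show "smooth_on (b \<circ> chart_inv d) ?T"
          by (rule smooth_fun_onD[OF smooth_fun_on_mono[OF b(1) chart_subset[OF M cM(1)]] d])
        show "smooth_on (\<lambda>y. fderiv (snd d \<circ> chart_inv c) ((snd c \<circ> chart_inv d) y) (v c)) ?T"
          by (rule smooth_on_compose[OF op smooth_on_frechet_derivative[OF
                  smooth_manifoldD(7)[OF M cM(1) d]] smooth_manifoldD(7)[OF M d cM(1)]])
            (use M d in auto)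
      qed
      then have "smooth_on (\<lambda>y. X (chart_inv d y) d) ?T"
        by (rule smooth_on_cong[OF op]) (use M d in \<open>auto simp: X_def coord_tangent_def\<close>)
      then show ?thesis using op q True b(4) by blast
    next
      case False
      have op: "openin (mtop M) (points M - C)" using b(3) by blast
      have op': "open (snd d ` (fst d \<inter> (points M - C)))" by (rule open_chart_image[OF M d op])
      have "smooth_on (\<lambda>y. X (chart_inv d y) d) (snd d ` (fst d \<inter> (points M - C)))"
        by (rule smooth_on_cong[OF op' smooth_on_const[of 0]])
          (use M d b(5) in \<open>auto simp: X_def\<close>)
      then show ?thesis using op' q False chart_subset[OF M d] by blast
    qed
  qed
  have "X p = v" using tangent_eq_coord_tangent[OF v c] b(2) by (auto simp: X_def)
  moreover have "vector_field M X" using tan sm by (simp add: vector_field_def)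
  ultimately show thesis using that by blast
qed

section \<open>Legendre pairs\<close>

lemma has_fderiv_inner:
  assumes "smooth_on f S" "smooth_on g S" "z \<in> S"
  shows "((\<lambda>y. f y \<bullet> g y) has_derivative (\<lambda>x. f z \<bullet> fderiv g z x + fderiv f z x \<bullet> g z)) (at z)"
  by (intro has_derivative_inner smooth_on_has_derivative[OF assms(1,3)]
      smooth_on_has_derivative[OF assms(2,3)])

lemma fderiv_inner_constant:
  assumes "open S" "smooth_on f S" "smooth_on g S" "z \<in> S" "\<And>y. y \<in> S \<Longrightarrow> f y \<bullet> g y = k"
  shows "fderiv f z x \<bullet> g z = - (f z \<bullet> fderiv g z x)"
proof -
  have "fderiv (\<lambda>y. f y \<bullet> g y) z = fderiv (\<lambda>y. k) z"
    by (rule frechet_derivative_cong_open[OF assms(1,4)]) (rule assms(5))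
  then have "(\<lambda>x. f z \<bullet> fderiv g z x + fderiv f z x \<bullet> g z) = (\<lambda>x. 0)"
    using frechet_derivative_eqI[OF has_fderiv_inner[OF assms(2,3,4)]] by simp
  from fun_cong[OF this, of x] show ?thesis by simp
qed

lemma linear_eq_sum_Basis:
  fixes h :: "'a::euclidean_space \<Rightarrow> 'b::real_vector"
  assumes "linear h"
  shows "h w = (\<Sum>b\<in>Basis. (w \<bullet> b) *\<^sub>R h b)"
  using linear_sum[OF assms, of "\<lambda>b. (w \<bullet> b) *\<^sub>R b" Basis] linear_scale[OF assms]
  by (simp add: euclidean_representation)

lemma smooth_on_fderiv_apply:
  fixes f :: "'v::euclidean_space \<Rightarrow> 'e::real_normed_vector"
  assumes S: "open S" and f: "smooth_on f S" and Y: "smooth_on Y S"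
  shows "smooth_on (\<lambda>y. fderiv f y (Y y)) S"
proof -
  have "smooth_on (\<lambda>y. \<Sum>b\<in>Basis. (Y y \<bullet> b) *\<^sub>R fderiv f y b) S"
    by (intro smooth_intros S Y smooth_on_frechet_derivative f)
  then show ?thesis
    by (rule smooth_on_cong[OF S]) (simp add: linear_eq_sum_Basis[OF smooth_on_linear_derivative[OF f], symmetric])
qed

text \<open>Product rule for the derivative along a field Y. The first summand is symmetric in x and
  Y z; after antisymmetrising two fields only the second one survives, and it produces the Lie
  bracket.\<close>

lemma fderiv_fderiv_apply:
  fixes f :: "'v::euclidean_space \<Rightarrow> 'e::real_normed_vector"
  assumes S: "open S" "z \<in> S" and f: "smooth_on f S" and Y: "smooth_on Y S"
  shows "fderiv (\<lambda>y. fderiv f y (Y y)) z x = fderiv (\<lambda>y. fderiv f y (Y z)) z x + fderiv f z (fderiv Y z x)"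
proof -
  have exp: "fderiv f y w = (\<Sum>b\<in>Basis. (w \<bullet> b) *\<^sub>R fderiv f y b)" if "y \<in> S" for y w
    by (rule linear_eq_sum_Basis[OF smooth_on_linear_derivative[OF f that]])
  have D: "fderiv (\<lambda>y. fderiv f y (W y)) z x =
      (\<Sum>b\<in>Basis. (W z \<bullet> b) *\<^sub>R fderiv (\<lambda>y. fderiv f y b) z x + (fderiv W z x \<bullet> b) *\<^sub>R fderiv f z b)"
    if W: "smooth_on W S" for W
  proof -
    have "fderiv (\<lambda>y. fderiv f y (W y)) z = fderiv (\<lambda>y. \<Sum>b\<in>Basis. (W y \<bullet> b) *\<^sub>R fderiv f y b) z"
      by (rule frechet_derivative_cong_open[OF S]) (rule exp)
    also have "\<dots> = (\<lambda>x. \<Sum>b\<in>Basis. (W z \<bullet> b) *\<^sub>R fderiv (\<lambda>y. fderiv f y b) z x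
        + (fderiv W z x \<bullet> b) *\<^sub>R fderiv f z b)"
      by (rule frechet_derivative_eqI[OF has_derivative_sum[OF has_derivative_scaleR[OF
                has_derivative_inner_left[OF smooth_on_has_derivative[OF W S(2)]]
                smooth_on_has_derivative[OF smooth_on_frechet_derivative[OF f] S(2)]]]])
    finally show ?thesis by simp
  qed
  show ?thesis
    using D[OF Y] D[OF smooth_on_const, of "Y z"] exp[OF S(2), of "fderiv Y z x"]
    by (simp add: sum.distrib)
qed

text \<open>A frontal and its unit normal in coordinates, that is, a map into the unit tangent
  bundle of the sphere that is isotropic for the contact structure. It may have singular
  points.\<close>

definition legendre_pair ::
  "('v::euclidean_space \<Rightarrow> 'e::euclidean_space) \<Rightarrow> ('v \<Rightarrow> 'e) \<Rightarrow> 'v set \<Rightarrow> bool" where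
  "legendre_pair F N S \<longleftrightarrow> open S \<and> smooth_on F S \<and> smooth_on N S \<and>
     (\<forall>z\<in>S. F z \<bullet> F z = 1 \<and> N z \<bullet> N z = 1 \<and> F z \<bullet> N z = 0 \<and> (\<forall>x. fderiv F z x \<bullet> N z = 0))"

lemma legendre_pairD:
  assumes "legendre_pair F N S"
  shows "open S" "smooth_on F S" "smooth_on N S"
    and "z \<in> S \<Longrightarrow> F z \<bullet> F z = 1" "z \<in> S \<Longrightarrow> N z \<bullet> N z = 1"
    and "z \<in> S \<Longrightarrow> F z \<bullet> N z = 0" "z \<in> S \<Longrightarrow> N z \<bullet> F z = 0"
    and "z \<in> S \<Longrightarrow> fderiv F z x \<bullet> N z = 0" "z \<in> S \<Longrightarrow> fderiv F z x \<bullet> F z = 0"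
    and "z \<in> S \<Longrightarrow> fderiv N z x \<bullet> N z = 0" "z \<in> S \<Longrightarrow> fderiv N z x \<bullet> F z = 0"
proof -
  show 1: "open S" "smooth_on F S" "smooth_on N S"
    and F: "\<And>z. z \<in> S \<Longrightarrow> F z \<bullet> F z = 1" and N: "\<And>z. z \<in> S \<Longrightarrow> N z \<bullet> N z = 1"
    and FN: "\<And>z. z \<in> S \<Longrightarrow> F z \<bullet> N z = 0" and dF: "\<And>z. z \<in> S \<Longrightarrow> fderiv F z x \<bullet> N z = 0"
    using assms by (auto simp: legendre_pair_def)
  show "z \<in> S \<Longrightarrow> N z \<bullet> F z = 0" using FN by (simp add: inner_commute)
  show "z \<in> S \<Longrightarrow> fderiv F z x \<bullet> F z = 0"
    using fderiv_inner_constant[OF 1(1,2,2) _ F, of z x] by (simp add: inner_commute)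
  show "z \<in> S \<Longrightarrow> fderiv N z x \<bullet> N z = 0"
    using fderiv_inner_constant[OF 1(1,3,3) _ N, of z x] by (simp add: inner_commute)
  show "z \<in> S \<Longrightarrow> fderiv N z x \<bullet> F z = 0"
    using fderiv_inner_constant[OF 1(1,2,3) _ FN, of z x] dF[of z] by (simp add: inner_commute)
qed

text \<open>Up to sign both sides are the second derivative of F paired with N. So the second
  fundamental form is symmetric also at singular points of F.\<close>

lemma legendre_pair_symmetric:
  assumes L: "legendre_pair F N S" and z: "z \<in> S"
  shows "fderiv F z x \<bullet> fderiv N z y = fderiv F z y \<bullet> fderiv N z x"
proof -
  note L' = legendre_pairD[OF L]
  have "fderiv (\<lambda>u. fderiv F u x) z y \<bullet> N z = - (fderiv F z x \<bullet> fderiv N z y)" for x y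
    by (rule fderiv_inner_constant[OF L'(1) smooth_on_frechet_derivative[OF L'(2)] L'(3) z L'(8)])
  then show ?thesis using symmetric_second_frechet_derivative[OF L'(1) z L'(2), of x y] by (metis neg_equal_iff_equal)
qed

definition proj_away :: "'e::euclidean_space \<Rightarrow> 'e \<Rightarrow> 'e \<Rightarrow> 'e" where
  "proj_away a b w = w - (w \<bullet> a) *\<^sub>R a - (w \<bullet> b) *\<^sub>R b"

lemma linear_proj_away: "linear (proj_away a b)"
  by (rule linearI) (auto simp: proj_away_def algebra_simps)

lemma proj_away_ident: "w \<bullet> a = 0 \<Longrightarrow> w \<bullet> b = 0 \<Longrightarrow> proj_away a b w = w"
  by (simp add: proj_away_def)

text \<open>The Gauss equation in a chart: \<open>proj_away (F z) (N z)\<close> is the projection onto the fibre at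
  \<open>z\<close> of the bundle orthogonal to \<open>F\<close> and \<open>N\<close>.\<close>

lemma legendre_pair_gauss:
  assumes L: "legendre_pair F N S" and z: "z \<in> S"
    and X: "smooth_on X S" and Y: "smooth_on Y S" and xi: "smooth_on \<xi> S"
    and E: "\<And>y. y \<in> S \<Longrightarrow> \<xi> y \<bullet> F y = 0" "\<And>y. y \<in> S \<Longrightarrow> \<xi> y \<bullet> N y = 0"
  defines "P \<equiv> \<lambda>y. proj_away (F y) (N y)"
  shows "P z (fderiv (\<lambda>y. P y (fderiv \<xi> y (Y y))) z (X z))
       - P z (fderiv (\<lambda>y. P y (fderiv \<xi> y (X y))) z (Y z))
       - P z (fderiv \<xi> z (fderiv Y z (X z) - fderiv X z (Y z)))
     = (fderiv F z (Y z) \<bullet> \<xi> z) *\<^sub>R fderiv F z (X z) - (fderiv F z (X z) \<bullet> \<xi> z) *\<^sub>R fderiv F z (Y z)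
     + (fderiv N z (Y z) \<bullet> \<xi> z) *\<^sub>R fderiv N z (X z) - (fderiv N z (X z) \<bullet> \<xi> z) *\<^sub>R fderiv N z (Y z)"
proof -
  note L' = legendre_pairD[OF L]
  note S = L'(1)
  interpret P: linear "P z" unfolding P_def by (rule linear_proj_away)
  have PF: "P z (F z) = 0" and PN: "P z (N z) = 0"
    and PdF: "P z (fderiv F z x) = fderiv F z x" and PdN: "P z (fderiv N z x) = fderiv N z x" for x
    using z L' by (auto simp: P_def proj_away_def)
  \<comment> \<open>As \<xi> is orthogonal to F and N, the projection adds a F + b N to the
    derivative of \<xi>, where a and b pair \<xi> with the derivatives of F and N along W. After
    differentiating and projecting once more, F and N themselves disappear and a dF + b dN remains:
    these are the curvature terms.\<close>
  have key: "P z (fderiv (\<lambda>y. P y (fderiv \<xi> y (W y))) z x) =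
      P z (fderiv (\<lambda>y. fderiv \<xi> y (W z)) z x) + P z (fderiv \<xi> z (fderiv W z x)) +
      (fderiv F z (W z) \<bullet> \<xi> z) *\<^sub>R fderiv F z x + (fderiv N z (W z) \<bullet> \<xi> z) *\<^sub>R fderiv N z x"
    if W: "smooth_on W S" for W x
  proof -
    define a where "a y = \<xi> y \<bullet> fderiv F y (W y)" for y
    define b where "b y = \<xi> y \<bullet> fderiv N y (W y)" for y
    define h where "h y = fderiv \<xi> y (W y)" for y
    have sm: "smooth_on a S" "smooth_on b S" "smooth_on h S"
      unfolding a_def b_def h_def
      by (intro smooth_intros smooth_on_fderiv_apply S xi W L')+
    have "P y (fderiv \<xi> y (W y)) = h y + a y *\<^sub>R F y + b y *\<^sub>R N y" if y: "y \<in> S" for y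
      using fderiv_inner_constant[OF S xi L'(2) y E(1), of "W y"]
        fderiv_inner_constant[OF S xi L'(3) y E(2), of "W y"]
      by (simp add: P_def proj_away_def a_def b_def h_def)
    then have "fderiv (\<lambda>y. P y (fderiv \<xi> y (W y))) z = fderiv (\<lambda>y. h y + a y *\<^sub>R F y + b y *\<^sub>R N y) z"
      by (intro frechet_derivative_cong_open[OF S z]) auto
    also have "\<dots> = (\<lambda>x. fderiv h z x + (a z *\<^sub>R fderiv F z x + fderiv a z x *\<^sub>R F z)
        + (b z *\<^sub>R fderiv N z x + fderiv b z x *\<^sub>R N z))"
      by (rule frechet_derivative_eqI) (intro has_derivative_add has_derivative_scaleR
          smooth_on_has_derivative[OF sm(1) z] smooth_on_has_derivative[OF sm(2) z]
          smooth_on_has_derivative[OF sm(3) z] smooth_on_has_derivative[OF L'(2) z]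
          smooth_on_has_derivative[OF L'(3) z])
    finally have "P z (fderiv (\<lambda>y. P y (fderiv \<xi> y (W y))) z x) =
        P z (fderiv h z x) + a z *\<^sub>R fderiv F z x + b z *\<^sub>R fderiv N z x"
      by (simp add: P.add P.scale PF PN PdF PdN)
    moreover have "fderiv h z x = fderiv (\<lambda>y. fderiv \<xi> y (W z)) z x + fderiv \<xi> z (fderiv W z x)"
      unfolding h_def by (rule fderiv_fderiv_apply[OF S z xi W])
    ultimately show ?thesis by (simp add: P.add a_def b_def inner_commute)
  qed
  have lin: "linear (fderiv \<xi> z)" by (rule smooth_on_linear_derivative[OF xi z])
  show ?thesis
    unfolding key[OF X] key[OF Y] linear_diff[OF lin] P.diff
      symmetric_second_frechet_derivative[OF S z xi, of "X z" "Y z"]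
    by simp
qed

text \<open>Proportionality of any two values, without a division or a chosen spanning vector. It is
  the form in which the condition falls out of the Gauss equation when the section has the value D
  x.\<close>

definition rank_le_one :: "('v::euclidean_space \<Rightarrow> 'e::euclidean_space) \<Rightarrow> bool" where
  "rank_le_one D \<longleftrightarrow> (\<forall>x y. (D x \<bullet> D x) *\<^sub>R D y = (D y \<bullet> D x) *\<^sub>R D x)"

lemma rank_le_oneD:
  assumes "rank_le_one D"
  shows "(D y \<bullet> w) *\<^sub>R D x = (D x \<bullet> w) *\<^sub>R D y"
proof (cases "D x = 0")
  case False
  have "(D x \<bullet> D x) *\<^sub>R D y = (D y \<bullet> D x) *\<^sub>R D x"
    using assms unfolding rank_le_one_def by blast
  then have "D y = ((D y \<bullet> D x) / (D x \<bullet> D x)) *\<^sub>R D x"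
    using False by (metis divide_inverse_commute inner_eq_zero_iff left_inverse scaleR_one scaleR_scaleR)
  then obtain k where "D y = k *\<^sub>R D x" by blast
  then show ?thesis by simp
qed simp

text \<open>The range lies in the orthogonal complement of S, whose dimension is below that of the
  domain. With S empty it gives kernels of functionals, with the three vectors F, N, e the direction
  that defines the caustic radius.\<close>

lemma kernel_of_orthogonal_range:
  fixes B :: "'v::euclidean_space \<Rightarrow> 'e::euclidean_space"
  assumes B: "linear B" and S: "pairwise orthogonal S" "0 \<notin> S"
    and orth: "\<And>x s. s \<in> S \<Longrightarrow> B x \<bullet> s = 0" and dim: "DIM('e) < DIM('v) + card S"
  obtains x where "x \<noteq> 0" "B x = 0"
proof (rule ccontr)
  assume "\<not> thesis"
  then have "inj B" using that linear_injective_0[OF B] by blast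
  then have "dim (range B) = DIM('v)" using dim_image_eq[OF B, of UNIV] by simp
  moreover have "range B \<subseteq> {y \<in> UNIV. \<forall>x\<in>span S. orthogonal x y}"
  proof -
    have "orthogonal (B x) s" if "s \<in> span S" for x s
      by (rule orthogonal_to_span[OF that]) (simp add: orthogonal_def orth)
    then show ?thesis by (auto simp: orthogonal_commute)
  qed
  then have "dim (range B) \<le> dim {y \<in> UNIV. \<forall>x\<in>span S. orthogonal x y}" by (rule dim_subset)
  moreover have "dim {y \<in> UNIV. \<forall>x\<in>span S. orthogonal x y} + dim (span S) = DIM('e)"
    using dim_subspace_orthogonal_to_vectors[OF subspace_span subspace_UNIV, of S] by simp
  moreover have "dim (span S) = card S"
    by (rule dim_span_eq_card_independent[OF pairwise_orthogonal_independent[OF S]])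
  ultimately show False using dim by linarith
qed

text \<open>If D w is not zero, D vanishes wherever the functional D x \<bullet> D w does, and in
  dimension at least two that functional has a nonzero zero. This is the source of the hypothesis n
  \<ge> 2.\<close>

lemma rank_le_one_kernel:
  fixes D :: "'v::euclidean_space \<Rightarrow> 'e::euclidean_space"
  assumes "rank_le_one D" "linear D" "2 \<le> DIM('v)"
  obtains x where "x \<noteq> 0" "D x = 0"
proof (cases "\<exists>w. D w \<noteq> 0")
  case True
  then obtain w where w: "D w \<noteq> 0" by blast
  have "linear (\<lambda>x. D x \<bullet> D w)"
    using linear_compose[OF assms(2), of "\<lambda>y. y \<bullet> D w"] 
    by (simp add: comp_def bounded_linear.linear bounded_linear_inner_left)
  then obtain x where x: "x \<noteq> 0" "D x \<bullet> D w = 0"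
    by (rule kernel_of_orthogonal_range[of _ "{}"]) (use assms(3) in auto)
  have "(D w \<bullet> D w) *\<^sub>R D x = (D x \<bullet> D w) *\<^sub>R D w" using assms(1) unfolding rank_le_one_def by blast
  then have "D x = 0" using x w by simp
  then show ?thesis using x that by blast
next
  case False
  then show ?thesis using that[of "SOME b. b \<in> Basis"] nonempty_Basis some_in_eq
    by (metis nonzero_Basis)
qed

text \<open>Local form of the caustic construction: \<open>x0\<close> is a constant direction on which \<open>dN\<close> does not
  vanish, and the unit vector along \<open>dN x0\<close> is the normal of the caustic.\<close>

locale caustic_chart =
  fixes F N :: "'v::euclidean_space \<Rightarrow> 'e::euclidean_space" and S :: "'v set" and x0 :: 'v
  assumes L: "legendre_pair F N S"
    and rank: "\<And>z. z \<in> S \<Longrightarrow> rank_le_one (fderiv N z)"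
    and immersed: "\<And>z x. z \<in> S \<Longrightarrow> fderiv F z x = 0 \<Longrightarrow> fderiv N z x = 0 \<Longrightarrow> x = 0"
    and x0: "\<And>z. z \<in> S \<Longrightarrow> fderiv N z x0 \<noteq> 0"
begin

definition e where "e z = fderiv N z x0 /\<^sub>R norm (fderiv N z x0)"
text \<open>The coefficient for which dF + \<rho> dN, applied to \<open>x0\<close>, is orthogonal to
  dN \<open>x0\<close>.\<close>

definition \<rho> where "\<rho> z = - (fderiv F z x0 \<bullet> fderiv N z x0) / (fderiv N z x0 \<bullet> fderiv N z x0)"
definition C where "C z = (1 / sqrt (1 + (\<rho> z)\<^sup>2)) *\<^sub>R (F z + \<rho> z *\<^sub>R N z)"

lemmas L' = legendre_pairD[OF L]

lemma smooth_e: "smooth_on e S" and smooth_rho: "smooth_on \<rho> S"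
  unfolding e_def \<rho>_def
  by (intro smooth_intros smooth_on_frechet_derivative L'; use x0 in force)+

lemma one_plus_rho_pos: "1 + (\<rho> z)\<^sup>2 > 0"
  by (simp add: add_pos_nonneg)

lemma smooth_C: "smooth_on C S"
  unfolding C_def power2_eq_square
  by (intro smooth_intros smooth_rho L')
    (use one_plus_rho_pos in \<open>auto simp: power2_eq_square add_nonneg_eq_0_iff\<close>)

lemma dN_eq:
  assumes "z \<in> S"
  shows "fderiv N z x = (fderiv N z x \<bullet> e z) *\<^sub>R e z"
proof -
  let ?w = "fderiv N z x0"
  have "(?w \<bullet> ?w) *\<^sub>R fderiv N z x = (fderiv N z x \<bullet> ?w) *\<^sub>R ?w"
    using rank[OF assms] unfolding rank_le_one_def by blast
  then have "(1 / (?w \<bullet> ?w)) *\<^sub>R (?w \<bullet> ?w) *\<^sub>R fderiv N z x = (1 / (?w \<bullet> ?w)) *\<^sub>R (fderiv N z x \<bullet> ?w) *\<^sub>R ?w"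
    by simp
  then show ?thesis
    using x0[OF assms]
    by (simp add: e_def power2_norm_eq_inner[symmetric] power2_eq_square field_simps)
qed

lemma e_unit: "z \<in> S \<Longrightarrow> e z \<bullet> e z = 1" and F_e: "z \<in> S \<Longrightarrow> F z \<bullet> e z = 0"
  and N_e: "z \<in> S \<Longrightarrow> N z \<bullet> e z = 0" 
  using x0[of z] L'(10)[of z x0] L'(11)[of z x0]
  by (auto simp: e_def power2_norm_eq_inner[symmetric] power2_eq_square inner_commute)

lemma dN_x0_e: "z \<in> S \<Longrightarrow> fderiv N z x0 \<bullet> e z > 0"
  using x0[of z] by (simp add: e_def power2_norm_eq_inner[symmetric] power2_eq_square)

lemma dN_eq_0_iff: "z \<in> S \<Longrightarrow> fderiv N z x = 0 \<longleftrightarrow> fderiv N z x \<bullet> e z = 0"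
  using dN_eq[of z x] by auto

text \<open>At \<open>x0\<close> this is the choice of \<rho>. Symmetry of the second fundamental
  form exchanges x with \<open>x0\<close>, and the rank condition writes both derivatives of N as
  multiples of e, which carries the identity over to x.\<close>

lemma dF_rho_dN_e:
  assumes z: "z \<in> S"
  shows "fderiv F z x \<bullet> e z + \<rho> z * (fderiv N z x \<bullet> e z) = 0"
proof -
  let ?w = "fderiv N z x0" and ?a = "fderiv N z x \<bullet> e z"
  have w: "?w = norm ?w *\<^sub>R e z" using x0[OF z] by (simp add: e_def)
  have r: "\<rho> z * norm ?w = - (fderiv F z x0 \<bullet> e z)"
    using x0[OF z]
    by (simp add: \<rho>_def e_def power2_norm_eq_inner[symmetric] power2_eq_square field_simps)
  have "norm ?w * (fderiv F z x \<bullet> e z) = fderiv F z x \<bullet> ?w" by (subst (2) w) simp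
  also have "\<dots> = fderiv F z x0 \<bullet> fderiv N z x" by (rule legendre_pair_symmetric[OF L z])
  also have "\<dots> = ?a * (fderiv F z x0 \<bullet> e z)" by (subst dN_eq[OF z]) simp
  also have "\<dots> = - (\<rho> z * norm ?w) * ?a" unfolding r by simp
  finally have "norm ?w * (fderiv F z x \<bullet> e z + \<rho> z * ?a) = 0" by (simp add: algebra_simps)
  then show ?thesis using x0[OF z] by simp
qed

lemma legendre_pair_caustic: "legendre_pair C e S"
  unfolding legendre_pair_def
proof (intro conjI ballI allI L'(1) smooth_C smooth_e e_unit)
  fix z assume z: "z \<in> S"
  note sq = one_plus_rho_pos[of z]
  have "(F z + \<rho> z *\<^sub>R N z) \<bullet> (F z + \<rho> z *\<^sub>R N z) = 1 + (\<rho> z)\<^sup>2"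
    using z L' by (simp add: algebra_simps power2_eq_square)
  moreover have "C z \<bullet> C z = (1 / sqrt (1 + (\<rho> z)\<^sup>2)) * (1 / sqrt (1 + (\<rho> z)\<^sup>2)) *
      ((F z + \<rho> z *\<^sub>R N z) \<bullet> (F z + \<rho> z *\<^sub>R N z))"
    unfolding C_def by (simp only: inner_scaleR_left inner_scaleR_right mult.assoc)
  ultimately show "C z \<bullet> C z = 1" using sq by simp
  show Ce: "C z \<bullet> e z = 0" using z by (simp add: C_def inner_add_left F_e N_e)
  fix x
  \<comment> \<open>Moving the derivative from C to e spares differentiating \<rho> and the
    normalising factor. Moving it back inside the sum leaves exactly the expression that
    \<open>dF_rho_dN_e\<close> annihilates.\<close>
  have "fderiv C z x \<bullet> e z = - (C z \<bullet> fderiv e z x)"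
    by (rule fderiv_inner_constant[OF L'(1) smooth_C smooth_e z, of 0])
      (simp add: C_def inner_add_left F_e N_e)
  also have "C z \<bullet> fderiv e z x = - (1 / sqrt (1 + (\<rho> z)\<^sup>2)) *
      (fderiv F z x \<bullet> e z + \<rho> z * (fderiv N z x \<bullet> e z))"
    using fderiv_inner_constant[OF L'(1,2) smooth_e z F_e, of x]
      fderiv_inner_constant[OF L'(1,3) smooth_e z N_e, of x]
    by (simp add: C_def inner_add_left algebra_simps)
  finally show "fderiv C z x \<bullet> e z = 0" by (simp add: dF_rho_dN_e[OF z])
qed

lemma de_N: "z \<in> S \<Longrightarrow> fderiv e z x \<bullet> N z = - (fderiv N z x \<bullet> e z)"
  using fderiv_inner_constant[OF L'(1) smooth_e L'(3), of z 0 x] N_e by (simp add: inner_commute)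

lemma de_x0: "z \<in> S \<Longrightarrow> fderiv e z x0 \<noteq> 0"
  using de_N[of z x0] dN_x0_e[of z] by auto

lemma de_exchange:
  assumes z: "z \<in> S"
  shows "(fderiv N z x \<bullet> e z) *\<^sub>R fderiv e z y = (fderiv N z y \<bullet> e z) *\<^sub>R fderiv e z x"
proof -
  define \<alpha> where "\<alpha> x y = fderiv N y x \<bullet> e y" for x y
  have sm: "smooth_on (\<alpha> x) S" for x
    unfolding \<alpha>_def by (intro smooth_intros smooth_on_frechet_derivative L' smooth_e)
  have D: "fderiv (\<lambda>u. fderiv N u x) z y = \<alpha> x z *\<^sub>R fderiv e z y + fderiv (\<alpha> x) z y *\<^sub>R e z" for x y
  proof -
    have "fderiv (\<lambda>u. fderiv N u x) z = fderiv (\<lambda>u. \<alpha> x u *\<^sub>R e u) z"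
      by (rule frechet_derivative_cong_open[OF L'(1) z]) (simp add: \<alpha>_def dN_eq[symmetric])
    also have "\<dots> = (\<lambda>y. \<alpha> x z *\<^sub>R fderiv e z y + fderiv (\<alpha> x) z y *\<^sub>R e z)"
      by (rule frechet_derivative_eqI[OF has_derivative_scaleR[OF smooth_on_has_derivative[OF sm z]
              smooth_on_has_derivative[OF smooth_e z]]])
    finally show ?thesis by simp
  qed
  \<comment> \<open>By the symmetry of \<open>D\<close> this difference is a multiple of e, whose
    coefficient collects the derivatives of \<alpha>. It is also orthogonal to the unit vector e,
    because the derivatives of e are; so it vanishes.\<close>
  let ?u = "\<alpha> x z *\<^sub>R fderiv e z y - \<alpha> y z *\<^sub>R fderiv e z x"
  have "?u = (fderiv (\<alpha> y) z x - fderiv (\<alpha> x) z y) *\<^sub>R e z"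
    using symmetric_second_frechet_derivative[OF L'(1) z L'(3), of x y] unfolding D
    by (simp add: algebra_simps)
  moreover have "?u \<bullet> e z = 0"
    using legendre_pairD(10)[OF legendre_pair_caustic z] by (simp add: inner_diff_left)
  ultimately have "?u = 0" using e_unit[OF z] by simp
  then show ?thesis by (simp add: \<alpha>_def)
qed

lemma rank_de:
  assumes z: "z \<in> S"
  shows "rank_le_one (fderiv e z)"
proof -
  have "\<exists>k w. \<forall>y. fderiv e z y = k y *\<^sub>R w"
  proof (intro exI allI)
    fix y
    let ?a = "fderiv N z x0 \<bullet> e z"
    have "fderiv e z y = (1 / ?a) *\<^sub>R (?a *\<^sub>R fderiv e z y)" using dN_x0_e[OF z] by simp
    also have "\<dots> = (1 / ?a) *\<^sub>R ((fderiv N z y \<bullet> e z) *\<^sub>R fderiv e z x0)"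
      by (simp only: de_exchange[OF z, of x0 y])
    finally show "fderiv e z y = ((fderiv N z y \<bullet> e z) / ?a) *\<^sub>R fderiv e z x0" by simp
  qed
  then obtain k w where "\<And>y. fderiv e z y = k y *\<^sub>R w" by blast
  then show ?thesis by (simp add: rank_le_one_def mult_ac)
qed

lemma immersed_caustic:
  assumes z: "z \<in> S" and dC: "fderiv C z x = 0" and de: "fderiv e z x = 0"
  shows "x = 0"
proof -
  have dN: "fderiv N z x = 0"
    using de_N[OF z, of x] de by (simp add: dN_eq_0_iff[OF z])
  define g where "g y = 1 / sqrt (1 + (\<rho> y)\<^sup>2)" for y
  have g: "smooth_on g S"
    unfolding g_def power2_eq_square
    by (intro smooth_intros smooth_rho L')
      (use one_plus_rho_pos in \<open>auto simp: power2_eq_square add_nonneg_eq_0_iff\<close>)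
  have "fderiv C z = fderiv (\<lambda>y. g y *\<^sub>R (F y + \<rho> y *\<^sub>R N y)) z"
    by (simp add: C_def[abs_def] g_def)
  also have "\<dots> = (\<lambda>x. g z *\<^sub>R (fderiv F z x + (\<rho> z *\<^sub>R fderiv N z x + fderiv \<rho> z x *\<^sub>R N z))
      + fderiv g z x *\<^sub>R (F z + \<rho> z *\<^sub>R N z))"
    by (rule frechet_derivative_eqI) (intro has_derivative_add has_derivative_scaleR
        smooth_on_has_derivative[OF g z] smooth_on_has_derivative[OF smooth_rho z]
        smooth_on_has_derivative[OF L'(2) z] smooth_on_has_derivative[OF L'(3) z])
  \<comment> \<open>The vector dF x is orthogonal to F and N, so pairing with it removes the
    derivatives of g and \<rho>; the remaining contribution of N is zero by
    \<open>dN\<close>.\<close>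
  finally have "fderiv F z x \<bullet> fderiv C z x = g z * (fderiv F z x \<bullet> fderiv F z x)"
    using dN L'(8,9)[OF z, of x] by (simp add: inner_add_right)
  moreover have "g z \<noteq> 0" using one_plus_rho_pos[of z] by (simp add: g_def)
  ultimately have "fderiv F z x = 0" using dC by simp
  then show ?thesis using immersed[OF z] dN by blast
qed

text \<open>The image of dF + \<rho> dN avoids the three orthogonal directions F, N and e, so too
  little room is left for injectivity. A kernel vector on which dN vanished would also be killed by
  dF, against \<open>immersed\<close>.\<close>

lemma caustic_direction:
  assumes z: "z \<in> S" and dim: "DIM('e) < DIM('v) + 3"
  obtains x where "fderiv N z x \<noteq> 0" "fderiv F z x = - \<rho> z *\<^sub>R fderiv N z x"
proof -
  have lin: "linear (\<lambda>x. fderiv F z x + \<rho> z *\<^sub>R fderiv N z x)"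
    by (intro linear_compose_add linear_compose_scale_right smooth_on_linear_derivative[OF _ z] L')
  have ne: "F z \<noteq> 0" "N z \<noteq> 0" "e z \<noteq> 0" using L'(4,5)[OF z] e_unit[OF z] by auto
  have dist: "F z \<noteq> N z" "F z \<noteq> e z" "N z \<noteq> e z"
    using L'(4-6)[OF z] F_e[OF z] N_e[OF z] by auto
  obtain x where x: "x \<noteq> 0" "fderiv F z x + \<rho> z *\<^sub>R fderiv N z x = 0"
  proof (rule kernel_of_orthogonal_range[OF lin, of "{F z, N z, e z}"])
    show "pairwise orthogonal {F z, N z, e z}"
      using L'(6,7)[OF z] F_e[OF z] N_e[OF z]
      by (auto simp: pairwise_def orthogonal_def inner_commute)
    show "DIM('e) < DIM('v) + card {F z, N z, e z}" using dist dim by simp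
    show "(fderiv F z x + \<rho> z *\<^sub>R fderiv N z x) \<bullet> s = 0" if "s \<in> {F z, N z, e z}" for x s
      using that L'(8-11)[OF z] dF_rho_dN_e[OF z] by (auto simp: inner_add_left)
  qed (use ne in auto)
  have eq: "fderiv F z x = - \<rho> z *\<^sub>R fderiv N z x" using x(2) by (simp add: eq_neg_iff_add_eq_0)
  moreover have "fderiv N z x \<noteq> 0" using immersed[OF z, of x] x(1) eq by auto
  ultimately show thesis using that by blast
qed

lemma caustic_radius_unique:
  assumes z: "z \<in> S" and x: "fderiv N z x \<noteq> 0" "fderiv F z x = - r *\<^sub>R fderiv N z x"
  shows "r = \<rho> z"
  using dF_rho_dN_e[OF z, of x] x dN_eq_0_iff[OF z, of x] by (simp add: algebra_simps)

end

section \<open>Fronts in charts\<close>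

lemma frontalD:
  assumes "frontal M f E"
  shows "smooth_manifold M" "smooth_fun_on M (points M) f" "p \<in> points M \<Longrightarrow> f p \<bullet> f p = 1"
    and "p \<in> points M \<Longrightarrow> \<exists>U \<nu>. p \<in> U \<and> local_unit_normal M f E U \<nu>"
  using assms by (auto simp: frontal_def norm_eq_1[symmetric])

lemma local_unit_normalD:
  assumes "local_unit_normal M f E U \<nu>"
  shows "openin (mtop M) U" "smooth_fun_on M U \<nu>"
    and "p \<in> U \<Longrightarrow> \<nu> p \<bullet> \<nu> p = 1" "p \<in> U \<Longrightarrow> f p \<bullet> \<nu> p = 0"
    and "p \<in> U \<Longrightarrow> v \<in> tangent_space M p \<Longrightarrow> differential M f p v \<bullet> \<nu> p = 0"
    and "p \<in> U \<Longrightarrow> E p = {w. w \<bullet> f p = 0 \<and> w \<bullet> \<nu> p = 0}"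
    and "p \<in> U \<Longrightarrow> p \<in> points M"
  using assms openin_subset[of "mtop M" U] by (auto simp: local_unit_normal_def norm_eq_1[symmetric])

lemma openin_points: "smooth_manifold M \<Longrightarrow> openin (mtop M) (points M)"
  by simp

lemma legendre_pair_chart:
  assumes f: "frontal M f E" and U: "local_unit_normal M f E U \<nu>" and c: "c \<in> atlas M"
  shows "legendre_pair (f \<circ> chart_inv c) (\<nu> \<circ> chart_inv c) (snd c ` (fst c \<inter> U))"
proof -
  note M = frontalD(1)[OF f] and U' = local_unit_normalD[OF U]
  have "U \<subseteq> points M" using U'(7) by blast
  then have sf: "smooth_fun_on M U f" using smooth_fun_on_mono[OF frontalD(2)[OF f]] by blast
  have "fderiv (f \<circ> chart_inv c) (snd c q) x \<bullet> \<nu> q = 0" if q: "q \<in> fst c" "q \<in> U" for q x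
  proof -
    have cq: "c \<in> charts_at M q" using c q by simp
    have "differential M f q (coord_tangent M q c x) = fderiv (f \<circ> chart_inv c) (snd c q) x"
      using differential_eq[OF M cq U'(1) q(2) sf coord_tangent_in_tangent_space[OF M cq]]
      by (simp only: coord_tangent_same[OF M cq])
    then show ?thesis using U'(5)[OF q(2) coord_tangent_in_tangent_space[OF M cq, of x]] by simp
  qed
  then show ?thesis
    unfolding legendre_pair_def
    using open_chart_image[OF M c U'(1)] smooth_fun_onD[OF sf c] smooth_fun_onD[OF U'(2) c]
      M c frontalD(3)[OF f] U'(3,4,7) by auto
qed

lemma legendre_pair_subset:
  "legendre_pair F N S \<Longrightarrow> open T \<Longrightarrow> T \<subseteq> S \<Longrightarrow> legendre_pair F N T"
  unfolding legendre_pair_def by (meson smooth_on_mono subset_iff)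

lemma legendre_pair_cong:
  assumes L: "legendre_pair F N S" and eq: "\<And>y. y \<in> S \<Longrightarrow> F y = F' y" "\<And>y. y \<in> S \<Longrightarrow> N y = N' y"
  shows "legendre_pair F' N' S"
proof -
  note L' = legendre_pairD[OF L]
  have "fderiv F' z = fderiv F z" if "z \<in> S" for z
    by (rule frechet_derivative_cong_open[OF L'(1) that]) (simp add: eq)
  then show ?thesis
    unfolding legendre_pair_def
    using L' eq smooth_on_cong[OF L'(1,2), of F'] smooth_on_cong[OF L'(1,3), of N'] by simp
qed

lemma differential_chart_ball:
  assumes M: "smooth_manifold M" and c: "c \<in> charts_at M p" and W: "openin (mtop M) W" "p \<in> W"
    and f: "smooth_fun_on M W f" and g: "smooth_fun_on M W g"
  shows "(\<forall>v\<in>tangent_space M p. P (differential M f p v) (differential M g p v)) \<longleftrightarrow>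
    (\<forall>x. P (fderiv (f \<circ> chart_inv c) (snd c p) x) (fderiv (g \<circ> chart_inv c) (snd c p) x))"
proof -
  have "(\<forall>v\<in>tangent_space M p. P (differential M f p v) (differential M g p v)) \<longleftrightarrow>
    (\<forall>v\<in>tangent_space M p. P (fderiv (f \<circ> chart_inv c) (snd c p) (v c)) (fderiv (g \<circ> chart_inv c) (snd c p) (v c)))"
    using differential_eq[OF M c W f] differential_eq[OF M c W g] by simp
  also have "\<dots> \<longleftrightarrow> (\<forall>x. P (fderiv (f \<circ> chart_inv c) (snd c p) x) (fderiv (g \<circ> chart_inv c) (snd c p) x))"
    by (rule ball_tangent_space[OF M c])
  finally show ?thesis .
qed

lemma local_unit_normal_chartI:
  assumes M: "smooth_manifold M" and c: "c \<in> atlas M" and U: "openin (mtop M) U" "U \<subseteq> fst c"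
    and L: "legendre_pair (f \<circ> chart_inv c) (\<nu> \<circ> chart_inv c) (snd c ` U)"
    and E: "\<And>q. q \<in> U \<Longrightarrow> E q = {w. w \<bullet> f q = 0 \<and> w \<bullet> \<nu> q = 0}"
  shows "local_unit_normal M f E U \<nu>" "smooth_fun_on M U f" "\<And>q. q \<in> U \<Longrightarrow> norm (f q) = 1"
proof -
  note L' = legendre_pairD[OF L]
  have ci: "chart_inv c (snd c q) = q" if "q \<in> U" for q using that U M c by auto
  show sf: "smooth_fun_on M U f" by (rule smooth_fun_on_chartI[OF M c U L'(2)])
  have sn: "smooth_fun_on M U \<nu>" by (rule smooth_fun_on_chartI[OF M c U L'(3)])
  show "norm (f q) = 1" if "q \<in> U" for q using L'(4)[of "snd c q"] that ci by (simp add: norm_eq_1)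
  have df: "\<forall>v\<in>tangent_space M q. differential M f q v \<bullet> \<nu> q = 0" if q: "q \<in> U" for q
  proof -
    have cq: "c \<in> charts_at M q" using c U q by auto
    show ?thesis
      using differential_chart_ball[OF M cq U(1) q sf sf, of "\<lambda>a b. a \<bullet> \<nu> q = 0"]
        L'(8)[of "snd c q"] q ci by simp
  qed
  have "\<nu> q \<in> sphere 0 1" "f q \<bullet> \<nu> q = 0" if "q \<in> U" for q
    using L'(5,6)[of "snd c q"] that ci by (auto simp: norm_eq_1)
  then show "local_unit_normal M f E U \<nu>"
    unfolding local_unit_normal_def using U(1) sn E df by blast
qed

text \<open>The bundle fixes the normal line, also at singular points, so only a sign is free. This
  sign is continuous, hence constant near p, and therefore the differentials at p are related by it
  as well.\<close>

lemma two_local_unit_normals: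
  assumes f: "frontal M f E" and U: "local_unit_normal M f E U \<nu>" and V: "local_unit_normal M f E V \<nu>'"
    and p: "p \<in> U" "p \<in> V"
  obtains s :: real where "s = 1 \<or> s = -1" "\<nu>' p = s *\<^sub>R \<nu> p"
    "\<And>v. v \<in> tangent_space M p \<Longrightarrow> differential M \<nu>' p v = s *\<^sub>R differential M \<nu> p v"
proof -
  note M = frontalD(1)[OF f] and U' = local_unit_normalD[OF U] and V' = local_unit_normalD[OF V]
  have sgn: "(\<nu>' q \<bullet> \<nu> q)\<^sup>2 = 1 \<and> \<nu>' q = (\<nu>' q \<bullet> \<nu> q) *\<^sub>R \<nu> q" if q: "q \<in> U" "q \<in> V" for q
  proof -
    \<comment> \<open>This part of \<nu>' lies in the fibre because it is orthogonal to f and \<nu>;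
      as \<nu>' defines the same fibre, it is orthogonal to \<nu>' too, which forces equality in the
      Cauchy-Schwarz inequality.\<close>
    define w where "w = \<nu>' q - (\<nu>' q \<bullet> \<nu> q) *\<^sub>R \<nu> q"
    have "w \<in> E q"
      unfolding U'(6)[OF q(1)] using U'(3,4)[OF q(1)] V'(4)[OF q(2)]
      by (simp add: w_def inner_diff_left inner_diff_right inner_commute)
    then have "w \<bullet> \<nu>' q = 0" using V'(6)[OF q(2)] by simp
    then have 1: "(\<nu>' q \<bullet> \<nu> q)\<^sup>2 = 1"
      using V'(3)[OF q(2)] by (simp add: w_def inner_diff_left inner_diff_right inner_commute power2_eq_square)
    have "w \<bullet> w = 1 - (\<nu>' q \<bullet> \<nu> q)\<^sup>2"
      using U'(3)[OF q(1)] V'(3)[OF q(2)]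
      by (simp add: w_def inner_diff_left inner_diff_right inner_commute power2_eq_square)
    then have "w = 0" using 1 by simp
    then show ?thesis using 1 by (simp add: w_def)
  qed
  define s where "s = \<nu>' p \<bullet> \<nu> p"
  have s: "s = 1 \<or> s = -1" using sgn[OF p] by (simp add: s_def power2_eq_1_iff)
  define W where "W = {q \<in> U \<inter> V. \<nu>' q \<bullet> \<nu> q \<in> {t. t * s > 0}}"
  have UV: "openin (mtop M) (U \<inter> V)" using U'(1) V'(1) by blast
  have smUV: "smooth_fun_on M (U \<inter> V) \<nu>" "smooth_fun_on M (U \<inter> V) \<nu>'"
    using smooth_fun_on_mono[OF U'(2)] smooth_fun_on_mono[OF V'(2)] by auto
  have "openin (mtop M) W"
    unfolding W_def
  proof (rule smooth_fun_on_continuous_map[OF M UV smooth_fun_on_inner[OF M UV smUV(2,1)]])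
    show "open {t. 0 < t * s}" by (intro open_Collect_less continuous_intros)
  qed
  moreover have pW: "p \<in> W" using p s by (auto simp: W_def simp flip: s_def)
  moreover have Ws: "\<nu>' q = s *\<^sub>R \<nu> q" if "q \<in> W" for q
  proof -
    have q: "q \<in> U" "q \<in> V" "\<nu>' q \<bullet> \<nu> q * s > 0" using that by (auto simp: W_def)
    have "\<nu>' q \<bullet> \<nu> q = 1 \<or> \<nu>' q \<bullet> \<nu> q = -1" using sgn[OF q(1,2)] by (simp add: power2_eq_1_iff)
    then have "\<nu>' q \<bullet> \<nu> q = s" using s q(3) by auto
    then show ?thesis using sgn[OF q(1,2)] by simp
  qed
  ultimately have "differential M \<nu>' p = differential M (\<lambda>q. s *\<^sub>R \<nu> q) p"
    by (intro differential_cong[OF M]) auto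
  moreover have "differential M (\<lambda>q. s *\<^sub>R \<nu> q) p v = s *\<^sub>R differential M \<nu> p v"
    if "v \<in> tangent_space M p" for v
    using s differential_minus[OF M U'(1) p(1) U'(2) that] by auto
  ultimately show thesis using that[of s] s Ws[OF pW] by simp
qed

text \<open>\<open>front\<close> quantifies over all local unit normals. One normal and one chart
  per point are enough, since any other normal has the same differential up to sign.\<close>

lemma frontI:
  assumes f: "frontal M f E"
    and imm: "\<And>p. p \<in> points M \<Longrightarrow> \<exists>U \<nu> c. p \<in> U \<and> local_unit_normal M f E U \<nu> \<and> c \<in> charts_at M p \<and>
      (\<forall>x. fderiv (f \<circ> chart_inv c) (snd c p) x = 0 \<longrightarrow> fderiv (\<nu> \<circ> chart_inv c) (snd c p) x = 0 \<longrightarrow> x = 0)"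
  shows "front M f E"
  unfolding front_def
proof (intro conjI allI impI ballI notI f)
  fix V \<nu>' p
  assume V: "local_unit_normal M f E V \<nu>'" and p: "p \<in> V"
    and "\<exists>v\<in>tangent_space M p. v \<noteq> (\<lambda>_. 0) \<and> differential M f p v = 0 \<and> differential M \<nu>' p v = 0"
  then obtain v where v: "v \<in> tangent_space M p" "v \<noteq> (\<lambda>_. 0)" "differential M f p v = 0"
    "differential M \<nu>' p v = 0" by blast
  note M = frontalD(1)[OF f]
  have pM: "p \<in> points M" by (rule local_unit_normalD(7)[OF V p])
  obtain U \<nu> c where U: "p \<in> U" "local_unit_normal M f E U \<nu>" and c: "c \<in> charts_at M p"
    and x: "\<And>x. fderiv (f \<circ> chart_inv c) (snd c p) x = 0 \<Longrightarrow> fderiv (\<nu> \<circ> chart_inv c) (snd c p) x = 0 \<Longrightarrow> x = 0"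
    using imm[OF pM] by blast
  note U' = local_unit_normalD[OF U(2)]
  obtain s :: real where s: "s = 1 \<or> s = -1"
    "\<And>v. v \<in> tangent_space M p \<Longrightarrow> differential M \<nu>' p v = s *\<^sub>R differential M \<nu> p v"
    by (rule two_local_unit_normals[OF f U(2) V U(1) p]) blast
  have "differential M \<nu> p v = 0" using s(2)[OF v(1)] s(1) v(4) by auto
  then have "v c = 0"
    using x[of "v c"] differential_eq[OF M c U'(1) U(1) U'(2) v(1)]
      differential_eq[OF M c openin_points[OF M] pM frontalD(2)[OF f] v(1)] v(3) by simp
  then show False using tangent_zero_iff[OF M c v(1)] v(2) by blast
qed

lemma front_immersed:
  assumes f: "front M f E" and U: "local_unit_normal M f E U \<nu>" and p: "p \<in> U" and c: "c \<in> charts_at M p"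
    and x: "fderiv (f \<circ> chart_inv c) (snd c p) x = 0" "fderiv (\<nu> \<circ> chart_inv c) (snd c p) x = 0"
  shows "x = 0"
proof -
  have fr: "frontal M f E" using f by (simp add: front_def)
  note M = frontalD(1)[OF fr] and U' = local_unit_normalD[OF U]
  let ?v = "coord_tangent M p c x"
  have v: "?v \<in> tangent_space M p" by (rule coord_tangent_in_tangent_space[OF M c])
  have vc: "?v c = x" by (rule coord_tangent_same[OF M c])
  have "differential M f p ?v = 0"
    using differential_eq[OF M c openin_points[OF M] U'(7)[OF p] frontalD(2)[OF fr] v] vc x(1) by simp
  moreover have "differential M \<nu> p ?v = 0"
    using differential_eq[OF M c U'(1) p U'(2) v] vc x(2) by simp
  ultimately have "?v = (\<lambda>_. 0)" using f U p v unfolding front_def by blast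
  then show ?thesis using vc by (metis)
qed

section \<open>Constant curvature one and the rank of the differential of the normal\<close>

lemma orth_proj_eq:
  assumes "a \<bullet> a = 1" "b \<bullet> b = 1" "a \<bullet> b = 0"
  shows "orth_proj {w. w \<bullet> a = 0 \<and> w \<bullet> b = 0} w = proj_away a b w"
  unfolding orth_proj_def
proof (rule the_equality)
  let ?S = "{w. w \<bullet> a = 0 \<and> w \<bullet> b = 0}"
  have P: "proj_away a b w \<in> ?S"
    using assms by (simp add: proj_away_def inner_diff_left inner_diff_right inner_commute)
  have O: "\<forall>z\<in>?S. orthogonal (w - proj_away a b w) z"
    by (auto simp: proj_away_def orthogonal_def inner_add_left inner_add_right inner_commute)
  then show "proj_away a b w \<in> ?S \<and> (\<forall>z\<in>?S. orthogonal (w - proj_away a b w) z)" using P by blast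
  fix y assume y: "y \<in> ?S \<and> (\<forall>z\<in>?S. orthogonal (w - y) z)"
  let ?d = "y - proj_away a b w"
  have "?d \<in> ?S" using y P by (simp add: inner_diff_left)
  then have "(w - y) \<bullet> ?d = 0" "(w - proj_away a b w) \<bullet> ?d = 0"
    using y O unfolding orthogonal_def by blast+
  then have "?d \<bullet> ?d = 0" by (simp add: inner_diff_left)
  then show "y = proj_away a b w" by simp
qed

text \<open>The fibres are orthogonal to f, so the projection onto the tangent space of the sphere
  is absorbed by the projection onto the fibre.\<close>

lemma conn_eq:
  assumes f: "frontal M f E" and U: "local_unit_normal M f E U \<nu>" and q: "q \<in> U"
  shows "conn M f E X \<xi> q = proj_away (f q) (\<nu> q) (differential M \<xi> q (X q))"
proof -
  note U' = local_unit_normalD[OF U]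
  note facts = frontalD(3)[OF f U'(7)[OF q]] U'(3,4)[OF q]
  show ?thesis
    unfolding conn_def sphere_conn_def U'(6)[OF q] orth_proj_eq[OF facts]
    using facts by (simp add: proj_away_def inner_diff_left)
qed

lemma conn_curvature_eq:
  assumes f: "frontal M f E" and U: "local_unit_normal M f E U \<nu>" and p: "p \<in> U"
    and X: "vector_field M X" and Y: "vector_field M Y" and xi: "section_of M E \<xi>"
  shows "conn_curvature M f E X Y \<xi> p =
      (differential M f p (Y p) \<bullet> \<xi> p) *\<^sub>R differential M f p (X p)
    - (differential M f p (X p) \<bullet> \<xi> p) *\<^sub>R differential M f p (Y p)
    + (differential M \<nu> p (Y p) \<bullet> \<xi> p) *\<^sub>R differential M \<nu> p (X p)
    - (differential M \<nu> p (X p) \<bullet> \<xi> p) *\<^sub>R differential M \<nu> p (Y p)"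
proof -
  note M = frontalD(1)[OF f] and U' = local_unit_normalD[OF U]
  define c where "c = (SOME c. c \<in> charts_at M p)"
  have cp: "c \<in> charts_at M p" unfolding c_def by (rule some_chart[OF M U'(7)[OF p]])
  then have c: "c \<in> atlas M" "p \<in> fst c" by auto
  let ?i = "chart_inv c"
  define S where "S = snd c ` (fst c \<inter> U)"
  define z where "z = snd c p"
  have L: "legendre_pair (f \<circ> ?i) (\<nu> \<circ> ?i) S" unfolding S_def by (rule legendre_pair_chart[OF f U c(1)])
  have zS: "z \<in> S" and iz: "?i z = p" using c p M by (auto simp: S_def z_def)
  have diff_p: "differential M g p v = fderiv (g \<circ> ?i) z (v c)" for g v
    unfolding differential_def Let_def c_def[symmetric] z_def by (rule refl)
  have iS: "?i y \<in> U" "?i y \<in> fst c" "snd c (?i y) = y" "c \<in> charts_at M (?i y)" if "y \<in> S" for y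
    using that c M by (auto simp: S_def)
  define Xc where "Xc y = X (?i y) c" for y
  define Yc where "Yc y = Y (?i y) c" for y
  have sub: "S \<subseteq> snd c ` fst c" by (auto simp: S_def)
  have sm: "smooth_on Xc S" "smooth_on Yc S"
    using X Y c(1) smooth_on_mono[OF _ sub] unfolding vector_field_def Xc_def Yc_def by blast+
  have xi': "smooth_fun_on M (points M) \<xi>" "\<And>q. q \<in> points M \<Longrightarrow> \<xi> q \<in> E q"
    using xi by (auto simp: section_of_def)
  have smxi: "smooth_on (\<xi> \<circ> ?i) S"
    unfolding S_def
    by (rule smooth_fun_onD[OF smooth_fun_on_mono[OF xi'(1) openin_subset[OF U'(1)]] c(1)])
  have E: "(\<xi> \<circ> ?i) y \<bullet> (f \<circ> ?i) y = 0" "(\<xi> \<circ> ?i) y \<bullet> (\<nu> \<circ> ?i) y = 0" if "y \<in> S" for y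
    using xi'(2)[OF U'(7)[OF iS(1)[OF that]]] U'(6)[OF iS(1)[OF that]] by auto
  let ?P = "\<lambda>y. proj_away ((f \<circ> ?i) y) ((\<nu> \<circ> ?i) y)"
  have conn_y: "(conn M f E W \<xi> \<circ> ?i) y = ?P y (fderiv (\<xi> \<circ> ?i) y (W (?i y) c))"
    if y: "y \<in> S" and W: "vector_field M W" for y W
  proof -
    have pM: "?i y \<in> points M" by (rule U'(7)[OF iS(1)[OF y]])
    have WT: "W (?i y) \<in> tangent_space M (?i y)" using W pM by (simp add: vector_field_def)
    have "differential M \<xi> (?i y) (W (?i y)) = fderiv (\<xi> \<circ> ?i) y (W (?i y) c)"
      using differential_eq[OF M iS(4)[OF y] openin_points[OF M] pM xi'(1) WT] iS(3)[OF y] by simp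
    then show ?thesis using conn_eq[OF f U iS(1)[OF y], of W \<xi>] by simp
  qed
  have conn_p: "conn M f E W g p = ?P z (fderiv (g \<circ> ?i) z (W p c))" for W g
    using conn_eq[OF f U p, of W g] unfolding diff_p by (simp add: iz)
  have dconn: "fderiv (conn M f E W \<xi> \<circ> ?i) z = fderiv (\<lambda>y. ?P y (fderiv (\<xi> \<circ> ?i) y (W (?i y) c))) z"
    if W: "vector_field M W" for W
    by (rule frechet_derivative_cong_open[OF legendre_pairD(1)[OF L] zS]) (rule conn_y[OF _ W])
  have br: "lie_bracket M X Y p c = fderiv Yc z (Xc z) - fderiv Xc z (Yc z)"
    using cp unfolding lie_bracket_def Xc_def Yc_def z_def[symmetric] iz by (simp only: if_True)
  show ?thesis
    unfolding conn_curvature_def conn_p dconn[OF X] dconn[OF Y] br diff_p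
    using legendre_pair_gauss[OF L zS sm smxi E] by (simp add: Xc_def Yc_def iz comp_def)
qed

lemma exists_section:
  assumes f: "frontal M f E" and p: "p \<in> points M" and w: "w \<in> E p"
  obtains \<xi> where "section_of M E \<xi>" "\<xi> p = w"
proof -
  note M = frontalD(1)[OF f]
  obtain U \<nu> where U: "p \<in> U" "local_unit_normal M f E U \<nu>" using frontalD(4)[OF f p] by blast
  note U' = local_unit_normalD[OF U(2)]
  \<comment> \<open>The constant vector w, projected into the nearby fibres; at p the projection
    does not change it.\<close>
  let ?g = "\<lambda>q. proj_away (f q) (\<nu> q) w"
  have sf: "smooth_fun_on M U f" by (rule smooth_fun_on_mono[OF frontalD(2)[OF f] openin_subset[OF U'(1)]])
  have "smooth_fun_on M U ?g"
    unfolding proj_away_def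
    by (intro smooth_fun_on_diff smooth_fun_on_scaleR smooth_fun_on_inner smooth_fun_on_const M U'(1,2) sf)
  then obtain b :: "_ \<Rightarrow> real" where b:
    "smooth_fun_on M (points M) (\<lambda>q. if q \<in> U then b q *\<^sub>R ?g q else 0)" "b p = 1"
    using extend_smooth_fun[OF M U'(1) U(1)] by blast
  let ?x = "\<lambda>q. if q \<in> U then b q *\<^sub>R ?g q else 0"
  have "?x q \<in> E q" if q: "q \<in> points M" for q
  proof (cases "q \<in> U")
    case True
    then show ?thesis
      using U'(3,4,6)[of q] frontalD(3)[OF f q]
      by (simp add: proj_away_def inner_diff_left inner_diff_right inner_commute)
  next
    case False
    obtain V \<nu>' where "q \<in> V" "local_unit_normal M f E V \<nu>'" using frontalD(4)[OF f q] by blast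
    then show ?thesis using False local_unit_normalD(6) by fastforce
  qed
  moreover have "?x p = w" using U b(2) w U'(6)[OF U(1)] by (simp add: proj_away_ident)
  ultimately show thesis using b(1) that[of ?x] by (simp add: section_of_def)
qed

text \<open>Comparing the hypothesis with the Gauss equation leaves the vanishing of the two terms
  in the differential of \<nu>. With X, Y extending y, x and with the section extending the
  derivative of \<nu> along x, these are the two sides of \<open>rank_le_one\<close>.\<close>

lemma constant_curvature_one_rank:
  assumes f: "frontal M f E" and cc: "constant_curvature_one M f E"
    and U: "local_unit_normal M f E U \<nu>" and p: "p \<in> U" and c: "c \<in> charts_at M p"
  shows "rank_le_one (fderiv (\<nu> \<circ> chart_inv c) (snd c p))"
  unfolding rank_le_one_def
proof (intro allI)
  fix x y
  note M = frontalD(1)[OF f] and U' = local_unit_normalD[OF U]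
  have pM: "p \<in> points M" by (rule U'(7)[OF p])
  have d: "differential M \<nu> p (coord_tangent M p c x) = fderiv (\<nu> \<circ> chart_inv c) (snd c p) x" for x
    using differential_eq[OF M c U'(1) p U'(2) coord_tangent_in_tangent_space[OF M c]]
    by (simp only: coord_tangent_same[OF M c])
  obtain X where X: "vector_field M X" "X p = coord_tangent M p c y"
    by (rule exists_vector_field[OF M pM coord_tangent_in_tangent_space[OF M c]])
  obtain Y where Y: "vector_field M Y" "Y p = coord_tangent M p c x"
    by (rule exists_vector_field[OF M pM coord_tangent_in_tangent_space[OF M c]])
  have "snd c p \<in> snd c ` (fst c \<inter> U)" using c p by auto
  then have "fderiv (\<nu> \<circ> chart_inv c) (snd c p) x \<in> E p"
    using legendre_pairD(10,11)[OF legendre_pair_chart[OF f U], of c "snd c p" x] c p M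
    unfolding U'(6)[OF p] by simp
  then obtain \<xi> where xi: "section_of M E \<xi>" "\<xi> p = fderiv (\<nu> \<circ> chart_inv c) (snd c p) x"
    by (rule exists_section[OF f pM])
  have "conn_curvature M f E X Y \<xi> p =
      (differential M f p (Y p) \<bullet> \<xi> p) *\<^sub>R differential M f p (X p)
    - (differential M f p (X p) \<bullet> \<xi> p) *\<^sub>R differential M f p (Y p)"
    using cc X(1) Y(1) xi(1) pM unfolding constant_curvature_one_def by blast
  then show "(fderiv (\<nu> \<circ> chart_inv c) (snd c p) x \<bullet> fderiv (\<nu> \<circ> chart_inv c) (snd c p) x) *\<^sub>R
      fderiv (\<nu> \<circ> chart_inv c) (snd c p) y =
      (fderiv (\<nu> \<circ> chart_inv c) (snd c p) y \<bullet> fderiv (\<nu> \<circ> chart_inv c) (snd c p) x) *\<^sub>R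
      fderiv (\<nu> \<circ> chart_inv c) (snd c p) x"
    using conn_curvature_eq[OF f U p X(1) Y(1) xi(1)] by (simp add: X(2) Y(2) xi(2) d)
qed

lemma constant_curvature_oneI:
  assumes f: "frontal M f E"
    and rank: "\<And>p. p \<in> points M \<Longrightarrow> \<exists>U \<nu> c. p \<in> U \<and> local_unit_normal M f E U \<nu> \<and> c \<in> charts_at M p \<and>
      rank_le_one (fderiv (\<nu> \<circ> chart_inv c) (snd c p))"
  shows "constant_curvature_one M f E"
  unfolding constant_curvature_one_def
proof (intro allI impI ballI, elim conjE)
  fix X Y \<xi> p
  assume X: "vector_field M X" and Y: "vector_field M Y" and xi: "section_of M E \<xi>" and pM: "p \<in> points M"
  note M = frontalD(1)[OF f]
  obtain U \<nu> c where U: "p \<in> U" "local_unit_normal M f E U \<nu>" and c: "c \<in> charts_at M p"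
    and r: "rank_le_one (fderiv (\<nu> \<circ> chart_inv c) (snd c p))"
    using rank[OF pM] by blast
  note U' = local_unit_normalD[OF U(2)]
  have "differential M \<nu> p (W p) = fderiv (\<nu> \<circ> chart_inv c) (snd c p) (W p c)" if "vector_field M W" for W
    using differential_eq[OF M c U'(1) U(1) U'(2)] that pM by (simp add: vector_field_def)
  then have "(differential M \<nu> p (Y p) \<bullet> \<xi> p) *\<^sub>R differential M \<nu> p (X p)
    = (differential M \<nu> p (X p) \<bullet> \<xi> p) *\<^sub>R differential M \<nu> p (Y p)"
    using rank_le_oneD[OF r] X Y by simp
  then show "conn_curvature M f E X Y \<xi> p =
      (differential M f p (Y p) \<bullet> \<xi> p) *\<^sub>R differential M f p (X p)
    - (differential M f p (X p) \<bullet> \<xi> p) *\<^sub>R differential M f p (Y p)"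
    unfolding conn_curvature_eq[OF f U(2,1) X Y xi] by simp
qed

section \<open>Umbilics and the caustic\<close>

lemma cc1_frontD:
  assumes "cc1_front M f E"
  shows "front M f E" "frontal M f E" "constant_curvature_one M f E" "smooth_manifold M"
  using assms frontalD(1) by (auto simp: cc1_front_def front_def)

text \<open>The rank condition gives a nonzero x that the differential of \<nu> kills, and the front
  condition says that df does not kill it. Evaluating the umbilic relation on x yields d1 = 0, and
  then the coefficient of the differential of \<nu> is not zero.\<close>

lemma umbilics_iff:
  fixes M :: "('a, 'v::euclidean_space) manifold"
  assumes cc: "cc1_front M f E" and n: "2 \<le> DIM('v)"
    and U: "local_unit_normal M f E U \<nu>" and p: "p \<in> U" and c: "c \<in> charts_at M p"
  shows "p \<in> umbilics M f E \<longleftrightarrow> (\<forall>x. fderiv (\<nu> \<circ> chart_inv c) (snd c p) x = 0)"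
proof
  note fr = cc1_frontD(2)[OF cc] and M = cc1_frontD(4)[OF cc] and U' = local_unit_normalD[OF U]
  have pM: "p \<in> points M" by (rule U'(7)[OF p])
  have sf: "smooth_fun_on M U f" by (rule smooth_fun_on_mono[OF frontalD(2)[OF fr] openin_subset[OF U'(1)]])
  {
    assume "\<forall>x. fderiv (\<nu> \<circ> chart_inv c) (snd c p) x = 0"
    then have "\<forall>v\<in>tangent_space M p. differential M \<nu> p v = 0"
      using differential_chart_ball[OF M c U'(1) p U'(2,2), of "\<lambda>a b. a = 0"] by simp
    then have "\<forall>v\<in>tangent_space M p. (0::real) *\<^sub>R differential M f p v = (1::real) *\<^sub>R differential M \<nu> p v"
      by simp
    moreover have "((0::real), (1::real)) \<noteq> (0, 0)" by simp
    ultimately show "p \<in> umbilics M f E" using U p pM unfolding umbilics_def by blast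
  }
  assume "p \<in> umbilics M f E"
  then obtain V \<nu>' and d1 d2 :: real where V: "p \<in> V" "local_unit_normal M f E V \<nu>'"
    and d: "(d1, d2) \<noteq> (0, 0)" "\<forall>v\<in>tangent_space M p. d1 *\<^sub>R differential M f p v = d2 *\<^sub>R differential M \<nu>' p v"
    unfolding umbilics_def by blast
  obtain s :: real where s: "s = 1 \<or> s = -1"
    "\<And>v. v \<in> tangent_space M p \<Longrightarrow> differential M \<nu>' p v = s *\<^sub>R differential M \<nu> p v"
    by (rule two_local_unit_normals[OF fr U V(2) p V(1)]) blast
  have "\<forall>v\<in>tangent_space M p. d1 *\<^sub>R differential M f p v = (d2 * s) *\<^sub>R differential M \<nu> p v"
    using d(2) s(2) by simp
  then have eq: "d1 *\<^sub>R fderiv (f \<circ> chart_inv c) (snd c p) x = (d2 * s) *\<^sub>R fderiv (\<nu> \<circ> chart_inv c) (snd c p) x" for x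
    using differential_chart_ball[OF M c U'(1) p sf U'(2), of "\<lambda>a b. d1 *\<^sub>R a = (d2 * s) *\<^sub>R b"] by simp
  note r = constant_curvature_one_rank[OF fr cc1_frontD(3)[OF cc] U p c]
  have "linear (fderiv (\<nu> \<circ> chart_inv c) (snd c p))"
    by (rule smooth_on_linear_derivative[OF smooth_fun_onD[OF U'(2)]]) (use c p in auto)
  then obtain x where x: "x \<noteq> 0" "fderiv (\<nu> \<circ> chart_inv c) (snd c p) x = 0"
    using rank_le_one_kernel[OF r _ n] by blast
  have "fderiv (f \<circ> chart_inv c) (snd c p) x \<noteq> 0"
    using front_immersed[OF cc1_frontD(1)[OF cc] U p c _ x(2)] x(1) by blast
  then have "d1 = 0" using eq[of x] x(2) by simp
  then have "d2 * s \<noteq> 0" using d(1) s(1) by auto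
  then show "\<forall>x. fderiv (\<nu> \<circ> chart_inv c) (snd c p) x = 0" using eq \<open>d1 = 0\<close> by simp
qed

lemma caustic_chart_of_front:
  assumes cc: "cc1_front M f E" and U: "local_unit_normal M f E U \<nu>" and c: "c \<in> atlas M"
  shows "caustic_chart (f \<circ> chart_inv c) (\<nu> \<circ> chart_inv c)
    {z \<in> snd c ` (fst c \<inter> U). fderiv (\<nu> \<circ> chart_inv c) z x0 \<noteq> 0} x0" (is "caustic_chart ?F ?N ?T x0")
proof
  note fr = cc1_frontD(2)[OF cc] and M = cc1_frontD(4)[OF cc] and U' = local_unit_normalD[OF U]
  have L: "legendre_pair ?F ?N (snd c ` (fst c \<inter> U))" by (rule legendre_pair_chart[OF fr U c])
  have "open ?T"
  proof -
    have "open (snd c ` (fst c \<inter> U) \<inter> (\<lambda>z. fderiv ?N z x0) -` (- {0}))"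
      by (rule continuous_open_preimage[OF smooth_on_imp_continuous_on[OF smooth_on_frechet_derivative[OF
                legendre_pairD(3)[OF L]]] legendre_pairD(1)[OF L]]) auto
    then show ?thesis by (simp add: Int_def vimage_def)
  qed
  then show "legendre_pair ?F ?N ?T" by (rule legendre_pair_subset[OF L]) auto
  fix z assume z: "z \<in> ?T"
  then obtain q where q: "z = snd c q" "q \<in> fst c" "q \<in> U" by auto
  then have cq: "c \<in> charts_at M q" using c by simp
  show "rank_le_one (fderiv ?N z)"
    unfolding q(1) by (rule constant_curvature_one_rank[OF fr cc1_frontD(3)[OF cc] U q(3) cq])
  show "x = 0" if "fderiv ?F z x = 0" "fderiv ?N z x = 0" for x
    using front_immersed[OF cc1_frontD(1)[OF cc] U q(3) cq] that unfolding q(1) by blast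
  show "fderiv ?N z x0 \<noteq> 0" using z by blast
qed

text \<open>The description in \<open>caustic_radius\<close> is legitimate:
  \<open>caustic_direction\<close> gives existence and \<open>caustic_radius_unique\<close>
  uniqueness. Passing from \<nu> to the normal selected in \<open>caustic\<close> multiplies radius
  and normal by the same sign s.\<close>

lemma caustic_eq:
  fixes M :: "('a, 'v::euclidean_space) manifold" and f :: "'a \<Rightarrow> 'e::euclidean_space"
  assumes cc: "cc1_front M f E" and dim: "DIM('e) < DIM('v) + 3"
    and U: "local_unit_normal M f E U \<nu>" and p: "p \<in> U" and c: "c \<in> charts_at M p"
    and nz: "fderiv (\<nu> \<circ> chart_inv c) (snd c p) x0 \<noteq> 0"
  shows "caustic M f E p =
    caustic_chart.C (f \<circ> chart_inv c) (\<nu> \<circ> chart_inv c) x0 (snd c p)"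
proof -
  note fr = cc1_frontD(2)[OF cc] and M = cc1_frontD(4)[OF cc] and U' = local_unit_normalD[OF U]
  have pM: "p \<in> points M" by (rule U'(7)[OF p])
  have cM: "c \<in> atlas M" "p \<in> fst c" using c by auto
  let ?T = "{z \<in> snd c ` (fst c \<inter> U). fderiv (\<nu> \<circ> chart_inv c) z x0 \<noteq> 0}"
  interpret caustic_chart "f \<circ> chart_inv c" "\<nu> \<circ> chart_inv c" ?T x0
    by (rule caustic_chart_of_front[OF cc U cM(1)])
  let ?z = "snd c p"
  have z: "?z \<in> ?T" using nz cM p by auto
  define \<nu>' where "\<nu>' = (SOME \<nu>. \<exists>U. p \<in> U \<and> local_unit_normal M f E U \<nu>)"
  have "\<exists>\<nu>. \<exists>U. p \<in> U \<and> local_unit_normal M f E U \<nu>" using U p by blast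
  from someI_ex[OF this, folded \<nu>'_def] obtain V where V: "p \<in> V" "local_unit_normal M f E V \<nu>'" by blast
  obtain s :: real where s: "s = 1 \<or> s = -1" "\<nu>' p = s *\<^sub>R \<nu> p"
    "\<And>v. v \<in> tangent_space M p \<Longrightarrow> differential M \<nu>' p v = s *\<^sub>R differential M \<nu> p v"
    by (rule two_local_unit_normals[OF fr U V(2) p V(1)]) blast
  have df: "differential M f p v = fderiv (f \<circ> chart_inv c) ?z (v c)" 
    and dn: "differential M \<nu>' p v = s *\<^sub>R fderiv (\<nu> \<circ> chart_inv c) ?z (v c)"
    if "v \<in> tangent_space M p" for v
    using differential_eq[OF M c openin_points[OF M] pM frontalD(2)[OF fr] that]
      differential_eq[OF M c U'(1) p U'(2) that] s(3)[OF that] by auto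
  have "caustic_radius M f \<nu>' p = s * \<rho> ?z"
    unfolding caustic_radius_def
  proof (rule the_equality)
    obtain x where x: "fderiv (\<nu> \<circ> chart_inv c) ?z x \<noteq> 0"
      "fderiv (f \<circ> chart_inv c) ?z x = - \<rho> ?z *\<^sub>R fderiv (\<nu> \<circ> chart_inv c) ?z x"
      by (rule caustic_direction[OF z dim])
    let ?v = "coord_tangent M p c x"
    have v: "?v \<in> tangent_space M p" by (rule coord_tangent_in_tangent_space[OF M c])
    have vc: "?v c = x" by (rule coord_tangent_same[OF M c])
    show "\<exists>v\<in>tangent_space M p. differential M \<nu>' p v \<noteq> 0 \<and>
        differential M f p v = - (s * \<rho> ?z) *\<^sub>R differential M \<nu>' p v"
      by (rule bexI[OF _ v]) (use df[OF v] dn[OF v] vc x s(1) in auto)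
  next
    fix r
    assume "\<exists>v\<in>tangent_space M p. differential M \<nu>' p v \<noteq> 0 \<and>
        differential M f p v = - r *\<^sub>R differential M \<nu>' p v"
    then obtain v where v: "v \<in> tangent_space M p" "differential M \<nu>' p v \<noteq> 0"
      "differential M f p v = - r *\<^sub>R differential M \<nu>' p v" by blast
    have "r * s = \<rho> ?z"
      by (rule caustic_radius_unique[OF z, of "v c"]) (use v df[OF v(1)] dn[OF v(1)] in auto)
    then show "r = s * \<rho> ?z" using s(1) by auto
  qed
  moreover have "s * s = 1" using s(1) by auto
  ultimately have "caustic_radius M f \<nu>' p *\<^sub>R \<nu>' p = \<rho> ?z *\<^sub>R \<nu> p" "(caustic_radius M f \<nu>' p)\<^sup>2 = (\<rho> ?z)\<^sup>2"
    using s(1,2) by auto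
  then show ?thesis
    unfolding caustic_def Let_def \<nu>'_def[symmetric] C_def using M cM by simp
qed

section \<open>Open submanifolds\<close>

lemma atlas_open_submanifold:
  "c \<in> atlas (open_submanifold M W) \<longleftrightarrow> (\<exists>d \<in> atlas M. c = (fst d \<inter> W, snd d))"
  unfolding open_submanifold_def by force

lemma mtop_open_submanifold: "mtop (open_submanifold M W) = subtopology (mtop M) W"
  by (simp add: open_submanifold_def)

text \<open>Shrinking a chart domain changes \<open>inv_into\<close> as a total function; the old
  and the new inverse agree on the image of the smaller domain, which is where smoothness is
  tested.\<close>

lemma chart_inv_restrict:
  assumes "smooth_manifold M" "d \<in> atlas M" "y \<in> snd d ` (fst d \<inter> W)"
  shows "inv_into (fst d \<inter> W) (snd d) y = chart_inv d y"
proof -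
  obtain q where q: "q \<in> fst d" "q \<in> W" "y = snd d q" using assms(3) by blast
  have "inj_on (snd d) (fst d \<inter> W)" by (rule inj_on_subset[OF inj_on_chart[OF assms(1,2)]]) auto
  then show ?thesis using q inj_on_chart[OF assms(1,2)] by simp
qed

lemma smooth_manifold_open_submanifold:
  assumes M: "smooth_manifold M" and W: "openin (mtop M) W"
  shows "smooth_manifold (open_submanifold M W)"
proof -
  let ?M = "open_submanifold M W"
  have W': "W \<subseteq> points M" by (rule openin_subset[OF W])
  have 1: "Hausdorff_space (mtop ?M)" "second_countable (mtop ?M)"
    using smooth_manifoldD(1,2)[OF M] 
    by (auto simp: mtop_open_submanifold Hausdorff_space_subtopology second_countable_subtopology)
  have 2: "\<Union> (fst ` atlas ?M) = points ?M"
  proof -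
    have "fst ` atlas ?M = (\<lambda>d. fst d \<inter> W) ` atlas M"
      unfolding set_eq_iff image_iff atlas_open_submanifold Bex_def by (metis fst_conv)
    then have "\<Union> (fst ` atlas ?M) = \<Union> (fst ` atlas M) \<inter> W" by auto
    then show ?thesis using smooth_manifoldD(3)[OF M] by (simp add: mtop_open_submanifold)
  qed
  have 3: "openin (mtop ?M) (fst c) \<and> open (snd c ` fst c) \<and>
      homeomorphic_map (subtopology (mtop ?M) (fst c)) (top_of_set (snd c ` fst c)) (snd c)"
    if "c \<in> atlas ?M" for c
  proof -
    obtain d where d: "d \<in> atlas M" "c = (fst d \<inter> W, snd d)"
      using \<open>c \<in> atlas ?M\<close> unfolding atlas_open_submanifold by blast
    have "homeomorphic_map (subtopology (subtopology (mtop M) (fst d)) (fst d \<inter> W))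
        (subtopology (top_of_set (snd d ` fst d)) (snd d ` (fst d \<inter> W))) (snd d)"
      by (rule homeomorphic_map_subtopologies[OF smooth_manifoldD(6)[OF M d(1)]])
        (use chart_subset[OF M d(1)] in auto)
    moreover have "subtopology (subtopology (mtop M) (fst d)) (fst d \<inter> W) =
        subtopology (mtop ?M) (fst d \<inter> W)"
      by (simp add: mtop_open_submanifold subtopology_subtopology Int_ac)
    moreover have "subtopology (top_of_set (snd d ` fst d)) (snd d ` (fst d \<inter> W)) =
        top_of_set (snd d ` (fst d \<inter> W))"
      by (simp add: subtopology_subtopology Int_absorb1 image_mono)
    ultimately show ?thesis
      using d openin_subtopology_Int[OF smooth_manifoldD(4)[OF M d(1)], of W]
        open_chart_image[OF M d(1) W] by (simp add: mtop_open_submanifold)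
  qed
  have 4: "smooth_on (snd c' \<circ> chart_inv c) (snd c ` (fst c \<inter> fst c'))"
    if c: "c \<in> atlas ?M" "c' \<in> atlas ?M" for c c'
  proof -
    obtain d d' where d: "d \<in> atlas M" "c = (fst d \<inter> W, snd d)" "d' \<in> atlas M" "c' = (fst d' \<inter> W, snd d')"
      using c unfolding atlas_open_submanifold by blast
    have "openin (mtop M) (fst d' \<inter> W)" using smooth_manifoldD(4)[OF M d(3)] W by blast
    then have op: "open (snd d ` (fst d \<inter> (fst d' \<inter> W)))" by (rule open_chart_image[OF M d(1)])
    have "smooth_on (snd d' \<circ> chart_inv d) (snd d ` (fst d \<inter> (fst d' \<inter> W)))"
      by (rule smooth_on_mono[OF smooth_manifoldD(7)[OF M d(1,3)]]) auto
    then have "smooth_on (snd d' \<circ> inv_into (fst d \<inter> W) (snd d)) (snd d ` (fst d \<inter> (fst d' \<inter> W)))"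
      by (rule smooth_on_cong[OF op]) (use chart_inv_restrict[OF M d(1)] in auto)
    moreover have "fst c \<inter> fst c' = fst d \<inter> (fst d' \<inter> W)" using d by auto
    ultimately show ?thesis using d by simp
  qed
  show ?thesis
    unfolding smooth_manifold_def using 1 2 3 4 by (simp add: case_prod_beta)
qed

section \<open>The caustic is a front\<close>

lemma caustic_cc1_front:
  fixes M :: "('a, 'v::euclidean_space) manifold" and f :: "'a \<Rightarrow> 'e::euclidean_space"
  assumes cc: "cc1_front M f E" and n: "2 \<le> DIM('v)" and dim: "DIM('e) < DIM('v) + 3"
  defines "M' \<equiv> open_submanifold M (points M - umbilics M f E)"
  shows "\<exists>E'. cc1_front M' (caustic M f E) E' \<and> umbilics M' (caustic M f E) E' = {}"
proof -
  note fr = cc1_frontD(2)[OF cc] and M = cc1_frontD(4)[OF cc]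
  define W where "W = points M - umbilics M f E"
  define fC where "fC = caustic M f E"
  \<comment> \<open>The local normal e is replaced by the values of the differentials of all local
    unit normals. Away from the umbilics these values span the line of e, so the fibre is well
    defined globally.\<close>
  define E' where "E' p = {w. w \<bullet> fC p = 0 \<and> (\<forall>U \<nu> v. p \<in> U \<longrightarrow> local_unit_normal M f E U \<nu> \<longrightarrow>
      v \<in> tangent_space M p \<longrightarrow> w \<bullet> differential M \<nu> p v = 0)}" for p

  have local_data: "\<exists>U c x0 S e. p \<in> U \<and> openin (mtop M) U \<and> U \<subseteq> W \<and> U \<subseteq> fst c \<and> c \<in> atlas M \<and>
      S = snd c ` U \<and> legendre_pair (fC \<circ> chart_inv c) e S \<and>
      (\<forall>q\<in>U. E' q = {w. w \<bullet> fC q = 0 \<and> w \<bullet> e (snd c q) = 0}) \<and>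
      (\<forall>z\<in>S. rank_le_one (fderiv e z) \<and> fderiv e z x0 \<noteq> 0 \<and>
        (\<forall>x. fderiv (fC \<circ> chart_inv c) z x = 0 \<longrightarrow> fderiv e z x = 0 \<longrightarrow> x = 0))"
    if p: "p \<in> W" for p
  proof -
    have pM: "p \<in> points M" using p by (simp add: W_def)
    obtain V \<nu> where V: "p \<in> V" "local_unit_normal M f E V \<nu>" using frontalD(4)[OF fr pM] by blast
    note V' = local_unit_normalD[OF V(2)]
    obtain c where cp: "c \<in> charts_at M p" using exists_chart[OF M pM] .
    then have c: "c \<in> atlas M" "p \<in> fst c" by auto
    obtain x0 where nz: "fderiv (\<nu> \<circ> chart_inv c) (snd c p) x0 \<noteq> 0"
      using umbilics_iff[OF cc n V(2,1) cp] p by (auto simp: W_def)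
    define S where "S = {z \<in> snd c ` (fst c \<inter> V). fderiv (\<nu> \<circ> chart_inv c) z x0 \<noteq> 0}"
    interpret caustic_chart "f \<circ> chart_inv c" "\<nu> \<circ> chart_inv c" S x0
      unfolding S_def by (rule caustic_chart_of_front[OF cc V(2) c(1)])
    define U where "U = {q \<in> fst c. snd c q \<in> S}"
    have "open S" by (rule L')
    then have opU: "openin (mtop M) U" unfolding U_def by (rule openin_chart_vimage[OF M c(1)])
    have UV: "U \<subseteq> V"
    proof
      fix q assume "q \<in> U"
      then obtain q' where "q \<in> fst c" "q' \<in> fst c" "q' \<in> V" "snd c q = snd c q'"
        by (auto simp: U_def S_def)
      then show "q \<in> V" using inj_onD[OF inj_on_chart[OF M c(1)], of q q'] by simp
    qed
    have SU: "S = snd c ` U" by (auto simp: U_def S_def)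
    have Sx0: "fderiv (\<nu> \<circ> chart_inv c) (snd c q) x0 \<noteq> 0" if "q \<in> U" for q
      using that by (simp add: U_def S_def)
    have cU: "c \<in> charts_at M q" if "q \<in> U" for q using that c by (simp add: U_def)
    \<comment> \<open>This inclusion shows that the complement of the umbilics is open, as the
      submanifold structure requires.\<close>
    have UW: "U \<subseteq> W"
    proof
      fix q assume q: "q \<in> U"
      then have qV: "q \<in> V" using UV by blast
      show "q \<in> W"
        using umbilics_iff[OF cc n V(2) qV cU[OF q]] Sx0[OF q] V'(7)[OF qV] by (auto simp: W_def)
    qed
    have ci: "chart_inv c (snd c q) = q" if "q \<in> U" for q using that M c by (simp add: U_def)
    have fC: "(fC \<circ> chart_inv c) z = C z" if z: "z \<in> S" for z
    proof -
      obtain q where q: "q \<in> U" "z = snd c q" using z SU by blast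
      have qV: "q \<in> V" using q UV by blast
      show ?thesis
        using caustic_eq[OF cc dim V(2) qV cU[OF q(1)] Sx0[OF q(1)]] ci[OF q(1)] by (simp add: fC_def q(2))
    qed
    have pU: "p \<in> U" using nz c V(1) by (simp add: U_def S_def)
    have LC: "legendre_pair (fC \<circ> chart_inv c) e S"
      by (rule legendre_pair_cong[OF legendre_pair_caustic fC[symmetric] refl])
    have dC: "fderiv (fC \<circ> chart_inv c) z = fderiv C z" if "z \<in> S" for z
      by (rule frechet_derivative_cong_open[OF L'(1) that fC])
    have Eq: "E' q = {w. w \<bullet> fC q = 0 \<and> w \<bullet> e (snd c q) = 0}" if q: "q \<in> U" for q
    proof -
      have qV: "q \<in> V" using q UV by blast
      have zS: "snd c q \<in> S" using q SU by blast
      have dn: "differential M \<nu> q v = fderiv (\<nu> \<circ> chart_inv c) (snd c q) (v c)"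
        if "v \<in> tangent_space M q" for v
        by (rule differential_eq[OF M cU[OF q] V'(1) qV V'(2) that])
      have "(\<forall>U \<nu> v. q \<in> U \<longrightarrow> local_unit_normal M f E U \<nu> \<longrightarrow>
          v \<in> tangent_space M q \<longrightarrow> w \<bullet> differential M \<nu> q v = 0) \<longleftrightarrow> w \<bullet> e (snd c q) = 0" for w
      proof
        assume A: "\<forall>U \<nu> v. q \<in> U \<longrightarrow> local_unit_normal M f E U \<nu> \<longrightarrow>
          v \<in> tangent_space M q \<longrightarrow> w \<bullet> differential M \<nu> q v = 0"
        have T: "coord_tangent M q c x0 \<in> tangent_space M q"
          by (rule coord_tangent_in_tangent_space[OF M cU[OF q]])
        have "w \<bullet> fderiv (\<nu> \<circ> chart_inv c) (snd c q) x0 = 0"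
          using A V(2) qV T dn[OF T] by (metis coord_tangent_same[OF M cU[OF q]])
        then show "w \<bullet> e (snd c q) = 0" by (simp add: e_def)
      next
        assume w: "w \<bullet> e (snd c q) = 0"
        show "\<forall>U \<nu> v. q \<in> U \<longrightarrow> local_unit_normal M f E U \<nu> \<longrightarrow>
          v \<in> tangent_space M q \<longrightarrow> w \<bullet> differential M \<nu> q v = 0"
        proof (intro allI impI)
          fix U2 \<nu>2 v assume U2: "q \<in> U2" "local_unit_normal M f E U2 \<nu>2" and v: "v \<in> tangent_space M q"
          obtain s :: real where s: "s = 1 \<or> s = -1"
            "\<And>v. v \<in> tangent_space M q \<Longrightarrow> differential M \<nu>2 q v = s *\<^sub>R differential M \<nu> q v"
            by (rule two_local_unit_normals[OF fr V(2) U2(2) qV U2(1)]) blast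
          have "w \<bullet> fderiv (\<nu> \<circ> chart_inv c) (snd c q) (v c) = 0"
            by (subst dN_eq[OF zS]) (simp add: w)
          then show "w \<bullet> differential M \<nu>2 q v = 0" using s(2)[OF v] dn[OF v] by simp
        qed
      qed
      then show ?thesis by (simp add: E'_def)
    qed
    have fin: "\<forall>z\<in>S. rank_le_one (fderiv e z) \<and> fderiv e z x0 \<noteq> 0 \<and>
        (\<forall>x. fderiv (fC \<circ> chart_inv c) z x = 0 \<longrightarrow> fderiv e z x = 0 \<longrightarrow> x = 0)"
      using rank_de de_x0 immersed_caustic dC by simp
    have "U \<subseteq> fst c" by (auto simp: U_def)
    then show ?thesis using pU opU UW c(1) SU LC Eq fin by blast
  qed

  have W: "openin (mtop M) W"
    using local_data by (subst openin_subopen) meson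
  have M'W: "M' = open_submanifold M W" by (simp add: M'_def W_def)
  have M': "smooth_manifold M'" unfolding M'W by (rule smooth_manifold_open_submanifold[OF M W])
  have pts: "points M' = W" using openin_subset[OF W] by (simp add: M'W mtop_open_submanifold Int_absorb1)

  have data': "\<exists>U \<nu> c x0. p \<in> U \<and> local_unit_normal M' fC E' U \<nu> \<and> c \<in> charts_at M' p \<and>
      openin (mtop M') U \<and> smooth_fun_on M' U fC \<and> norm (fC p) = 1 \<and>
      rank_le_one (fderiv (\<nu> \<circ> chart_inv c) (snd c p)) \<and> fderiv (\<nu> \<circ> chart_inv c) (snd c p) x0 \<noteq> 0 \<and>
      (\<forall>x. fderiv (fC \<circ> chart_inv c) (snd c p) x = 0 \<longrightarrow> fderiv (\<nu> \<circ> chart_inv c) (snd c p) x = 0 \<longrightarrow> x = 0)"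
    if p: "p \<in> points M'" for p
  proof -
    have "p \<in> W" using p pts by simp
    from local_data[OF this] obtain U c x0 S e where
      U: "p \<in> U" "openin (mtop M) U" "U \<subseteq> W" "U \<subseteq> fst c" and c: "c \<in> atlas M" and S: "S = snd c ` U"
      and L: "legendre_pair (fC \<circ> chart_inv c) e S"
      and E: "\<forall>q\<in>U. E' q = {w. w \<bullet> fC q = 0 \<and> w \<bullet> e (snd c q) = 0}"
      and fin: "\<forall>z\<in>S. rank_le_one (fderiv e z) \<and> fderiv e z x0 \<noteq> 0 \<and>
        (\<forall>x. fderiv (fC \<circ> chart_inv c) z x = 0 \<longrightarrow> fderiv e z x = 0 \<longrightarrow> x = 0)"
      by blast
    define d where "d = (fst c \<inter> W, snd c)"
    have d: "d \<in> atlas M'" using c by (auto simp: d_def M'W atlas_open_submanifold)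
    have Ud: "U \<subseteq> fst d" using U by (auto simp: d_def)
    have dp: "d \<in> charts_at M' p" using d Ud U by auto
    have opU: "openin (mtop M') U" using U(2,3) by (auto simp: M'W mtop_open_submanifold openin_open_subtopology[OF W])
    have S': "S = snd d ` U" by (simp add: S d_def)
    have di: "chart_inv d z = chart_inv c z" if "z \<in> S" for z
      using chart_inv_restrict[OF M c, of z W] that U(3,4) unfolding S d_def by auto
    have sd: "snd c (chart_inv c z) = z" if "z \<in> S" for z
      using that U(4) M c unfolding S by auto
    have eq: "(fC \<circ> chart_inv c) z = (fC \<circ> chart_inv d) z" "e z = ((\<lambda>q. e (snd c q)) \<circ> chart_inv d) z"
      if "z \<in> S" for z
      using di[OF that] sd[OF that] by auto
    have L2: "legendre_pair (fC \<circ> chart_inv d) ((\<lambda>q. e (snd c q)) \<circ> chart_inv d) (snd d ` U)"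
      using legendre_pair_cong[OF L eq] unfolding S' .
    note lun = local_unit_normal_chartI[OF M' d opU Ud L2, of E', OF E[rule_format]]
    have zS: "snd d p \<in> S" using U(1) S' by blast
    note cong = frechet_derivative_cong_open[OF legendre_pairD(1)[OF L] zS]
    have "fderiv ((\<lambda>q. e (snd c q)) \<circ> chart_inv d) (snd d p) = fderiv e (snd d p)"
      "fderiv (fC \<circ> chart_inv d) (snd d p) = fderiv (fC \<circ> chart_inv c) (snd d p)"
      by (rule cong[OF eq(2)[symmetric]], assumption) (rule cong[OF eq(1)[symmetric]], assumption)
    then show ?thesis
      using fin[rule_format, OF zS] lun U(1) dp opU
      by (intro exI[of _ U] exI[of _ "\<lambda>q. e (snd c q)"] exI[of _ d] exI[of _ x0]) simp
  qed
  have frontal': "frontal M' fC E'"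
    unfolding frontal_def
  proof (intro conjI M')
    show "smooth_fun_on M' (points M') fC"
    proof (rule smooth_fun_on_local[OF M'])
      fix p assume "p \<in> points M'"
      from data'[OF this] show "\<exists>V. openin (mtop M') V \<and> p \<in> V \<and> smooth_fun_on M' V fC" by blast
    qed
    show "fC ` points M' \<subseteq> sphere 0 1" using data' by fastforce
    show "\<forall>p\<in>points M'. \<exists>U \<nu>. p \<in> U \<and> local_unit_normal M' fC E' U \<nu>" using data' by blast
  qed
  have cc': "cc1_front M' fC E'"
    unfolding cc1_front_def
  proof
    show "front M' fC E'"
      by (rule frontI[OF frontal']) (use data' in blast)
    show "constant_curvature_one M' fC E'"
      by (rule constant_curvature_oneI[OF frontal']) (use data' in blast)
  qed
  moreover have "umbilics M' fC E' = {}"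
  proof -
    have False if p: "p \<in> umbilics M' fC E'" for p
    proof -
      have "p \<in> points M'" using p by (simp add: umbilics_def)
      from data'[OF this] obtain U \<nu> c x0 where U: "p \<in> U" "local_unit_normal M' fC E' U \<nu>"
        "c \<in> charts_at M' p" "fderiv (\<nu> \<circ> chart_inv c) (snd c p) x0 \<noteq> 0" by blast
      \<comment> \<open>The umbilic criterion is applied to the caustic itself, whose normal has a
        nonzero derivative along \<open>x0\<close>.\<close>
      then show False using umbilics_iff[OF cc' n U(2,1,3)] p by blast
    qed
    then show ?thesis by blast
  qed
  ultimately show ?thesis unfolding fC_def by blast
qed

section \<open>The cylinder\<close>

lemma second_countable_euclidean:
  "second_countable (euclidean :: 'a::second_countable_topology topology)"
proof -
  obtain B :: "'a set set" where B: "countable B" "topological_basis B"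
    using ex_countable_basis by blast
  have "\<exists>V\<in>B. x \<in> V \<and> V \<subseteq> U" if "open U" "x \<in> U" for U x
    by (rule topological_basisE[OF B(2) that]) blast
  then show ?thesis
    unfolding second_countable_def
    by (intro exI[of _ B]) (simp add: B(1) topological_basis_open[OF B(2)])
qed

definition cylinder_chart :: "'n \<Rightarrow> real \<times> (real^'n::finite) \<Rightarrow> real^'n" where
  "cylinder_chart i = (\<lambda>(s, x). \<chi> j. if j = i then s else x $ j)"

definition cylinder_dom :: "'n \<Rightarrow> real \<Rightarrow> (real \<times> (real^'n::finite)) set" where
  "cylinder_dom i \<sigma> = {(s, x). x \<in> sphere 0 1 \<and> 0 < \<sigma> * x $ i}"

text \<open>Slot i of z holds the line coordinate s. The sphere coordinate with index i is recovered
  from the others as a square root, with the sign of the half sphere.\<close>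

definition cylinder_inv :: "'n \<Rightarrow> real \<Rightarrow> real^'n::finite \<Rightarrow> real \<times> (real^'n)" where
  "cylinder_inv i \<sigma> z =
     (z $ i, \<chi> j. if j = i then \<sigma> * sqrt (1 - (\<Sum>k\<in>UNIV - {i}. z $ k * z $ k)) else z $ j)"

text \<open>The common image of the two charts with index i: the unit ball in the other coordinates
  times the line in slot i.\<close>

definition cylinder_ball :: "'n \<Rightarrow> (real^'n::finite) set" where
  "cylinder_ball i = {z. (\<Sum>k\<in>UNIV - {i}. z $ k * z $ k) < 1}"

lemma cylinder_alt:
  "cylinder = \<lparr> mtop = top_of_set (UNIV \<times> sphere 0 1),
     atlas = {(cylinder_dom i \<sigma>, cylinder_chart i) | i \<sigma>. \<sigma> \<in> {-1, 1}} \<rparr>"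
  unfolding cylinder_def cylinder_dom_def cylinder_chart_def by simp

lemma points_cylinder [simp]: "points cylinder = UNIV \<times> sphere 0 1"
  and mtop_cylinder: "mtop cylinder = top_of_set (UNIV \<times> sphere 0 1)"
  by (simp_all add: cylinder_alt)

lemma atlas_cylinderE:
  assumes "c \<in> atlas cylinder"
  obtains i \<sigma> where "\<sigma> = -1 \<or> \<sigma> = 1" "c = (cylinder_dom i \<sigma>, cylinder_chart i)"
  using assms by (auto simp: cylinder_alt)

lemma bounded_linear_cylinder_chart: "bounded_linear (cylinder_chart i)"
proof -
  have "linear (cylinder_chart i)"
    by (rule linearI) (auto simp: cylinder_chart_def vec_eq_iff)
  then show ?thesis by (simp add: linear_conv_bounded_linear)
qed

lemma inner_vec_split:
  fixes x :: "real^'n::finite"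
  shows "x \<bullet> y = x $ i * y $ i + (\<Sum>k\<in>UNIV - {i}. x $ k * y $ k)"
  by (simp add: inner_vec_def sum.remove[of UNIV i])

lemma mem_cylinder_dom: "(s, x) \<in> cylinder_dom i \<sigma> \<longleftrightarrow> x \<bullet> x = 1 \<and> 0 < \<sigma> * x $ i"
  by (simp add: cylinder_dom_def norm_eq_1)

lemma cylinder_chart_in_ball:
  assumes "p \<in> cylinder_dom i \<sigma>"
  shows "cylinder_chart i p \<in> cylinder_ball i"
proof -
  obtain s x where p: "p = (s, x)" by force
  have "x \<bullet> x = 1" "x $ i \<noteq> 0" using assms by (auto simp: p mem_cylinder_dom)
  then have "(\<Sum>k\<in>UNIV - {i}. x $ k * x $ k) < 1"
    using inner_vec_split[of x x i] not_real_square_gt_zero[of "x $ i"] by linarith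
  then show ?thesis by (simp add: p cylinder_ball_def cylinder_chart_def)
qed

lemma cylinder_inv_chart:
  assumes "\<sigma> = -1 \<or> \<sigma> = 1" "p \<in> cylinder_dom i \<sigma>"
  shows "cylinder_inv i \<sigma> (cylinder_chart i p) = p"
proof -
  obtain s x where p: "p = (s, x)" by force
  have x: "x \<bullet> x = 1" "0 < \<sigma> * x $ i" using assms by (auto simp: p mem_cylinder_dom)
  have "1 - (\<Sum>k\<in>UNIV - {i}. x $ k * x $ k) = (x $ i)\<^sup>2"
    using inner_vec_split[of x x i] x by (simp add: power2_eq_square)
  then have "\<sigma> * sqrt (1 - (\<Sum>k\<in>UNIV - {i}. x $ k * x $ k)) = \<sigma> * \<bar>x $ i\<bar>" by simp
  also have "\<dots> = x $ i" using x(2) assms(1) by auto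
  finally show ?thesis by (simp add: p cylinder_inv_def cylinder_chart_def vec_eq_iff)
qed

lemma cylinder_chart_inv: "cylinder_chart i (cylinder_inv i \<sigma> z) = z"
  by (simp add: cylinder_inv_def cylinder_chart_def vec_eq_iff)

lemma cylinder_inv_in_dom:
  assumes "\<sigma> = -1 \<or> \<sigma> = 1" "z \<in> cylinder_ball i"
  shows "cylinder_inv i \<sigma> z \<in> cylinder_dom i \<sigma>"
proof -
  let ?S = "\<Sum>k\<in>UNIV - {i}. z $ k * z $ k"
  have S: "?S < 1" using assms(2) by (simp add: cylinder_ball_def)
  have ss: "\<sigma> * \<sigma> = 1" using assms(1) by auto
  have "(\<sigma> * sqrt (1 - ?S)) * (\<sigma> * sqrt (1 - ?S)) = (\<sigma> * \<sigma>) * (sqrt (1 - ?S) * sqrt (1 - ?S))" by simp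
  also have "\<dots> = 1 - ?S" using S ss by simp
  finally have "snd (cylinder_inv i \<sigma> z) \<bullet> snd (cylinder_inv i \<sigma> z) = 1"
    by (simp add: inner_vec_split[of _ _ i] cylinder_inv_def)
  moreover have "0 < \<sigma> * snd (cylinder_inv i \<sigma> z) $ i"
    using S ss by (simp add: cylinder_inv_def flip: mult.assoc)
  ultimately show ?thesis by (cases "cylinder_inv i \<sigma> z") (simp add: mem_cylinder_dom)
qed

lemma cylinder_chart_image:
  assumes "\<sigma> = -1 \<or> \<sigma> = 1"
  shows "cylinder_chart i ` cylinder_dom i \<sigma> = cylinder_ball i"
proof
  show "cylinder_chart i ` cylinder_dom i \<sigma> \<subseteq> cylinder_ball i"
    using cylinder_chart_in_ball by blast
  show "cylinder_ball i \<subseteq> cylinder_chart i ` cylinder_dom i \<sigma>"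
  proof
    fix z :: "real^'a" assume "z \<in> cylinder_ball i"
    from imageI[OF cylinder_inv_in_dom[OF assms this], of "cylinder_chart i"]
    show "z \<in> cylinder_chart i ` cylinder_dom i \<sigma>" by (simp only: cylinder_chart_inv)
  qed
qed

lemma open_cylinder_ball: "open (cylinder_ball i)"
  unfolding cylinder_ball_def by (intro open_Collect_less continuous_intros)

lemma smooth_on_cylinder_inv: "smooth_on (cylinder_inv i \<sigma>) (cylinder_ball i)"
proof -
  have "smooth_on (\<lambda>z. if j = i then \<sigma> * sqrt (1 - (\<Sum>k\<in>UNIV - {i}. z $ k * z $ k)) else z $ j)
      (cylinder_ball i)" for j
    by (cases "j = i")
      (auto intro!: smooth_intros open_cylinder_ball simp: cylinder_ball_def[symmetric], auto simp: cylinder_ball_def)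
  then show ?thesis
    unfolding cylinder_inv_def[abs_def]
    by (intro smooth_on_Pair smooth_on_vec_lambda smooth_on_vec_nth smooth_on_ident open_cylinder_ball)
qed

lemma inv_into_cylinder:
  assumes "\<sigma> = -1 \<or> \<sigma> = 1" "z \<in> cylinder_ball i"
  shows "inv_into (cylinder_dom i \<sigma>) (cylinder_chart i) z = cylinder_inv i \<sigma> z"
proof -
  have "inj_on (cylinder_chart i) (cylinder_dom i \<sigma>)"
    by (rule inj_on_inverseI[of _ "cylinder_inv i \<sigma>"]) (rule cylinder_inv_chart[OF assms(1)])
  from inv_into_f_f[OF this cylinder_inv_in_dom[OF assms]] show ?thesis
    by (simp only: cylinder_chart_inv)
qed

lemma cylinder_dom_subset: "cylinder_dom i \<sigma> \<subseteq> UNIV \<times> sphere 0 1"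
  by (auto simp: cylinder_dom_def)

lemma smooth_manifold_cylinder: "smooth_manifold (cylinder :: (real \<times> (real^'n::finite), real^'n) manifold)"
proof -
  let ?M = "cylinder :: (real \<times> (real^'n), real^'n) manifold"
  have 1: "Hausdorff_space (mtop ?M)" "second_countable (mtop ?M)"
    by (simp_all add: mtop_cylinder Hausdorff_space_subtopology second_countable_subtopology
        second_countable_euclidean)
  have 2: "\<Union> (fst ` atlas ?M) = points ?M"
  proof
    show "\<Union> (fst ` atlas ?M) \<subseteq> points ?M"
    proof (intro Union_least)
      fix U assume "U \<in> fst ` atlas ?M"
      then obtain i \<sigma> where "U = cylinder_dom i \<sigma>" by (auto elim!: atlas_cylinderE)
      then show "U \<subseteq> points ?M" using cylinder_dom_subset by simp
    qed
    show "points ?M \<subseteq> \<Union> (fst ` atlas ?M)"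
    proof
      fix p :: "real \<times> (real^'n)" assume "p \<in> points ?M"
      then obtain s x where p: "p = (s, x)" "x \<bullet> x = 1" by (auto simp: norm_eq_1)
      then have "x \<noteq> 0" by auto
      then obtain i where i: "x $ i \<noteq> 0" by (auto simp: vec_eq_iff)
      then have "0 < sgn (x $ i) * x $ i" "sgn (x $ i) \<in> {-1, 1}"
        by (auto simp: sgn_real_def)
      then have "(cylinder_dom i (sgn (x $ i)), cylinder_chart i) \<in> atlas ?M"
        "p \<in> cylinder_dom i (sgn (x $ i))"
        using p unfolding cylinder_alt by (auto simp: mem_cylinder_dom)
      then show "p \<in> \<Union> (fst ` atlas ?M)" by force
    qed
  qed
  have 3: "openin (mtop ?M) (fst c) \<and> open (snd c ` fst c) \<and>
      homeomorphic_map (subtopology (mtop ?M) (fst c)) (top_of_set (snd c ` fst c)) (snd c)"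
    if c: "c \<in> atlas ?M" for c
  proof -
    obtain i \<sigma> where \<sigma>: "\<sigma> = -1 \<or> \<sigma> = 1" and c: "c = (cylinder_dom i \<sigma>, cylinder_chart i)"
      using c by (rule atlas_cylinderE)
    have "open {p :: real \<times> (real^'n). 0 < \<sigma> * snd p $ i}"
      by (intro open_Collect_less continuous_intros)
    moreover have "cylinder_dom i \<sigma> = (UNIV \<times> sphere 0 1) \<inter> {p. 0 < \<sigma> * snd p $ i}"
      by (auto simp: cylinder_dom_def)
    ultimately have "openin (mtop ?M) (cylinder_dom i \<sigma>)"
      by (simp add: mtop_cylinder openin_open_Int)
    moreover have "homeomorphic_maps (top_of_set (cylinder_dom i \<sigma>)) (top_of_set (cylinder_ball i))
        (cylinder_chart i) (cylinder_inv i \<sigma>)"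
      unfolding homeomorphic_maps_def
    proof (intro conjI ballI)
      show "continuous_map (top_of_set (cylinder_dom i \<sigma>)) (top_of_set (cylinder_ball i)) (cylinder_chart i)"
        using linear_continuous_on[OF bounded_linear_cylinder_chart] cylinder_chart_in_ball by auto
      show "continuous_map (top_of_set (cylinder_ball i)) (top_of_set (cylinder_dom i \<sigma>)) (cylinder_inv i \<sigma>)"
        using smooth_on_imp_continuous_on[OF smooth_on_cylinder_inv] cylinder_inv_in_dom[OF \<sigma>] by auto
    qed (use cylinder_inv_chart[OF \<sigma>] cylinder_chart_inv in auto)
    moreover have "subtopology (mtop ?M) (cylinder_dom i \<sigma>) = top_of_set (cylinder_dom i \<sigma>)"
      using cylinder_dom_subset[of i \<sigma>] by (simp add: mtop_cylinder subtopology_subtopology Int_absorb1)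
    ultimately show ?thesis
      by (auto simp: c homeomorphic_map_maps cylinder_chart_image[OF \<sigma>] open_cylinder_ball)
  qed
  have 4: "smooth_on (snd c' \<circ> chart_inv c) (snd c ` (fst c \<inter> fst c'))"
    if cc: "c \<in> atlas ?M" "c' \<in> atlas ?M" for c c'
  proof -
    obtain i \<sigma> where \<sigma>: "\<sigma> = -1 \<or> \<sigma> = 1" and c: "c = (cylinder_dom i \<sigma>, cylinder_chart i)"
      using cc(1) by (rule atlas_cylinderE)
    obtain j \<tau> where \<tau>: "\<tau> = -1 \<or> \<tau> = 1" and c': "c' = (cylinder_dom j \<tau>, cylinder_chart j)"
      using cc(2) by (rule atlas_cylinderE)
    have eq: "cylinder_chart i ` (cylinder_dom i \<sigma> \<inter> cylinder_dom j \<tau>) =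
        {z \<in> cylinder_ball i. 0 < \<tau> * snd (cylinder_inv i \<sigma> z) $ j}" (is "?A = ?B")
    proof
      show "?A \<subseteq> ?B"
      proof
        fix z assume "z \<in> ?A"
        then obtain p where p: "z = cylinder_chart i p" "p \<in> cylinder_dom i \<sigma>" "p \<in> cylinder_dom j \<tau>"
          by blast
        have "0 < \<tau> * snd p $ j" using p(3) by (cases p) (simp add: mem_cylinder_dom)
        then show "z \<in> ?B"
          using cylinder_chart_in_ball[OF p(2)] cylinder_inv_chart[OF \<sigma> p(2)] by (simp add: p(1))
      qed
      show "?B \<subseteq> ?A"
      proof
        fix z assume z: "z \<in> ?B"
        then have d: "cylinder_inv i \<sigma> z \<in> cylinder_dom i \<sigma>"
          by (intro cylinder_inv_in_dom[OF \<sigma>]) simp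
        then have "cylinder_inv i \<sigma> z \<in> cylinder_dom j \<tau>"
          using z by (cases "cylinder_inv i \<sigma> z") (simp add: mem_cylinder_dom)
        then have "cylinder_chart i (cylinder_inv i \<sigma> z) \<in> ?A" using d by blast
        then show "z \<in> ?A" by (simp only: cylinder_chart_inv)
      qed
    qed
    have "open (cylinder_ball i \<inter> (\<lambda>z. \<tau> * snd (cylinder_inv i \<sigma> z) $ j) -` {0<..})"
      by (rule continuous_open_preimage[OF _ open_cylinder_ball])
        (auto intro!: continuous_intros smooth_on_imp_continuous_on[OF smooth_on_cylinder_inv])
    then have op: "open ?A" unfolding eq by (simp add: Int_def vimage_def)
    have "smooth_on (\<lambda>z. cylinder_chart j (cylinder_inv i \<sigma> z)) ?A"
      by (rule smooth_on_linear_compose[OF op bounded_linear_cylinder_chart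
            smooth_on_mono[OF smooth_on_cylinder_inv]]) (auto simp: eq)
    then have "smooth_on (cylinder_chart j \<circ> inv_into (cylinder_dom i \<sigma>) (cylinder_chart i)) ?A"
      by (rule smooth_on_cong[OF op]) (auto simp: eq inv_into_cylinder[OF \<sigma>])
    then show ?thesis by (simp add: c c')
  qed
  show ?thesis
    unfolding smooth_manifold_def using 1 2 3 4 by (simp add: case_prod_beta)
qed

lemma smooth_on_chart_inv_cylinder:
  assumes "c \<in> atlas cylinder"
  shows "smooth_on (chart_inv c) (snd c ` fst c)" and "bounded_linear (snd c)"
proof -
  obtain i \<sigma> where \<sigma>: "\<sigma> = -1 \<or> \<sigma> = 1" and c: "c = (cylinder_dom i \<sigma>, cylinder_chart i)"
    using assms by (rule atlas_cylinderE)
  show "smooth_on (chart_inv c) (snd c ` fst c)"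
    unfolding c fst_conv snd_conv cylinder_chart_image[OF \<sigma>]
    by (rule smooth_on_cong[OF open_cylinder_ball smooth_on_cylinder_inv])
      (simp add: inv_into_cylinder[OF \<sigma>])
  show "bounded_linear (snd c)" by (simp add: c bounded_linear_cylinder_chart)
qed

section \<open>Maps and tangent vectors of the cylinder in the ambient product\<close>

lemma smooth_fun_on_cylinderI:
  fixes G :: "real \<times> (real^'n::finite) \<Rightarrow> 'e::euclidean_space"
  assumes W: "openin (mtop cylinder) W" and A: "W \<subseteq> A" and G: "smooth_on G A"
    and eq: "\<And>q. q \<in> W \<Longrightarrow> g q = G q"
  shows "smooth_fun_on cylinder W g"
proof (rule smooth_fun_onI)
  have M: "smooth_manifold (cylinder :: (real \<times> (real^'n), real^'n) manifold)"
    by (rule smooth_manifold_cylinder)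
  fix c :: "(real \<times> (real^'n), real^'n) chart" assume c: "c \<in> atlas cylinder"
  have op: "open (snd c ` (fst c \<inter> W))" by (rule open_chart_image[OF M c W])
  have "smooth_on (\<lambda>z. G (chart_inv c z)) (snd c ` (fst c \<inter> W))"
    by (rule smooth_on_compose[OF op G smooth_on_mono[OF smooth_on_chart_inv_cylinder(1)[OF c]]])
      (use M c A in auto)
  then show "smooth_on (g \<circ> chart_inv c) (snd c ` (fst c \<inter> W))"
    by (rule smooth_on_cong[OF op]) (use M c eq in auto)
qed

text \<open>Identifies coordinate vectors at p = (s, x) with ambient vectors (a, w) such that w is
  orthogonal to x.\<close>

abbreviation cylinder_tangent where "cylinder_tangent c p \<equiv> fderiv (chart_inv c) (snd c p)"

lemma cylinder_tangent:
  fixes p :: "real \<times> (real^'n::finite)"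
  assumes c: "c \<in> charts_at cylinder p"
  shows linear_cylinder_tangent: "linear (cylinder_tangent c p)"
    and chart_cylinder_tangent: "snd c (cylinder_tangent c p u) = u"
    and "snd (cylinder_tangent c p u) \<bullet> snd p = 0"
    and cylinder_tangent_chart: "w \<bullet> snd p = 0 \<Longrightarrow> cylinder_tangent c p (snd c (a, w)) = (a, w)"
proof -
  have M: "smooth_manifold (cylinder :: (real \<times> (real^'n), real^'n) manifold)"
    by (rule smooth_manifold_cylinder)
  have cM: "c \<in> atlas cylinder" "p \<in> fst c" using c by auto
  let ?S = "snd c ` fst c" and ?z = "snd c p"
  have S: "open ?S" "?z \<in> ?S" using smooth_manifoldD(5)[OF M cM(1)] cM by auto
  note D = smooth_on_has_derivative[OF smooth_on_chart_inv_cylinder(1)[OF cM(1)] S(2)]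
  show "linear (cylinder_tangent c p)"
    by (rule smooth_on_linear_derivative[OF smooth_on_chart_inv_cylinder(1)[OF cM(1)] S(2)])
  have iz: "chart_inv c ?z = p" using M cM by simp
  have "((\<lambda>y. snd c (chart_inv c y)) has_derivative (\<lambda>u. snd c (cylinder_tangent c p u))) (at ?z)"
    by (rule bounded_linear.has_derivative[OF smooth_on_chart_inv_cylinder(2)[OF cM(1)] D])
  then have "((\<lambda>y. y) has_derivative (\<lambda>u. snd c (cylinder_tangent c p u))) (at ?z)"
    by (rule has_derivative_transform_within_open[OF _ S]) (use M cM in auto)
  from has_derivative_unique[OF this has_derivative_ident]
  show chart: "snd c (cylinder_tangent c p u) = u" for u by (rule fun_cong)
  have "((\<lambda>y. snd (chart_inv c y) \<bullet> snd (chart_inv c y)) has_derivative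
      (\<lambda>u. snd (chart_inv c ?z) \<bullet> snd (cylinder_tangent c p u) + snd (cylinder_tangent c p u) \<bullet> snd (chart_inv c ?z))) (at ?z)"
    by (intro has_derivative_inner has_derivative_snd D)
  then have "((\<lambda>y. 1::real) has_derivative
      (\<lambda>u. snd (chart_inv c ?z) \<bullet> snd (cylinder_tangent c p u) + snd (cylinder_tangent c p u) \<bullet> snd (chart_inv c ?z))) (at ?z)"
  proof (rule has_derivative_transform_within_open[OF _ S])
    fix y assume "y \<in> ?S"
    then have "chart_inv c y \<in> fst c" by (rule inv_into_into)
    then have "chart_inv c y \<in> UNIV \<times> sphere 0 1" using chart_subset[OF M cM(1)] by auto
    then show "snd (chart_inv c y) \<bullet> snd (chart_inv c y) = 1" by (auto simp: norm_eq_1)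
  qed
  from fun_cong[OF has_derivative_unique[OF this has_derivative_const]]
  show orth: "snd (cylinder_tangent c p u) \<bullet> snd p = 0" for u
    by (simp add: iz inner_commute)
  show "cylinder_tangent c p (snd c (a, w)) = (a, w)" if w: "w \<bullet> snd p = 0"
  proof -
    obtain i \<sigma> where \<sigma>: "\<sigma> = -1 \<or> \<sigma> = 1" and ci: "c = (cylinder_dom i \<sigma>, cylinder_chart i)"
      using cM(1) by (rule atlas_cylinderE)
    obtain a' w' where J: "cylinder_tangent c p (snd c (a, w)) = (a', w')" by force
    have "cylinder_chart i (a', w') = cylinder_chart i (a, w)"
      using chart[of "snd c (a, w)"] unfolding J by (simp add: ci)
    then have "\<forall>j. (if j = i then a' else w' $ j) = (if j = i then a else w $ j)"
      by (simp add: cylinder_chart_def vec_eq_iff)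
    then have a: "a' = a" and wj: "\<And>j. j \<noteq> i \<Longrightarrow> w' $ j = w $ j" by (auto split: if_splits)
    \<comment> \<open>The chart forgets component i of w; orthogonality to the sphere point recovers
      it, because that point has a nonzero component i on the chart domain.\<close>
    have "snd p $ i \<noteq> 0" using cM(2) by (cases p) (auto simp: ci mem_cylinder_dom)
    moreover have "(w' - w) \<bullet> snd p = 0"
      using w orth[of "snd c (a, w)"] unfolding J by (simp add: inner_diff_left)
    then have "(w' - w) $ i * snd p $ i = 0"
      using inner_vec_split[of "w' - w" "snd p" i] wj by simp
    ultimately have "w' $ i = w $ i" by simp
    then have "w' = w" using wj by (metis vec_eq_iff)
    then show ?thesis using J a by simp
  qed
qed

lemma fderiv_cylinder:
  fixes G :: "real \<times> (real^'n::finite) \<Rightarrow> 'e::euclidean_space"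
  assumes c: "c \<in> charts_at cylinder p" and W: "openin (mtop cylinder) W" "p \<in> W"
    and G: "smooth_on G A" "p \<in> A" and eq: "\<And>q. q \<in> W \<Longrightarrow> g q = G q"
  shows "fderiv (g \<circ> chart_inv c) (snd c p) u = fderiv G p (cylinder_tangent c p u)"
proof -
  have M: "smooth_manifold (cylinder :: (real \<times> (real^'n), real^'n) manifold)"
    by (rule smooth_manifold_cylinder)
  have cM: "c \<in> atlas cylinder" "p \<in> fst c" using c by auto
  let ?z = "snd c p" and ?S = "snd c ` (fst c \<inter> W)"
  have S: "open ?S" "?z \<in> ?S" using open_chart_image[OF M cM(1) W(1)] cM W by auto
  have D: "(chart_inv c has_derivative cylinder_tangent c p) (at ?z)"
    by (rule smooth_on_has_derivative[OF smooth_on_chart_inv_cylinder(1)[OF cM(1)]]) (use cM in auto)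
  have iz: "chart_inv c ?z = p" using M cM by simp
  have "((\<lambda>y. G (chart_inv c y)) has_derivative (\<lambda>u. fderiv G p (cylinder_tangent c p u))) (at ?z)"
    by (rule has_derivative_compose[OF D]) (use smooth_on_has_derivative[OF G] iz in simp)
  then have "((g \<circ> chart_inv c) has_derivative (\<lambda>u. fderiv G p (cylinder_tangent c p u))) (at ?z)"
    by (rule has_derivative_transform_within_open[OF _ S]) (use M cM eq in auto)
  then show ?thesis by (simp add: frechet_derivative_eqI)
qed

lemma smooth_map_cylinderI:
  fixes H :: "real \<times> (real^'n::finite) \<Rightarrow> real \<times> (real^'n)"
  assumes H: "smooth_on H A" and A: "UNIV \<times> sphere 0 1 \<subseteq> A"
    and maps: "\<And>p. p \<in> UNIV \<times> sphere 0 1 \<Longrightarrow> \<Phi> p = H p \<and> H p \<in> UNIV \<times> sphere 0 1"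
  shows "smooth_map cylinder cylinder \<Phi>"
proof -
  have M: "smooth_manifold (cylinder :: (real \<times> (real^'n), real^'n) manifold)"
    by (rule smooth_manifold_cylinder)
  have "continuous_on (UNIV \<times> sphere 0 1) H"
    by (rule continuous_on_subset[OF smooth_on_imp_continuous_on[OF H] A])
  then have "continuous_on (UNIV \<times> sphere 0 1) \<Phi>"
    by (rule continuous_on_eq) (use maps in simp)
  then have cont: "continuous_map (mtop cylinder) (mtop cylinder) \<Phi>"
    using maps by (auto simp: mtop_cylinder)
  have "smooth_on (snd d \<circ> \<Phi> \<circ> chart_inv c) (snd c ` {p \<in> fst c. \<Phi> p \<in> fst d})"
    if c: "c \<in> atlas cylinder" and d: "d \<in> atlas cylinder"
    for c d :: "(real \<times> (real^'n), real^'n) chart"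
  proof -
    let ?W = "{p \<in> points cylinder. \<Phi> p \<in> fst d}"
    have W: "openin (mtop cylinder) ?W"
      by (rule openin_continuous_map_preimage[OF cont smooth_manifoldD(4)[OF M d]])
    have "{p \<in> fst c. \<Phi> p \<in> fst d} = fst c \<inter> ?W" using chart_subset[OF M c] by auto
    moreover have op: "open (snd c ` (fst c \<inter> ?W))" by (rule open_chart_image[OF M c W])
    moreover have "smooth_on (\<lambda>z. H (chart_inv c z)) (snd c ` (fst c \<inter> ?W))"
      by (rule smooth_on_compose[OF op H smooth_on_mono[OF smooth_on_chart_inv_cylinder(1)[OF c]]])
        (use M c A in auto)
    then have "smooth_on (\<lambda>z. snd d (H (chart_inv c z))) (snd c ` (fst c \<inter> ?W))"
      by (rule smooth_on_linear_compose[OF op smooth_on_chart_inv_cylinder(2)[OF d]])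
    then have "smooth_on (snd d \<circ> \<Phi> \<circ> chart_inv c) (snd c ` (fst c \<inter> ?W))"
      by (rule smooth_on_cong[OF op]) (use M c maps in auto)
    ultimately show ?thesis by simp
  qed
  then show ?thesis unfolding smooth_map_def using cont by (simp add: case_prod_beta)
qed

section \<open>Curves\<close>

abbreviation vderiv where "vderiv f s \<equiv> vector_derivative f (at s)"

lemma smooth_curve_has_vector_derivative:
  "smooth_on f UNIV \<Longrightarrow> (f has_vector_derivative vderiv f s) (at s)" for f :: "real \<Rightarrow> 'e::real_normed_vector"
  using smooth_on_imp_differentiable vector_derivative_works by blast

lemma smooth_on_vector_derivative:
  fixes f :: "real \<Rightarrow> 'e::real_normed_vector"
  assumes "smooth_on f UNIV"
  shows "smooth_on (\<lambda>s. vderiv f s) UNIV"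
proof -
  have "fderiv f s 1 = vderiv f s" for s
    using frechet_derivative_eq_vector_derivative[OF smooth_on_imp_differentiable[OF assms], of s] by simp
  then show ?thesis using smooth_on_frechet_derivative[OF assms, of 1] by simp
qed

lemma vderiv_inner_constant:
  fixes f g :: "real \<Rightarrow> 'e::real_inner"
  assumes f: "smooth_on f UNIV" and g: "smooth_on g UNIV" and k: "\<And>s. f s \<bullet> g s = k"
  shows "vderiv f s \<bullet> g s = - (f s \<bullet> vderiv g s)"
proof -
  have "((\<lambda>s. f s \<bullet> g s) has_derivative
      (\<lambda>h. f s \<bullet> (h *\<^sub>R vderiv g s) + (h *\<^sub>R vderiv f s) \<bullet> g s)) (at s)"
    using smooth_curve_has_vector_derivative[OF f, of s] smooth_curve_has_vector_derivative[OF g, of s]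
    unfolding has_vector_derivative_def by (rule has_derivative_inner)
  then have "((\<lambda>s. k) has_derivative (\<lambda>h. f s \<bullet> (h *\<^sub>R vderiv g s) + (h *\<^sub>R vderiv f s) \<bullet> g s)) (at s)"
    by (simp only: k)
  from fun_cong[OF has_derivative_unique[OF this has_derivative_const], of 1] show ?thesis by simp
qed

text \<open>Signed arc length from 0. It exhibits the distance in \<open>complete_curve\<close> as
  the absolute value pulled back along an increasing function.\<close>

lemma arc_length_primitive:
  fixes w :: "real \<Rightarrow> real"
  assumes w: "continuous_on UNIV w" and pos: "\<And>t. 0 < w t"
  obtains L where "\<And>a b. integral {min a b..max a b} w = \<bar>L b - L a\<bar>" "strict_mono L" "continuous_on UNIV L"
    and "\<And>a b. a \<le> b \<Longrightarrow> L b - L a = integral {a..b} w"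
proof -
  \<comment> \<open>At least one of the two integrals is over an empty or degenerate interval; the
    difference is the oriented integral from 0 to x.\<close>
  define L where "L x = integral {0..x} w - integral {x..0} w" for x
  have int: "w integrable_on {a..b}" for a b
    by (rule integrable_continuous_interval[OF continuous_on_subset[OF w]]) simp
  have L: "L b - L a = integral {a..b} w" if ab: "a \<le> b" for a b
  proof -
    consider "0 \<le> a" | "a < 0" "0 \<le> b" | "b < 0" by linarith
    then show ?thesis
    proof cases
      case 1
      then show ?thesis
        using Henstock_Kurzweil_Integration.integral_combine[of 0 a b w] ab int
        by (cases "a = 0"; cases "b = 0") (auto simp: L_def)
    next
      case 2
      then show ?thesis
        using Henstock_Kurzweil_Integration.integral_combine[of a 0 b w] int
        by (cases "b = 0") (auto simp: L_def)
    next
      case 3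
      then show ?thesis
        using Henstock_Kurzweil_Integration.integral_combine[of a b 0 w] ab int by (auto simp: L_def)
    qed
  qed
  have D: "(L has_real_derivative w x) (at x)" for x
  proof -
    have "((\<lambda>u. integral {x - 1..u} w) has_vector_derivative w x) (at x within {x - 1..x + 1})"
      by (rule integral_has_vector_derivative[OF continuous_on_subset[OF w]]) auto
    then have "((\<lambda>u. integral {x - 1..u} w) has_vector_derivative w x) (at x)"
      by (simp add: at_within_Icc_at)
    then have "((\<lambda>u. L (x - 1) + integral {x - 1..u} w) has_real_derivative w x) (at x)"
      unfolding has_real_derivative_iff_has_vector_derivative by (auto intro!: derivative_eq_intros)
    then show ?thesis
    proof (rule has_field_derivative_transform_within_open[of _ _ _ "{x - 1<..}"])
      fix y assume "y \<in> {x - 1<..}"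
      then show "L (x - 1) + integral {x - 1..y} w = L y" using L[of "x - 1" y] by simp
    qed auto
  qed
  have sm: "strict_mono L"
  proof (rule strict_monoI)
    fix a b :: real assume "a < b"
    then show "L a < L b" by (rule DERIV_pos_imp_increasing) (use D pos in blast)
  qed
  have "continuous_on UNIV L"
    using DERIV_isCont[OF D] by (simp add: continuous_at_imp_continuous_on)
  moreover have "integral {min a b..max a b} w = \<bar>L b - L a\<bar>" for a b
    using L[of a b] L[of b a] strict_mono_less_eq[OF sm, of a b] strict_mono_less_eq[OF sm, of b a]
    by (cases "a \<le> b") auto
  ultimately show thesis using that sm L by blast
qed

lemma Metric_space_strict_mono:
  fixes L :: "real \<Rightarrow> real"
  assumes "strict_mono L"
  shows "Metric_space UNIV (\<lambda>a b. \<bar>L b - L a\<bar>)"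
proof
  show "\<bar>L y - L x\<bar> = 0 \<longleftrightarrow> x = y" for x y
    using strict_mono_eq[OF assms, of y x] by auto
qed auto

text \<open>A Cauchy sequence for the larger distance is one for the smaller, so it converges there.
  Monotonicity of L turns this into convergence in the usual topology of the line, and continuity of
  K into convergence for the larger distance.\<close>

lemma complete_curve_mono:
  fixes \<gamma> \<delta> :: "real \<Rightarrow> 'e::euclidean_space"
  assumes \<gamma>: "regular_curve \<gamma>" "complete_curve \<gamma>" and \<delta>: "regular_curve \<delta>"
    and le: "\<And>s. norm (vderiv \<gamma> s) \<le> norm (vderiv \<delta> s)"
  shows "complete_curve \<delta>"
proof -
  have cont: "continuous_on UNIV (\<lambda>t. norm (vderiv \<beta> t))" if "regular_curve \<beta>" for \<beta> :: "real \<Rightarrow> 'e"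
    using smooth_on_imp_continuous_on[OF smooth_on_vector_derivative] that
    by (auto simp: regular_curve_def intro!: continuous_intros)
  have pos: "0 < norm (vderiv \<beta> t)" if "regular_curve \<beta>" for \<beta> :: "real \<Rightarrow> 'e" and t
    using that by (auto simp: regular_curve_def)
  obtain L where L: "\<And>a b. integral {min a b..max a b} (\<lambda>t. norm (vderiv \<gamma> t)) = \<bar>L b - L a\<bar>"
    "strict_mono L" "continuous_on UNIV L"
    "\<And>a b. a \<le> b \<Longrightarrow> L b - L a = integral {a..b} (\<lambda>t. norm (vderiv \<gamma> t))"
    by (rule arc_length_primitive[OF cont[OF \<gamma>(1)] pos[OF \<gamma>(1)]]) blast
  obtain K where K: "\<And>a b. integral {min a b..max a b} (\<lambda>t. norm (vderiv \<delta> t)) = \<bar>K b - K a\<bar>"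
    "strict_mono K" "continuous_on UNIV K"
    "\<And>a b. a \<le> b \<Longrightarrow> K b - K a = integral {a..b} (\<lambda>t. norm (vderiv \<delta> t))"
    by (rule arc_length_primitive[OF cont[OF \<delta>] pos[OF \<delta>]]) blast
  interpret ArcL: Metric_space UNIV "\<lambda>a b. \<bar>L b - L a\<bar>" by (rule Metric_space_strict_mono[OF L(2)])
  interpret ArcK: Metric_space UNIV "\<lambda>a b. \<bar>K b - K a\<bar>" by (rule Metric_space_strict_mono[OF K(2)])
  have LK: "\<bar>L b - L a\<bar> \<le> \<bar>K b - K a\<bar>" for a b
  proof -
    have "L b - L a \<le> K b - K a \<and> 0 \<le> L b - L a" if "a \<le> b" for a b
    proof
      show "L b - L a \<le> K b - K a"
        unfolding L(4)[OF that] K(4)[OF that]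
        by (intro integral_le integrable_continuous_interval continuous_on_subset[OF cont[OF \<gamma>(1)]]
            continuous_on_subset[OF cont[OF \<delta>]] le) auto
      show "0 \<le> L b - L a" using that strict_mono_less_eq[OF L(2), of a b] by simp
    qed
    from this[of a b] this[of b a] show ?thesis by linarith
  qed
  have complL: "ArcL.mcomplete" using \<gamma>(2) unfolding complete_curve_def L(1) .
  have "ArcK.mcomplete"
    unfolding ArcK.mcomplete_def
  proof (intro allI impI)
    fix \<sigma> assume "ArcK.MCauchy \<sigma>"
    then have "ArcL.MCauchy \<sigma>"
      unfolding ArcK.MCauchy_def ArcL.MCauchy_def using LK by (meson order.strict_trans1)
    then obtain x where "limitin ArcL.mtopology \<sigma> x sequentially"
      using complL unfolding ArcL.mcomplete_def by blast
    then have limL: "(\<lambda>n. L (\<sigma> n)) \<longlonglongrightarrow> L x"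
      unfolding ArcL.limit_metric_sequentially LIMSEQ_def dist_real_def by (simp add: abs_minus_commute)
    have "\<sigma> \<longlonglongrightarrow> x"
    proof (rule order_tendstoI)
      fix a assume "a < x"
      then have "L a < L x" using L(2) by (simp add: strict_mono_less)
      from order_tendstoD(1)[OF limL this] show "\<forall>\<^sub>F n in sequentially. a < \<sigma> n"
        by (simp add: strict_mono_less[OF L(2)])
    next
      fix a assume "x < a"
      then have "L x < L a" using L(2) by (simp add: strict_mono_less)
      from order_tendstoD(2)[OF limL this] show "\<forall>\<^sub>F n in sequentially. \<sigma> n < a"
        by (simp add: strict_mono_less[OF L(2)])
    qed
    moreover have "isCont K x" using K(3) by (simp add: continuous_on_eq_continuous_at)
    ultimately have "(\<lambda>n. K (\<sigma> n)) \<longlonglongrightarrow> K x" by (metis isCont_tendsto_compose)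
    then show "\<exists>x. limitin ArcK.mtopology \<sigma> x sequentially"
      unfolding ArcK.limit_metric_sequentially LIMSEQ_def dist_real_def
      by (intro exI[of _ x]) (simp add: abs_minus_commute)
  qed
  then show ?thesis unfolding complete_curve_def K(1) .
qed

section \<open>Orthonormal frames and orthogonal complements\<close>

lemma orthonormal_independent:
  fixes e :: "'n::finite \<Rightarrow> 'e::euclidean_space"
  assumes orth: "\<And>i j. e i \<bullet> e j = (if i = j then 1 else 0)"
  shows "dim (span (range e)) = CARD('n)"
proof -
  have "inj e"
  proof (rule injI)
    fix i j assume "e i = e j"
    then show "i = j" using orth[of i i] orth[of i j] by (metis zero_neq_one)
  qed
  have "pairwise orthogonal (range e)"
    by (auto simp: pairwise_def orthogonal_def orth)
  moreover have "0 \<notin> range e"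
  proof
    assume "0 \<in> range e"
    then obtain i where "e i = 0" by auto
    then show False using orth[of i i] by simp
  qed
  ultimately have "independent (range e)" by (rule pairwise_orthogonal_independent)
  then have "dim (span (range e)) = card (range e)" by (rule dim_span_eq_card_independent)
  then show ?thesis using card_image[OF \<open>inj e\<close>] by simp
qed

lemma orthonormal_expansion:
  fixes e :: "'n::finite \<Rightarrow> 'e::euclidean_space"
  assumes orth: "\<And>i j. e i \<bullet> e j = (if i = j then 1 else 0)" and w: "w \<in> span (range e)"
  shows "w = (\<Sum>i\<in>UNIV. (w \<bullet> e i) *\<^sub>R e i)"
proof -
  let ?u = "w - (\<Sum>i\<in>UNIV. (w \<bullet> e i) *\<^sub>R e i)"
  have "?u \<in> span (range e)"
    by (intro span_diff w span_sum span_scale span_base) auto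
  moreover have "?u \<bullet> e j = 0" for j
    by (simp add: inner_diff_left inner_sum_left orth if_distrib cong: if_cong)
  then have "orthogonal ?u s" if "s \<in> span (range e)" for s
    by - (rule orthogonal_to_span[OF that], auto simp: orthogonal_def)
  ultimately have "?u \<bullet> ?u = 0" unfolding orthogonal_def by blast
  then show ?thesis by simp
qed

lemma mem_orthogonal_comp_pair:
  "w \<in> orthogonal_comp (span {a, b}) \<longleftrightarrow> w \<bullet> a = 0 \<and> w \<bullet> b = 0"
proof
  assume "w \<in> orthogonal_comp (span {a, b})"
  then show "w \<bullet> a = 0 \<and> w \<bullet> b = 0"
    by (auto simp: orthogonal_comp_def orthogonal_def inner_commute span_base)
next
  assume w: "w \<bullet> a = 0 \<and> w \<bullet> b = 0"
  have "orthogonal w y" if "y \<in> span {a, b}" for y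
    by (rule orthogonal_to_span[OF that]) (use w in \<open>auto simp: orthogonal_def\<close>)
  then show "w \<in> orthogonal_comp (span {a, b})"
    by (auto simp: orthogonal_comp_def orthogonal_commute)
qed

section \<open>Developable tubes\<close>

locale framed_curve =
  fixes \<gamma> :: "real \<Rightarrow> 'e::euclidean_space" and e :: "'n::finite \<Rightarrow> real \<Rightarrow> 'e"
  assumes reg: "regular_curve \<gamma>"
    and smooth_e: "\<And>i. smooth_on (e i) UNIV"
    and orth: "\<And>s i j. e i s \<bullet> e j s = (if i = j then 1 else 0)"
    and spn: "\<And>s. span (range (\<lambda>i. e i s)) = orthogonal_comp (span {\<gamma> s, vderiv \<gamma> s})"
begin

definition T where "T = unit_tangent \<gamma>"
definition v where "v s = norm (vderiv \<gamma> s)"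

lemma smooth_gamma: "smooth_on \<gamma> UNIV" and v_pos: "0 < v s" and gamma_gamma: "\<gamma> s \<bullet> \<gamma> s = 1"
  using reg by (auto simp: regular_curve_def v_def norm_eq_1)

lemma gamma': "vderiv \<gamma> s = v s *\<^sub>R T s"
  using v_pos[of s] by (simp add: T_def unit_tangent_def v_def)

lemma smooth_v: "smooth_on v UNIV"
  unfolding v_def[abs_def] using v_pos
  by (intro smooth_on_norm smooth_on_vector_derivative smooth_gamma) (auto simp: v_def)

lemma smooth_T: "smooth_on T UNIV"
proof -
  have "smooth_on (\<lambda>s. inverse (v s) *\<^sub>R vderiv \<gamma> s) UNIV"
    by (intro smooth_intros smooth_v smooth_on_vector_derivative smooth_gamma less_imp_neq[OF v_pos, symmetric])
      auto
  then show ?thesis by (simp add: T_def unit_tangent_def[abs_def] v_def)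
qed

lemma T_T: "T s \<bullet> T s = 1"
  using v_pos[of s] by (simp add: T_def unit_tangent_def v_def power2_norm_eq_inner[symmetric] power2_eq_square)

lemma gamma_T: "\<gamma> s \<bullet> T s = 0" "T s \<bullet> \<gamma> s = 0"
proof -
  show "\<gamma> s \<bullet> T s = 0"
    using vderiv_inner_constant[OF smooth_gamma smooth_gamma gamma_gamma, of s] v_pos[of s]
    by (simp add: gamma' inner_commute)
  then show "T s \<bullet> \<gamma> s = 0" by (simp add: inner_commute)
qed

lemma T'_T: "vderiv T s \<bullet> T s = 0" "T s \<bullet> vderiv T s = 0"
  using vderiv_inner_constant[OF smooth_T smooth_T T_T, of s] by (auto simp: inner_commute)

lemma gamma_T': "\<gamma> s \<bullet> vderiv T s = - v s" "vderiv T s \<bullet> \<gamma> s = - v s"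
  using vderiv_inner_constant[OF smooth_gamma smooth_T gamma_T(1), of s]
  by (auto simp: gamma' T_T inner_commute)

lemma e_gamma: "e i s \<bullet> \<gamma> s = 0" and e_T: "e i s \<bullet> T s = 0"
proof -
  have "e i s \<in> orthogonal_comp (span {\<gamma> s, vderiv \<gamma> s})"
    unfolding spn[symmetric] by (rule span_base) simp
  then show "e i s \<bullet> \<gamma> s = 0" "e i s \<bullet> T s = 0"
    using v_pos[of s] by (auto simp: mem_orthogonal_comp_pair gamma')
qed

lemma expansion:
  assumes "w \<bullet> \<gamma> s = 0" "w \<bullet> T s = 0"
  shows "w = (\<Sum>i\<in>UNIV. (w \<bullet> e i s) *\<^sub>R e i s)"
proof -
  have "w \<in> span (range (\<lambda>i. e i s))"
    unfolding spn mem_orthogonal_comp_pair using assms by (simp add: gamma')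
  then show ?thesis by (rule orthonormal_expansion[OF orth])
qed

text \<open>The tube extended linearly in x to the whole ambient product, so that it can be
  differentiated there.\<close>

definition tube :: "real \<times> (real^'n) \<Rightarrow> 'e" where
  "tube p = (\<Sum>i\<in>UNIV. snd p $ i *\<^sub>R e i (fst p))"

lemma smooth_on_curve_fst:
  fixes \<beta> :: "real \<Rightarrow> 'b::euclidean_space"
  assumes "smooth_on \<beta> UNIV" "open A"
  shows "smooth_on (\<lambda>p. \<beta> (fst p)) (A :: (real \<times> (real^'n)) set)"
  by (rule smooth_on_compose[OF assms(2,1)]) (auto intro!: smooth_intros assms(2))

lemma smooth_tube: "open A \<Longrightarrow> smooth_on tube A"
  unfolding tube_def[abs_def] by (intro smooth_intros smooth_on_curve_fst smooth_e) auto

lemma tube_tube: "tube (s, x) \<bullet> tube (s, y) = x \<bullet> y"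
  and tube_e: "tube (s, x) \<bullet> e i s = x $ i"
  and tube_gamma: "tube (s, x) \<bullet> \<gamma> s = 0"
  and tube_T: "tube (s, x) \<bullet> T s = 0"
  by (simp_all add: tube_def inner_sum_left inner_sum_right orth if_distrib e_gamma e_T inner_vec_def
      mult.commute cong: if_cong)

lemma fderiv_curve_fst:
  fixes \<beta> :: "real \<Rightarrow> 'b::euclidean_space"
  assumes "smooth_on \<beta> UNIV"
  shows "((\<lambda>p :: real \<times> (real^'n). \<beta> (fst p)) has_derivative (\<lambda>h. fst h *\<^sub>R vderiv \<beta> (fst p))) (at p)"
proof (rule has_derivative_compose[where f=fst and g=\<beta>])
  show "(\<beta> has_derivative (\<lambda>x. x *\<^sub>R vderiv \<beta> (fst p))) (at (fst p))"
    using smooth_curve_has_vector_derivative[OF assms] by (simp add: has_vector_derivative_def)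
qed (auto intro!: derivative_eq_intros)

lemma fderiv_tube:
  "fderiv tube (s, x) (a, w) = a *\<^sub>R (\<Sum>i\<in>UNIV. x $ i *\<^sub>R vderiv (e i) s) + (\<Sum>i\<in>UNIV. w $ i *\<^sub>R e i s)"
proof -
  have "((\<lambda>p :: real \<times> (real^'n). snd p $ i) has_derivative (\<lambda>h. snd h $ i)) (at p)" for i p
    by (intro bounded_linear.has_derivative[OF bounded_linear_vec_nth] has_derivative_snd has_derivative_ident)
  from has_derivative_sum[OF has_derivative_scaleR[OF this fderiv_curve_fst[OF smooth_e]]]
  have "(tube has_derivative (\<lambda>h. \<Sum>i\<in>UNIV. snd (s, x) $ i *\<^sub>R (fst h *\<^sub>R vderiv (e i) (fst (s, x)))
      + snd h $ i *\<^sub>R e i (fst (s, x)))) (at (s, x))"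
    unfolding tube_def[abs_def] .
  from frechet_derivative_eqI[OF this] show ?thesis
    by (simp add: sum.distrib scaleR_sum_right mult.commute)
qed

text \<open>The partial derivative of the tube in s.\<close>

definition tube_s :: "real \<Rightarrow> real^'n \<Rightarrow> 'e" where
  "tube_s s x = (\<Sum>i\<in>UNIV. x $ i *\<^sub>R vderiv (e i) s)"

lemma tube_s_gamma: "tube_s s x \<bullet> \<gamma> s = 0"
  and tube_s_T: "tube_s s x \<bullet> T s = - (tube (s, x) \<bullet> vderiv T s)"
  and tube_s_tube: "tube_s s x \<bullet> tube (s, x) = 0"
proof -
  have "vderiv (e i) s \<bullet> \<gamma> s = 0" for i
    using vderiv_inner_constant[OF smooth_e smooth_gamma e_gamma] by (simp add: gamma' e_T)
  then show "tube_s s x \<bullet> \<gamma> s = 0" by (simp add: tube_s_def inner_sum_left)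
  have "vderiv (e i) s \<bullet> T s = - (e i s \<bullet> vderiv T s)" for i
    by (rule vderiv_inner_constant[OF smooth_e smooth_T e_T])
  then show "tube_s s x \<bullet> T s = - (tube (s, x) \<bullet> vderiv T s)"
    by (simp add: tube_s_def tube_def inner_sum_left sum_negf)
  have sm: "smooth_on (\<lambda>s. tube (s, x)) UNIV"
    unfolding tube_def by (auto intro!: smooth_intros smooth_e)
  have "((\<lambda>s. tube (s, x)) has_vector_derivative tube_s s x) (at s)"
    unfolding tube_def tube_s_def fst_conv snd_conv
    by (intro has_vector_derivative_sum bounded_linear.has_vector_derivative[OF bounded_linear_scaleR_right]
        smooth_curve_has_vector_derivative[OF smooth_e])
  then have "vderiv (\<lambda>s. tube (s, x)) s = tube_s s x" by (rule vector_derivative_at)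
  then show "tube_s s x \<bullet> tube (s, x) = 0"
    using vderiv_inner_constant[OF sm sm tube_tube, of s] by (simp add: inner_commute)
qed

text \<open>The tangent vector over \<open>\<partial>\<^sub>s\<close> along which the tube moves in the direction of \<open>T\<close> only.\<close>

definition horizontal :: "real \<Rightarrow> real^'n \<Rightarrow> real \<times> (real^'n)" where
  "horizontal s x = (1, \<chi> i. - (tube_s s x \<bullet> e i s))"

lemma horizontal_tangent: "snd (horizontal s x) \<bullet> x = 0"
proof -
  have "snd (horizontal s x) \<bullet> x = - (tube_s s x \<bullet> tube (s, x))"
    by (simp add: horizontal_def inner_vec_def tube_def inner_sum_right sum_negf mult.commute)
  then show ?thesis by (simp add: tube_s_tube)
qed

lemma fderiv_tube_horizontal: "fderiv tube (s, x) (horizontal s x) = - (tube (s, x) \<bullet> vderiv T s) *\<^sub>R T s"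
proof -
  \<comment> \<open>Without its component along T, the derivative in s is a combination of the
    frame. The second component of \<open>horizontal\<close> is chosen to cancel precisely this
    combination.\<close>
  let ?u = "tube_s s x - (tube_s s x \<bullet> T s) *\<^sub>R T s"
  have "?u = (\<Sum>i\<in>UNIV. (?u \<bullet> e i s) *\<^sub>R e i s)"
    by (rule expansion) (simp_all add: inner_diff_left tube_s_gamma gamma_T T_T)
  also have "\<dots> = (\<Sum>i\<in>UNIV. (tube_s s x \<bullet> e i s) *\<^sub>R e i s)"
    by (simp add: inner_diff_left inner_commute[of "T s"] e_T)
  finally have "tube_s s x - (\<Sum>i\<in>UNIV. (tube_s s x \<bullet> e i s) *\<^sub>R e i s) = (tube_s s x \<bullet> T s) *\<^sub>R T s"
    by (simp add: algebra_simps)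
  then show ?thesis
    by (simp add: horizontal_def fderiv_tube tube_s_def[symmetric] sum_negf tube_s_T)
qed

end

context framed_curve
begin

section \<open>The tube as a front on the cylinder\<close>

lemma tube_add: "tube (s, x + y) = tube (s, x) + tube (s, y)"
  and tube_scaleR: "tube (s, r *\<^sub>R x) = r *\<^sub>R tube (s, x)"
  by (simp_all add: tube_def sum.distrib scaleR_add_left scaleR_sum_right)

lemma tube_axis: "tube (s, axis i 1) = e i s"
  by (simp add: tube_def axis_def if_distrib if_distribR cong: if_cong)

lemma fderiv_tube': "fderiv tube (s, x) (a, w) = a *\<^sub>R tube_s s x + tube (s, w)"
  by (simp add: fderiv_tube tube_s_def tube_def)

lemma fderiv_tube_gamma: "fderiv tube p h \<bullet> \<gamma> (fst p) = 0"
  by (cases p; cases h) (simp add: fderiv_tube' inner_add_left tube_s_gamma tube_gamma)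

abbreviation gamma_fst :: "real \<times> (real^'n) \<Rightarrow> 'e" where "gamma_fst p \<equiv> \<gamma> (fst p)"

lemma smooth_fun_tube:
  assumes ft: "\<forall>p\<in>points cylinder. f p = tube p" and W: "openin (mtop cylinder) W"
  shows "smooth_fun_on cylinder W f"
  by (rule smooth_fun_on_cylinderI[OF W subset_UNIV smooth_tube[OF open_UNIV]])
    (use ft openin_subset[OF W] in blast)

lemma fderiv_f:
  assumes ft: "\<forall>p\<in>points cylinder. f p = tube p" and c: "c \<in> charts_at cylinder p"
  shows "fderiv (f \<circ> chart_inv c) (snd c p) u = fderiv tube p (cylinder_tangent c p u)"
proof (rule fderiv_cylinder[OF c openin_points[OF smooth_manifold_cylinder] _ smooth_tube[OF open_UNIV] UNIV_I])
  show "f q = tube q" if "q \<in> points cylinder" for q using ft that by blast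
  have "c \<in> atlas cylinder" "p \<in> fst c" using c by auto
  then show "p \<in> points cylinder" using chart_subset[OF smooth_manifold_cylinder] by blast
qed

lemma fderiv_gamma_fst:
  assumes c: "c \<in> charts_at cylinder p"
  shows "fderiv (gamma_fst \<circ> chart_inv c) (snd c p) u = fst (cylinder_tangent c p u) *\<^sub>R vderiv \<gamma> (fst p)"
proof -
  have "p \<in> points cylinder"
    using c chart_subset[OF smooth_manifold_cylinder, of c] by blast
  then have "fderiv (gamma_fst \<circ> chart_inv c) (snd c p) u = fderiv gamma_fst p (cylinder_tangent c p u)"
    by (intro fderiv_cylinder[OF c openin_points[OF smooth_manifold_cylinder] _
          smooth_on_curve_fst[OF smooth_gamma open_UNIV]]) auto
  then show ?thesis
    by (simp only: frechet_derivative_eqI[OF fderiv_curve_fst[OF smooth_gamma]])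
qed

lemma local_unit_normal_gamma:
  assumes ft: "\<forall>p\<in>points cylinder. f p = tube p" and W: "openin (mtop cylinder) W"
    and E: "\<And>q. q \<in> W \<Longrightarrow> E q = {w. w \<bullet> f q = 0 \<and> w \<bullet> \<gamma> (fst q) = 0}"
  shows "local_unit_normal cylinder f E W gamma_fst"
  unfolding local_unit_normal_def
proof (intro conjI ballI W E)
  show "smooth_fun_on cylinder W gamma_fst"
    by (rule smooth_fun_on_cylinderI[OF W subset_UNIV smooth_on_curve_fst[OF smooth_gamma open_UNIV]]) simp
  fix q assume q: "q \<in> W"
  then have qM: "q \<in> points cylinder" using openin_subset[OF W] by blast
  show "\<gamma> (fst q) \<in> sphere 0 1" by (simp add: norm_eq_1 gamma_gamma)
  show "f q \<bullet> \<gamma> (fst q) = 0" unfolding bspec[OF ft qM] by (cases q) (simp add: tube_gamma)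
  obtain c where c: "c \<in> charts_at cylinder q"
    using exists_chart[OF smooth_manifold_cylinder qM] .
  fix v assume v: "v \<in> tangent_space cylinder q"
  have "differential cylinder f q v = fderiv tube q (cylinder_tangent c q (v c))"
    by (rule trans[OF differential_eq[OF smooth_manifold_cylinder c W q smooth_fun_tube[OF ft W] v]
          fderiv_f[OF ft c]])
  then show "differential cylinder f q v \<bullet> \<gamma> (fst q) = 0" by (simp add: fderiv_tube_gamma)
qed

text \<open>On an ambient tangent vector (a, w) the normal \<gamma> has derivative a \<gamma>',
  whence rank at most one. If it vanishes then a = 0, and on the remaining w the tube is a linear
  isometry, so the tube with this normal is a front.\<close>

lemma tube_cc1_front:
  assumes ft: "\<forall>p\<in>points cylinder. f p = tube p"
  shows "\<exists>E. cc1_front cylinder f E \<and> \<not> totally_geodesic cylinder f E"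
proof -
  define E where "E q = {w. w \<bullet> f q = 0 \<and> w \<bullet> \<gamma> (fst q) = 0}" for q
  let ?P = "points (cylinder :: (real \<times> (real^'n), real^'n) manifold)"
  note M = smooth_manifold_cylinder
  have op: "openin (mtop cylinder) ?P" by (rule openin_points[OF M])
  have lun: "local_unit_normal cylinder f E ?P gamma_fst"
    by (rule local_unit_normal_gamma[OF ft op]) (auto simp: E_def)
  have fr: "frontal cylinder f E"
    unfolding frontal_def
  proof (intro conjI M smooth_fun_tube[OF ft op])
    show "f ` ?P \<subseteq> sphere 0 1"
    proof
      fix y assume "y \<in> f ` ?P"
      then obtain s x where "y = f (s, x)" "(s, x) \<in> ?P" by auto
      then have "y \<bullet> y = 1" using bspec[OF ft, of "(s, x)"] tube_tube[of s x x] by (simp add: norm_eq_1)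
      then show "y \<in> sphere 0 1" by (simp add: norm_eq_1)
    qed
    show "\<forall>p\<in>?P. \<exists>U \<nu>. p \<in> U \<and> local_unit_normal cylinder f E U \<nu>" using lun by blast
  qed
  have "front cylinder f E"
  proof (rule frontI[OF fr])
    fix p assume p: "p \<in> ?P"
    obtain c where c: "c \<in> charts_at cylinder p" using exists_chart[OF M p] .
    have "u = 0" if u: "fderiv (f \<circ> chart_inv c) (snd c p) u = 0"
      "fderiv (gamma_fst \<circ> chart_inv c) (snd c p) u = 0" for u
    proof -
      obtain a w where J: "cylinder_tangent c p u = (a, w)" by force
      obtain s x where px: "p = (s, x)" by force
      have "a = 0"
        using u(2) v_pos[of s] unfolding fderiv_gamma_fst[OF c] J by (auto simp: v_def px)
      moreover have "fderiv tube p (a, w) = 0" using fderiv_f[OF ft c, of u] u(1) by (simp add: J)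
      ultimately have "tube (s, w) = 0" by (simp add: px fderiv_tube')
      then have "w \<bullet> w = 0" using tube_tube[of s w w] by simp
      then have "cylinder_tangent c p u = 0" using J \<open>a = 0\<close> by (simp add: zero_prod_def)
      moreover have "c \<in> atlas cylinder" using c by blast
      from linear_0[OF bounded_linear.linear[OF smooth_on_chart_inv_cylinder(2)[OF this]]]
      have "snd c 0 = 0" .
      ultimately show "u = 0" using chart_cylinder_tangent[OF c, of u] by simp
    qed
    then show "\<exists>U \<nu> c. p \<in> U \<and> local_unit_normal cylinder f E U \<nu> \<and> c \<in> charts_at cylinder p \<and>
      (\<forall>x. fderiv (f \<circ> chart_inv c) (snd c p) x = 0 \<longrightarrow> fderiv (\<nu> \<circ> chart_inv c) (snd c p) x = 0 \<longrightarrow> x = 0)"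
      using lun p c by blast
  qed
  moreover have "constant_curvature_one cylinder f E"
  proof (rule constant_curvature_oneI[OF fr])
    fix p assume p: "p \<in> ?P"
    obtain c where c: "c \<in> charts_at cylinder p" using exists_chart[OF M p] .
    have "rank_le_one (fderiv (gamma_fst \<circ> chart_inv c) (snd c p))"
      unfolding rank_le_one_def fderiv_gamma_fst[OF c] by simp
    then show "\<exists>U \<nu> c. p \<in> U \<and> local_unit_normal cylinder f E U \<nu> \<and> c \<in> charts_at cylinder p \<and>
      rank_le_one (fderiv (\<nu> \<circ> chart_inv c) (snd c p))" using lun p c by blast
  qed
  moreover have "\<not> totally_geodesic cylinder f E"
  proof
    assume tg: "totally_geodesic cylinder f E"
    define p :: "real \<times> (real^'n)" where "p = (0, axis undefined 1)"
    have p: "p \<in> ?P" by (simp add: p_def)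
    obtain c where c: "c \<in> charts_at cylinder p" using exists_chart[OF M p] .
    let ?u = "coord_tangent cylinder p c (snd c (1, 0))"
    have T: "?u \<in> tangent_space cylinder p" by (rule coord_tangent_in_tangent_space[OF M c])
    have J: "cylinder_tangent c p (snd c (1, 0)) = (1, 0)" by (rule cylinder_tangent_chart[OF c]) simp
    have "differential cylinder gamma_fst p ?u = 0"
      using tg lun p T unfolding totally_geodesic_def by blast
    moreover have "differential cylinder gamma_fst p ?u = fst (cylinder_tangent c p (?u c)) *\<^sub>R vderiv \<gamma> (fst p)"
      by (rule trans[OF differential_eq[OF M c op p local_unit_normalD(2)[OF lun] T] fderiv_gamma_fst[OF c]])
    ultimately have "vderiv \<gamma> (fst p) = 0" by (simp add: coord_tangent_same[OF M c] J)
    then show False using v_pos[of "fst p"] by (simp add: v_def)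
  qed
  ultimately show ?thesis unfolding cc1_front_def by blast
qed

section \<open>The caustic of a tube\<close>

definition offset :: "real \<times> (real^'n) \<Rightarrow> real" where
  "offset p = (tube p \<bullet> vderiv T (fst p)) / v (fst p)"

text \<open>The caustic before normalisation. Since \<gamma> \<bullet> T' = - |\<gamma>'|, the
  coefficient \<open>offset\<close> is the one that makes the sum orthogonal to T'.\<close>

definition focal :: "real \<times> (real^'n) \<Rightarrow> 'e" where
  "focal p = tube p + offset p *\<^sub>R \<gamma> (fst p)"

lemma local_unit_normal_orthogonal:
  assumes ft: "\<forall>p\<in>points cylinder. f p = tube p" and U: "local_unit_normal cylinder f E U \<nu>"
    and q: "(s, x) \<in> U" and w: "w \<bullet> x = 0"
  shows "fderiv tube (s, x) (a, w) \<bullet> \<nu> (s, x) = 0"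
proof -
  note M = smooth_manifold_cylinder
  note U' = local_unit_normalD[OF U]
  obtain c where c: "c \<in> charts_at cylinder (s, x)" using exists_chart[OF M U'(7)[OF q]] .
  let ?u = "coord_tangent cylinder (s, x) c (snd c (a, w))"
  have T: "?u \<in> tangent_space cylinder (s, x)" by (rule coord_tangent_in_tangent_space[OF M c])
  have J: "cylinder_tangent c (s, x) (snd c (a, w)) = (a, w)"
    by (rule cylinder_tangent_chart[OF c]) (simp add: w)
  have "differential cylinder f (s, x) ?u = fderiv tube (s, x) (cylinder_tangent c (s, x) (?u c))"
    by (rule trans[OF differential_eq[OF M c U'(1) q smooth_fun_tube[OF ft U'(1)] T] fderiv_f[OF ft c]])
  then have "differential cylinder f (s, x) ?u = fderiv tube (s, x) (a, w)"
    by (simp only: coord_tangent_same[OF M c] J)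
  then show ?thesis using U'(5)[OF q T] by simp
qed

text \<open>Where the tube is an immersion its normal is \<open>\<gamma>\<close> up to sign; elsewhere the frontal may have
  other normals.\<close>

lemma local_unit_normal_parallel_gamma:
  assumes ft: "\<forall>p\<in>points cylinder. f p = tube p" and U: "local_unit_normal cylinder f E U \<nu>"
    and q: "q \<in> U" and nz: "tube q \<bullet> vderiv T (fst q) \<noteq> 0"
  shows "\<nu> q = (\<nu> q \<bullet> \<gamma> (fst q)) *\<^sub>R \<gamma> (fst q)"
proof -
  obtain s x where qx: "q = (s, x)" by force
  note U' = local_unit_normalD[OF U]
  have x: "x \<bullet> x = 1" using U'(7)[OF q] by (simp add: qx norm_eq_1)
  note orth_nu = local_unit_normal_orthogonal[OF ft U q[unfolded qx]]
  have tx: "tube (s, x) \<bullet> \<nu> q = 0" using U'(4)[OF q] bspec[OF ft U'(7)[OF q]] by (simp add: qx)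
  have "e i s \<bullet> \<nu> q = 0" for i
  proof -
    \<comment> \<open>The part of the axis vector that is tangent to the sphere at x. The removed
      multiple of x corresponds to a multiple of f, which is orthogonal to the normal
      anyway.\<close>
    let ?w = "axis i 1 - (axis i 1 \<bullet> x) *\<^sub>R x"
    have "?w \<bullet> x = 0" using x by (simp add: inner_diff_left)
    then have "tube (s, ?w) \<bullet> \<nu> q = 0" using orth_nu[of ?w 0] by (simp add: fderiv_tube' qx)
    moreover have "e i s = tube (s, ?w) + (axis i 1 \<bullet> x) *\<^sub>R tube (s, x)"
      by (simp add: tube_axis flip: tube_add tube_scaleR)
    ultimately show ?thesis using tx by (simp add: inner_add_left)
  qed
  moreover have "T s \<bullet> \<nu> q = 0"
    using orth_nu[OF horizontal_tangent, of 1 s] nz fderiv_tube_horizontal[of s x]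
    by (simp add: qx horizontal_def)
  ultimately have "\<nu> q - (\<nu> q \<bullet> \<gamma> s) *\<^sub>R \<gamma> s = 0"
    by (subst expansion[of "\<nu> q - (\<nu> q \<bullet> \<gamma> s) *\<^sub>R \<gamma> s" s])
      (simp_all add: inner_diff_left gamma_gamma gamma_T inner_commute[of "\<nu> q"] inner_commute[of "\<gamma> s" "e _ s"] e_gamma)
  then show ?thesis by (simp add: qx)
qed

lemma tube_caustic:
  assumes ft: "\<forall>p\<in>points cylinder. f p = tube p"
    and cc: "cc1_front cylinder f E" and dim: "DIM('e) = CARD('n) + 2" and n: "2 \<le> CARD('n)"
    and p: "p \<in> points cylinder"
  shows "p \<notin> umbilics cylinder f E"
    and "caustic cylinder f E p = (1 / sqrt (1 + (offset p)\<^sup>2)) *\<^sub>R focal p"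
proof -
  note M = smooth_manifold_cylinder
  have n': "2 \<le> DIM(real^'n)" and dim': "DIM('e) < DIM(real^'n) + 3" using n dim by simp_all
  obtain s x where px: "p = (s, x)" by force
  have fr: "frontal cylinder f E" by (rule cc1_frontD(2)[OF cc])
  obtain c where c: "c \<in> charts_at cylinder p" using exists_chart[OF M p] .
  then have cM: "c \<in> atlas cylinder" "p \<in> fst c" by auto
  have ip: "chart_inv c (snd c p) = p" using M cM by (rule chart_inv_chart)
  let ?u = "snd c (horizontal s x)"
  have J: "cylinder_tangent c p ?u = horizontal s x"
    using cylinder_tangent_chart[OF c, of "snd (horizontal s x)" "fst (horizontal s x)"]
    by (simp add: px horizontal_tangent)
  have dF: "fderiv (f \<circ> chart_inv c) (snd c p) ?u = - (tube p \<bullet> vderiv T s) *\<^sub>R T s"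
    using fderiv_f[OF ft c, of ?u] fderiv_tube_horizontal[of s x] unfolding J by (simp add: px)
  \<comment> \<open>The horizontal vector plays the part of \<open>x0\<close>. Only the product of
    \<open>offset\<close> with the normal has to be known: at a singular point this product is zero,
    whichever normal the frontal has there.\<close>
  have "\<exists>U \<nu>. p \<in> U \<and> local_unit_normal cylinder f E U \<nu> \<and> fderiv (\<nu> \<circ> chart_inv c) (snd c p) ?u \<noteq> 0 \<and>
      - (fderiv (f \<circ> chart_inv c) (snd c p) ?u \<bullet> fderiv (\<nu> \<circ> chart_inv c) (snd c p) ?u) /
        (fderiv (\<nu> \<circ> chart_inv c) (snd c p) ?u \<bullet> fderiv (\<nu> \<circ> chart_inv c) (snd c p) ?u) = offset p \<and>
      offset p *\<^sub>R \<nu> p = offset p *\<^sub>R \<gamma> s"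
  proof -
    obtain U \<nu> where U: "p \<in> U" "local_unit_normal cylinder f E U \<nu>" using frontalD(4)[OF fr p] by blast
    note U' = local_unit_normalD[OF U(2)]
    show ?thesis
    proof (cases "tube p \<bullet> vderiv T s = 0")
      case True
      have "?u \<noteq> 0"
      proof
        assume "?u = 0"
        then have "horizontal s x = 0" using J linear_0[OF linear_cylinder_tangent[OF c]] by simp
        then show False by (simp add: horizontal_def zero_prod_def)
      qed
      then have "fderiv (\<nu> \<circ> chart_inv c) (snd c p) ?u \<noteq> 0"
        using front_immersed[OF cc1_frontD(1)[OF cc] U(2,1) c, of ?u] dF True by auto
      then show ?thesis
        using U True dF by (intro exI[of _ U] exI[of _ \<nu>]) (simp add: offset_def px)
    next
      case False
      \<comment> \<open>Where f \<bullet> T' is not zero the given bundle E is the one defined by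
        \<gamma>, so that \<gamma> becomes a local unit normal of f and E near p.\<close>
      define W where "W = {q \<in> U. tube q \<bullet> vderiv T (fst q) \<in> - {0}}"
      have W: "openin (mtop cylinder) W"
        unfolding W_def
      proof (rule smooth_fun_on_continuous_map[OF M U'(1)])
        show "smooth_fun_on cylinder U (\<lambda>q. tube q \<bullet> vderiv T (fst q))"
          by (rule smooth_fun_on_cylinderI[OF U'(1) subset_UNIV])
            (auto intro!: smooth_intros smooth_tube smooth_on_curve_fst smooth_on_vector_derivative smooth_T)
      qed auto
      have E: "E q = {w. w \<bullet> f q = 0 \<and> w \<bullet> \<gamma> (fst q) = 0}" if q: "q \<in> W" for q
      proof -
        have qU: "q \<in> U" and nz: "tube q \<bullet> vderiv T (fst q) \<noteq> 0" using q by (auto simp: W_def)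
        define k where "k = \<nu> q \<bullet> \<gamma> (fst q)"
        have nu: "\<nu> q = k *\<^sub>R \<gamma> (fst q)"
          unfolding k_def by (rule local_unit_normal_parallel_gamma[OF ft U(2) qU nz])
        then have "k \<noteq> 0" using U'(3)[OF qU] by auto
        then show ?thesis unfolding U'(6)[OF qU] nu by simp
      qed
      have "local_unit_normal cylinder f E W gamma_fst"
        by (rule local_unit_normal_gamma[OF ft W E])
      moreover have "p \<in> W" using U(1) False by (simp add: W_def px)
      moreover have dN: "fderiv (gamma_fst \<circ> chart_inv c) (snd c p) ?u = v s *\<^sub>R T s"
        unfolding fderiv_gamma_fst[OF c] J by (simp add: horizontal_def px gamma')
      moreover have "v s *\<^sub>R T s \<noteq> 0" using v_pos[of s] T_T[of s] by auto
      moreover have "- (- (tube p \<bullet> vderiv T s) *\<^sub>R T s \<bullet> v s *\<^sub>R T s) / (v s *\<^sub>R T s \<bullet> v s *\<^sub>R T s) = offset p"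
        using v_pos[of s] by (simp add: T_T offset_def px)
      ultimately show ?thesis
        using dF by (intro exI[of _ W] exI[of _ gamma_fst]) (simp add: px)
    qed
  qed
  then obtain U \<nu> where U: "p \<in> U" "local_unit_normal cylinder f E U \<nu>"
    and nz: "fderiv (\<nu> \<circ> chart_inv c) (snd c p) ?u \<noteq> 0"
    and rho: "- (fderiv (f \<circ> chart_inv c) (snd c p) ?u \<bullet> fderiv (\<nu> \<circ> chart_inv c) (snd c p) ?u) /
        (fderiv (\<nu> \<circ> chart_inv c) (snd c p) ?u \<bullet> fderiv (\<nu> \<circ> chart_inv c) (snd c p) ?u) = offset p"
    and on: "offset p *\<^sub>R \<nu> p = offset p *\<^sub>R \<gamma> s" by blast
  show "p \<notin> umbilics cylinder f E" using umbilics_iff[OF cc n' U(2,1) c] nz by blast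
  note chart = caustic_chart_of_front[OF cc U(2) cM(1), of ?u]
  show "caustic cylinder f E p = (1 / sqrt (1 + (offset p)\<^sup>2)) *\<^sub>R focal p"
    unfolding caustic_eq[OF cc dim' U(2,1) c nz] caustic_chart.C_def[OF chart] caustic_chart.\<rho>_def[OF chart] rho
    unfolding comp_def ip focal_def using on bspec[OF ft p] by (simp add: px)
qed

section \<open>The centre curve of the caustic of a tube\<close>

lemma focal_T: "focal (s, x) \<bullet> T s = 0"
  and focal_T': "focal (s, x) \<bullet> vderiv T s = 0"
  and focal_e: "focal (s, x) \<bullet> e i s = x $ i"
  and focal_gamma: "focal (s, x) \<bullet> \<gamma> s = offset (s, x)"
  and focal_focal: "focal (s, x) \<bullet> focal (s, x) = x \<bullet> x + (offset (s, x))\<^sup>2"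
proof -
  have "\<gamma> s \<bullet> tube (s, x) = 0" "\<gamma> s \<bullet> e i s = 0"
    using tube_gamma e_gamma by (simp_all add: inner_commute)
  then show "focal (s, x) \<bullet> T s = 0" "focal (s, x) \<bullet> vderiv T s = 0" "focal (s, x) \<bullet> e i s = x $ i"
    "focal (s, x) \<bullet> \<gamma> s = offset (s, x)" "focal (s, x) \<bullet> focal (s, x) = x \<bullet> x + (offset (s, x))\<^sup>2"
    using v_pos[of s]
    by (simp_all add: focal_def inner_add_left inner_add_right tube_T gamma_T gamma_T' tube_e tube_gamma
        gamma_gamma tube_tube power2_eq_square, simp add: offset_def)
qed

lemma focal_nonzero: "x \<noteq> 0 \<Longrightarrow> focal (s, x) \<noteq> 0"
  using focal_focal[of s x] inner_gt_zero_iff[of x] zero_le_power2[of "offset (s, x)"]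
  by (auto simp: add_nonneg_eq_0_iff)

lemma smooth_focal: "open A \<Longrightarrow> smooth_on focal A"
  unfolding focal_def[abs_def] offset_def[abs_def]
  by (intro smooth_intros smooth_tube smooth_on_curve_fst smooth_on_vector_derivative smooth_T
      smooth_gamma smooth_v less_imp_neq[OF v_pos, symmetric])

lemma T'_nonzero: "vderiv T s \<noteq> 0"
  using gamma_T'(1)[of s] v_pos[of s] by auto

lemma regular_T: "regular_curve T"
  unfolding regular_curve_def using smooth_T T'_nonzero by (simp add: norm_eq_1 T_T)

text \<open>Cauchy-Schwarz for \<gamma> \<bullet> T' = - |\<gamma>'|. It compares the arc lengths of
  \<gamma> and T and so hands completeness on to T.\<close>

lemma v_le_norm_T': "v s \<le> norm (vderiv T s)"
  using Cauchy_Schwarz_ineq2[of "\<gamma> s" "vderiv T s"] gamma_gamma[of s] v_pos[of s]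
  by (simp add: gamma_T' norm_eq_1[symmetric])

text \<open>The minus sign makes \<gamma> \<bullet> t positive, so that the denominator of
  \<open>rotated_frame\<close> does not vanish.\<close>

definition t where "t s = - ((1 / norm (vderiv T s)) *\<^sub>R vderiv T s)"

lemma T'_eq: "vderiv T s = - norm (vderiv T s) *\<^sub>R t s"
  using T'_nonzero[of s] by (simp add: t_def)

lemma t_t: "t s \<bullet> t s = 1"
  using T'_nonzero[of s] by (simp add: t_def power2_norm_eq_inner[symmetric] power2_eq_square)

lemma t_T: "t s \<bullet> T s = 0"
  by (simp add: t_def T'_T)

lemma gamma_t_pos: "0 < \<gamma> s \<bullet> t s"
  using T'_nonzero[of s] v_pos[of s] by (simp add: t_def gamma_T')

lemma one_plus_gamma_t: "1 + \<gamma> s \<bullet> t s \<noteq> 0"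
  using gamma_t_pos[of s] by linarith

lemma smooth_t: "smooth_on t UNIV"
  unfolding t_def[abs_def]
  by (intro smooth_intros smooth_on_vector_derivative smooth_T) (simp_all add: T'_nonzero)

text \<open>The rotation in the plane of \<open>\<gamma>\<close> and \<open>t\<close> that takes \<open>\<gamma>\<close> to \<open>t\<close> maps the frame
  of the complement of \<open>\<gamma>, T\<close> to a frame of the complement of \<open>t, T\<close>.\<close>

definition rotated_frame :: "'n \<Rightarrow> real \<Rightarrow> 'e" where
  "rotated_frame i s = e i s - ((e i s \<bullet> t s) / (1 + \<gamma> s \<bullet> t s)) *\<^sub>R (\<gamma> s + t s)"

lemma framed_T:
  assumes dim: "DIM('e) = CARD('n) + 2"
  shows "framed_curve T rotated_frame"
proof
  show "regular_curve T" by (rule regular_T)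
  show "smooth_on (rotated_frame i) UNIV" for i
    unfolding rotated_frame_def[abs_def]
    by (intro smooth_intros smooth_e smooth_t smooth_gamma open_UNIV one_plus_gamma_t)
  fix s
  let ?k = "1 + \<gamma> s \<bullet> t s"
  note k = one_plus_gamma_t[of s]
  \<comment> \<open>On vectors orthogonal to \<gamma> the rotation coincides with the reflection in
    the hyperplane orthogonal to \<gamma> + t, whose squared norm is computed here. This is why
    inner products of the frame are preserved.\<close>
  have pp: "(\<gamma> s + t s) \<bullet> (\<gamma> s + t s) = 2 * ?k"
    by (simp add: inner_add_left inner_add_right gamma_gamma t_t inner_commute)
  have ep: "e i s \<bullet> (\<gamma> s + t s) = e i s \<bullet> t s" for i
    by (simp add: inner_add_right e_gamma)
  show orth': "rotated_frame i s \<bullet> rotated_frame j s = (if i = j then 1 else 0)" for i j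
  proof -
    have expand: "(x - \<alpha> *\<^sub>R p) \<bullet> (y - \<beta> *\<^sub>R p) = x \<bullet> y - \<beta> * (x \<bullet> p) - \<alpha> * (y \<bullet> p) + \<alpha> * \<beta> * (p \<bullet> p)"
      for x y p :: 'e and \<alpha> \<beta>
      by (simp add: inner_diff_left inner_diff_right inner_commute algebra_simps)
    have cancel: "x / k * (y / k) * (2 * k) = y / k * x + x / k * y" if "k \<noteq> 0" for x y k :: real
      using that by (simp add: field_simps)
    define a where "a i = e i s \<bullet> t s" for i
    have "rotated_frame i s \<bullet> rotated_frame j s =
        e i s \<bullet> e j s - (a j / ?k) * (e i s \<bullet> (\<gamma> s + t s)) - (a i / ?k) * (e j s \<bullet> (\<gamma> s + t s))
        + (a i / ?k) * (a j / ?k) * ((\<gamma> s + t s) \<bullet> (\<gamma> s + t s))"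
      unfolding rotated_frame_def a_def[symmetric] by (rule expand)
    also have "\<dots> = e i s \<bullet> e j s - (a j / ?k) * a i - (a i / ?k) * a j + (a i / ?k) * (a j / ?k) * (2 * ?k)"
      unfolding pp ep a_def by (rule refl)
    also have "\<dots> = e i s \<bullet> e j s" unfolding cancel[OF k] by simp
    finally show ?thesis by (simp add: orth)
  qed
  have sub: "span (range (\<lambda>i. rotated_frame i s)) \<subseteq> orthogonal_comp (span {T s, vderiv T s})"
  proof (rule span_minimal[OF _ subspace_orthogonal_comp])
    have "rotated_frame i s \<bullet> T s = 0" for i
      by (simp add: rotated_frame_def inner_diff_left inner_add_left e_T gamma_T t_T)
    moreover have "rotated_frame i s \<bullet> t s = 0" for i
      using k by (simp add: rotated_frame_def inner_diff_left inner_add_left t_t add.commute)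
    then have "rotated_frame i s \<bullet> vderiv T s = 0" for i by (subst T'_eq) simp
    ultimately show "range (\<lambda>i. rotated_frame i s) \<subseteq> orthogonal_comp (span {T s, vderiv T s})"
      by (auto simp: mem_orthogonal_comp_pair)
  qed
  \<comment> \<open>Inclusion becomes equality by dimension: T and T' span a plane, and its
    complement has as many dimensions as the frame has members.\<close>
  have "T s \<noteq> vderiv T s" using T_T[of s] T'_T[of s] by auto
  moreover have "independent {T s, vderiv T s}"
  proof (rule pairwise_orthogonal_independent)
    show "pairwise orthogonal {T s, vderiv T s}" by (simp add: pairwise_def orthogonal_def T'_T)
    show "0 \<notin> {T s, vderiv T s}" using T_T[of s] T'_nonzero[of s] by auto
  qed
  ultimately have "dim (span {T s, vderiv T s}) = 2" by (subst dim_span_eq_card_independent) auto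
  moreover have "orthogonal_comp (span {T s, vderiv T s}) = {y \<in> UNIV. \<forall>x\<in>span {T s, vderiv T s}. orthogonal x y}"
    by (auto simp: orthogonal_comp_def)
  ultimately have "dim (orthogonal_comp (span {T s, vderiv T s})) + 2 = DIM('e)"
    using dim_subspace_orthogonal_to_vectors[OF subspace_span subspace_UNIV, of "{T s, vderiv T s}"] by simp
  then show "span (range (\<lambda>i. rotated_frame i s)) = orthogonal_comp (span {T s, vderiv T s})"
    using orthonormal_independent[of "\<lambda>i. rotated_frame i s", OF orth'] dim
    by (intro subspace_dim_equal subspace_span subspace_orthogonal_comp sub) simp
qed

lemma center_curve_T:
  assumes dim: "DIM('e) = CARD('n) + 2" and compl: "complete_curve \<gamma>"
    and h: "\<And>p. p \<in> points cylinder \<Longrightarrow> h p = (1 / sqrt (1 + (offset p)\<^sup>2)) *\<^sub>R focal p"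
  shows "center_curve T (h :: real \<times> (real^'n) \<Rightarrow> 'e)"
proof -
  interpret C: framed_curve T rotated_frame by (rule framed_T[OF dim])
  let ?P = "UNIV \<times> sphere 0 1 :: (real \<times> (real^'n)) set"
  \<comment> \<open>An open neighbourhood of the cylinder on which \<open>focal\<close> and
    \<open>away\<close> have no zeros, so that dividing by their norms is smooth.\<close>
  define A :: "(real \<times> (real^'n)) set" where "A = UNIV \<times> (- {0})"
  have A: "open A" "?P \<subseteq> A" by (auto simp: A_def intro!: open_Times)
  \<comment> \<open>The coordinates of the caustic point in the rotated frame.\<close>
  define \<phi> where "\<phi> s x = (\<chi> i. (focal (s, x) \<bullet> rotated_frame i s) / norm (focal (s, x)))" for s x
  define \<Phi> where "\<Phi> p = (fst p, \<phi> (fst p) (snd p))" for p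
  \<comment> \<open>Inverse construction: the caustic point is a positive multiple of f + \<rho>
    \<gamma>, so removing its component along \<gamma> and normalising gives back f.\<close>
  define away where "away p = C.tube p - (C.tube p \<bullet> \<gamma> (fst p)) *\<^sub>R \<gamma> (fst p)" for p
  define \<Psi> where "\<Psi> p = (fst p, \<chi> i. (C.tube p \<bullet> e i (fst p)) / norm (away p))" for p

  have C_T: "T s \<bullet> w = 0 \<Longrightarrow> vderiv T s \<bullet> w = 0 \<Longrightarrow> w = (\<Sum>i\<in>UNIV. (w \<bullet> rotated_frame i s) *\<^sub>R rotated_frame i s)" for s w
    using C.expansion[of w s] T'_nonzero[of s]
    by (simp add: C.T_def unit_tangent_def inner_commute)
  have tube_Phi: "C.tube (\<Phi> (s, x)) = (1 / norm (focal (s, x))) *\<^sub>R focal (s, x)" for s x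
  proof -
    have "focal (s, x) = (\<Sum>i\<in>UNIV. (focal (s, x) \<bullet> rotated_frame i s) *\<^sub>R rotated_frame i s)"
      by (rule C_T) (simp_all add: inner_commute[of _ "focal _"] focal_T focal_T')
    then have "(1 / norm (focal (s, x))) *\<^sub>R focal (s, x) =
        (1 / norm (focal (s, x))) *\<^sub>R (\<Sum>i\<in>UNIV. (focal (s, x) \<bullet> rotated_frame i s) *\<^sub>R rotated_frame i s)"
      by simp
    then show ?thesis by (simp add: C.tube_def \<Phi>_def \<phi>_def scaleR_sum_right)
  qed
  have Ctube_T': "C.tube (s, y) \<bullet> vderiv T s = 0" for s y
    using C.tube_T[of s y] T'_nonzero[of s] by (simp add: C.T_def unit_tangent_def)
  have Ctube_T: "C.tube (s, y) \<bullet> T s = 0" for s y by (rule C.tube_gamma)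
  have away_gamma: "away (s, y) \<bullet> \<gamma> s = 0" and away_T: "away (s, y) \<bullet> T s = 0" for s y
    by (simp_all add: away_def inner_diff_left gamma_gamma Ctube_T gamma_T)
  have away_nz: "away (s, y) \<noteq> 0" if y: "y \<noteq> 0" for s y
  proof
    assume "away (s, y) = 0"
    then have w: "C.tube (s, y) = (C.tube (s, y) \<bullet> \<gamma> s) *\<^sub>R \<gamma> s" by (simp add: away_def)
    \<comment> \<open>The vector would be a multiple of \<gamma> and orthogonal to T', which only
      zero is, as \<gamma> \<bullet> T' is not zero.\<close>
    have "C.tube (s, y) \<bullet> vderiv T s = (C.tube (s, y) \<bullet> \<gamma> s) * (\<gamma> s \<bullet> vderiv T s)" by (subst w) simp
    then have "C.tube (s, y) \<bullet> \<gamma> s = 0" using Ctube_T' v_pos[of s] by (simp add: gamma_T')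
    then have "C.tube (s, y) = 0" using w by simp
    then show False using C.tube_tube[of s y y] y by simp
  qed
  have away_exp: "away (s, y) = (\<Sum>i\<in>UNIV. (C.tube (s, y) \<bullet> e i s) *\<^sub>R e i s)" for s y
  proof -
    have comp: "away (s, y) \<bullet> e i s = C.tube (s, y) \<bullet> e i s" for i
      by (simp add: away_def inner_diff_left inner_commute[of "\<gamma> s"] e_gamma)
    have "away (s, y) = (\<Sum>i\<in>UNIV. (away (s, y) \<bullet> e i s) *\<^sub>R e i s)"
      by (rule expansion[OF away_gamma away_T])
    then show ?thesis by (simp only: comp)
  qed
  have tube_Psi: "tube (\<Psi> (s, y)) = (1 / norm (away (s, y))) *\<^sub>R away (s, y)" for s y
    using arg_cong[where f="(*\<^sub>R) (1 / norm (away (s, y)))", OF away_exp[of s y]]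
    by (simp add: tube_def \<Psi>_def scaleR_sum_right)

  have Phi_P: "\<Phi> p \<in> ?P" if pP: "p \<in> ?P" for p
  proof -
    obtain s x where p: "p = (s, x)" "x \<bullet> x = 1" using pP by (auto simp: norm_eq_1)
    then have "x \<noteq> 0" by auto
    then have "C.tube (\<Phi> p) \<bullet> C.tube (\<Phi> p) = 1"
      using focal_nonzero[of x s] by (simp add: p tube_Phi power2_norm_eq_inner[symmetric] power2_eq_square)
    then have "snd (\<Phi> p) \<bullet> snd (\<Phi> p) = 1" using C.tube_tube[of "fst (\<Phi> p)" "snd (\<Phi> p)" "snd (\<Phi> p)"] by simp
    then show ?thesis by (cases "\<Phi> p") (simp add: norm_eq_1)
  qed
  have Psi_P: "\<Psi> p \<in> ?P" if pP: "p \<in> ?P" for p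
  proof -
    obtain s y where p: "p = (s, y)" "y \<bullet> y = 1" using pP by (auto simp: norm_eq_1)
    then have "y \<noteq> 0" by auto
    then have "tube (\<Psi> p) \<bullet> tube (\<Psi> p) = 1"
      using away_nz[of y s] by (simp add: p tube_Psi power2_norm_eq_inner[symmetric] power2_eq_square)
    then have "snd (\<Psi> p) \<bullet> snd (\<Psi> p) = 1" using tube_tube[of "fst (\<Psi> p)" "snd (\<Psi> p)" "snd (\<Psi> p)"] by simp
    then show ?thesis by (cases "\<Psi> p") (simp add: norm_eq_1)
  qed
  have Psi_Phi: "\<Psi> (\<Phi> p) = p" if pP: "p \<in> ?P" for p
  proof -
    obtain s x where p: "p = (s, x)" "x \<bullet> x = 1" using pP by (auto simp: norm_eq_1)
    then have "x \<noteq> 0" by auto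
    let ?N = "norm (focal (s, x))"
    have N: "?N > 0" using focal_nonzero[OF \<open>x \<noteq> 0\<close>] by simp
    have fst: "fst (\<Phi> (s, x)) = s" by (simp add: \<Phi>_def)
    have "away (\<Phi> (s, x)) = (1 / ?N) *\<^sub>R (focal (s, x) - (focal (s, x) \<bullet> \<gamma> s) *\<^sub>R \<gamma> s)"
      by (simp add: away_def fst tube_Phi scaleR_diff_right)
    also have "\<dots> = (1 / ?N) *\<^sub>R tube (s, x)" unfolding focal_gamma by (simp add: focal_def)
    finally have "norm (away (\<Phi> (s, x))) = 1 / ?N * norm (tube (s, x))" using N by simp
    also have "norm (tube (s, x)) = 1" using tube_tube[of s x x] p(2) by (simp add: norm_eq_1)
    finally have na: "norm (away (\<Phi> (s, x))) = 1 / ?N" by simp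
    show ?thesis
      using N by (simp add: \<Psi>_def na fst p(1) tube_Phi focal_e vec_eq_iff)
  qed
  have Phi_Psi: "\<Phi> (\<Psi> p) = p" if pP: "p \<in> ?P" for p
  proof -
    obtain s y where p: "p = (s, y)" "y \<bullet> y = 1" using pP by (auto simp: norm_eq_1)
    then have "y \<noteq> 0" by auto
    let ?N = "norm (away (s, y))" and ?w = "C.tube (s, y)"
    have N: "?N > 0" using away_nz[OF \<open>y \<noteq> 0\<close>] by simp
    have fst: "fst (\<Psi> (s, y)) = s" by (simp add: \<Psi>_def)
    have "tube (\<Psi> (s, y)) \<bullet> vderiv T s = (1 / ?N) * (away (s, y) \<bullet> vderiv T s)" by (simp add: tube_Psi)
    also have "away (s, y) \<bullet> vderiv T s = (?w \<bullet> \<gamma> s) * v s"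
      by (simp add: away_def inner_diff_left Ctube_T' gamma_T')
    finally have "offset (\<Psi> (s, y)) = (?w \<bullet> \<gamma> s) / ?N"
      using v_pos[of s] by (simp add: offset_def fst)
    then have foc: "focal (\<Psi> (s, y)) = (1 / ?N) *\<^sub>R ?w"
      by (simp add: focal_def fst tube_Psi away_def scaleR_diff_right)
    have "norm ?w = 1" using C.tube_tube[of s y y] p(2) by (simp add: norm_eq_1)
    then have "norm (focal (\<Psi> (s, y))) = 1 / ?N" using N by (simp add: foc)
    then have "\<phi> (fst (\<Psi> (s, y))) (snd (\<Psi> (s, y))) = (\<chi> i. ?w \<bullet> rotated_frame i s)"
      using N unfolding \<phi>_def prod.collapse by (simp add: foc fst)
    also have "\<dots> = y" by (simp add: vec_eq_iff C.tube_e)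
    finally show ?thesis by (simp add: \<Phi>_def p(1)) (simp add: fst)
  qed

  have smooth_Phi: "smooth_on \<Phi> A"
    unfolding \<Phi>_def[abs_def] \<phi>_def prod.collapse
    by (intro smooth_intros smooth_focal smooth_on_curve_fst C.smooth_e A(1))
      (auto simp: A_def focal_nonzero)
  have smooth_Psi: "smooth_on \<Psi> A"
  proof -
    have "smooth_on away A"
      unfolding away_def[abs_def] by (intro smooth_intros C.smooth_tube smooth_on_curve_fst smooth_gamma A(1))
    then show ?thesis
      unfolding \<Psi>_def[abs_def]
      by (intro smooth_intros C.smooth_tube smooth_on_curve_fst smooth_e A(1)) (auto simp: A_def away_nz)
  qed
  have bij: "bij_betw \<Phi> ?P ?P"
    by (rule bij_betwI[where g=\<Psi>]) (use Phi_P Psi_P Psi_Phi Phi_Psi in auto)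
  have inv: "inv_into ?P \<Phi> p = \<Psi> p" if "p \<in> ?P" for p
    using inv_into_f_f[OF bij_betw_imp_inj_on[OF bij] Psi_P[OF that]] Phi_Psi[OF that] by simp
  have diffeo: "diffeomorphism cylinder cylinder \<Phi>"
    unfolding diffeomorphism_def points_cylinder
  proof (intro conjI bij)
    show "smooth_map cylinder cylinder \<Phi>"
      by (rule smooth_map_cylinderI[OF smooth_Phi A(2)]) (use Phi_P in blast)
    show "smooth_map cylinder cylinder (inv_into ?P \<Phi>)"
      by (rule smooth_map_cylinderI[OF smooth_Psi A(2)]) (use Psi_P inv in blast)
  qed
  have "complete_curve T"
    by (rule complete_curve_mono[OF reg compl regular_T]) (use v_le_norm_T' in \<open>simp add: v_def\<close>)
  then have "developable_tube T C.tube"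
    unfolding developable_tube_def
    by (intro conjI regular_T exI[of _ rotated_frame] allI ballI)
      (simp_all add: C.smooth_e C.orth C.spn C.tube_def)
  moreover have "h p = C.tube (\<Phi> p)" if p: "p \<in> ?P" for p
  proof -
    obtain s x where px: "p = (s, x)" "x \<bullet> x = 1" using p by (auto simp: norm_eq_1)
    have "norm (focal (s, x)) = sqrt (1 + (offset (s, x))\<^sup>2)"
      using focal_focal[of s x] px(2) by (simp add: norm_eq_sqrt_inner)
    then show ?thesis using h[of p] p by (simp add: px(1) tube_Phi)
  qed
  ultimately show ?thesis
    unfolding center_curve_def
    using regular_T diffeo by (intro conjI exI[of _ C.tube] exI[of _ \<Phi>] exI[of _ \<phi>]) (auto simp: \<Phi>_def)
qed

end

theorem proposition3p7:
  assumes "CARD('n::finite) \<ge> 2"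
    and "CARD('m::finite) = CARD('n) + 2"
  shows
    "(\<forall>(M :: ('a, real^'n) manifold) (f :: 'a \<Rightarrow> real^'m) E.
        cc1_front M f E \<and> \<not> totally_geodesic M f E \<longrightarrow>
        (let M' = open_submanifold M (points M - umbilics M f E); fC = caustic M f E
         in \<exists>E'. cc1_front M' fC E' \<and> umbilics M' fC E' = {}))
     \<and>
     (\<forall>(\<gamma> :: real \<Rightarrow> real^'m) (f :: real \<times> (real^'n) \<Rightarrow> real^'m).
        developable_tube \<gamma> f \<longrightarrow>
        (\<exists>E. cc1_front cylinder f E \<and> \<not> totally_geodesic cylinder f E) \<and>
        (\<forall>E. cc1_front cylinder f E \<and> \<not> totally_geodesic cylinder f E \<longrightarrow>
             umbilics cylinder f E = {} \<and>
             center_curve (unit_tangent \<gamma>) (caustic cylinder f E)))"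
proof (intro conjI allI impI)
  fix M :: "('a, real^'n) manifold" and f :: "'a \<Rightarrow> real^'m" and E
  assume "cc1_front M f E \<and> \<not> totally_geodesic M f E"
  then show "let M' = open_submanifold M (points M - umbilics M f E); fC = caustic M f E
         in \<exists>E'. cc1_front M' fC E' \<and> umbilics M' fC E' = {}"
    unfolding Let_def using caustic_cc1_front[of M f E] assms by simp
next
  fix \<gamma> :: "real \<Rightarrow> real^'m" and f :: "real \<times> (real^'n) \<Rightarrow> real^'m"
  assume tube: "developable_tube \<gamma> f"
  then obtain e :: "'n \<Rightarrow> real \<Rightarrow> real^'m" where curve: "regular_curve \<gamma>" "complete_curve \<gamma>"
    and e: "\<And>i. smooth_on (e i) UNIV" "\<And>s i j. e i s \<bullet> e j s = (if i = j then 1 else 0)"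
      "\<And>s. span (range (\<lambda>i. e i s)) = orthogonal_comp (span {\<gamma> s, vderiv \<gamma> s})"
    and f: "\<And>s x. x \<in> sphere 0 1 \<Longrightarrow> f (s, x) = (\<Sum>i\<in>UNIV. x $ i *\<^sub>R e i s)"
    unfolding developable_tube_def by blast
  interpret framed_curve \<gamma> e by unfold_locales (use curve e in auto)
  have ft: "\<forall>p\<in>points cylinder. f p = framed_curve.tube e p"
    using f by (auto simp: tube_def)
  have dim: "DIM(real^'m) = CARD('n) + 2" using assms(2) by simp
  show "\<exists>E. cc1_front cylinder f E \<and> \<not> totally_geodesic cylinder f E"
    by (rule tube_cc1_front[OF ft])
  fix E assume "cc1_front cylinder f E \<and> \<not> totally_geodesic cylinder f E"
  then have cc: "cc1_front cylinder f E" by blast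
  show "umbilics cylinder f E = {}"
    using tube_caustic(1)[OF ft cc dim assms(1)] by (auto simp: umbilics_def)
  show "center_curve (unit_tangent \<gamma>) (caustic cylinder f E)"
    using center_curve_T[OF dim curve(2) tube_caustic(2)[OF ft cc dim assms(1)]] by (simp add: T_def)
qed

end
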